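(* Let $d$ be odd, let $\mathcal C$ be a cyclic $A_\infty$-category of degree $d$ with underlying collection of cyclic chain complexes $V_B$, $B=\mathrm{Ob}\,\mathcal C$, let $I\in MCE(\mathcal F^{fr}(V_B))$ be its Hamiltonian and $I^q\in MCE(\mathcal F^{pq}(V_B))$ a quantization of it. There are Maurer–Cartan elements $$D\in MCE(\mathcal{RT}_B)\quad\text{and}\quad S\in MCE(s\mathcal{RG}_B[[\gamma]])$$ such that $p(S)=D$ and, further, $\rho_I(D)=I$ and $\rho_{I^q}(S)=I^q$. Explicitly, $D$ is the sum over all $n>2$ and all isomorphism classes of $B$-colored ribbon trees with one vertex, no internal edges and $n$ leaves, and $S$ is the sum over all $n>0$ and all isomorphism classes of $B$-colored stable ribbon graphs with one vertex, no internal edges and $n$ leaves.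
   Context: Throughout $k$ is a field of characteristic $0$; $V[1]$ is the shift for which $V$ in degree $0$ gives $V[1]$ in degree $-1$; $V^\vee$ is the linear dual; $\mathrm{Sym}(V)=\bigoplus_{n\ge0}V^{\otimes n}/S_n$; Koszul signs. $MCE$ of a complex with differential $D_0$ and compatible shifted Lie bracket denotes the set of Maurer–Cartan elements: $D_0X+\frac12\{X,X\}=0$. All algebras below carry a degree $1$ differential and a Lie bracket of degree $d-2$. Cyclic $A_\infty$-categories. A (small) $A_\infty$-category $\mathcal C$ has complexes $\mathrm{Hom}(\lambda,\mu)$ and a square-zero coderivation $m_{\mathcal C}$ of $\mathrm{Bar}\,\mathcal C=\bigoplus_{n\geq 1}\bigoplus\mathrm{Hom}(\lambda_0,\lambda_1)[1]\otimes\cdots\otimes\mathrm{Hom}(\lambda_{n-1},\lambda_n)[1]$ commuting with the internal differential $d$, with $m_1=0$. $\mathrm{Cyc}^*_+(\mathcal C)$ is the linear dual of $\ker(1-t)[-1]$, $t$ = signed cyclic permutation on tensors with $\lambda_n=\lambda_0$ (zero on others); elements of $\mathrm{Cyc}^*_+(\mathcal C)[-1]$ are cyclic words $(a_1\cdots a_n)$ in letters from the $\mathrm{Hom}(\lambda,\mu)^\vee[-1]$ with cyclically matching boundary conditions. $\mathcal C$ is cyclic of degree $d$ if there are symmetric non-degenerate chain maps $\langle\cdot,\cdot\rangle:\mathrm{Hom}(\mu,\lambda)\otimes\mathrm{Hom}(\lambda,\mu)\to k[-d]$ with $\langle(m_{\mathcal C}+d)\cdot,\cdot\rangle$ cyclically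 symmetric; the Hamiltonian is $I=\langle m_{\mathcal C}\cdot,\cdot\rangle$. $V_B$ is the collection of complexes with pairings obtained by forgetting $m_{\mathcal C}$. $\langle\cdot,\cdot\rangle^{-1}$ is the inverse pairing on letters (zero if boundary conditions do not match). $\mathcal F^{fr}(V_B)=\mathrm{Sym}(\mathrm{Cyc}^*_+(V_B)[-1])$ has differential $d$ and the bracket extending by Leibniz $\{(a_1\cdots a_n),(b_1\cdots b_m)\}=\sum_{i,j}\pm\langle a_i,b_j\rangle^{-1}(a_{i+1}\cdots a_{i-1}b_{j+1}\cdots b_{j-1})$ ($n+m>2$; zero for $n=m=1$). $\mathrm{Cyc}^*(V_B)=\mathrm{Cyc}^*_+(V_B)\times(\prod_{\lambda\in B}k\nu_\lambda)[1]$ has the same bracket except that the $\nu_\lambda$ are central and $\{(a),(b)\}=\langle a,b\rangle^{-1}\nu_\lambda$ for $a,b\in\mathrm{Hom}(\lambda,\lambda)^\vee[-1]$ (zero for other one-letter words). The cobracket is $\nabla(a_1\cdots a_n)=\sum_{i<j}\pm\langle a_i,a_j\rangle^{-1}(a_{i+1}\cdots a_{j-1})\otimes(a_{j+1}\cdots a_na_1\cdots a_{i-1})$, with an empty word replaced by $\nu_\lambda$, $\lambda$ the object at that position; $\nabla\nu_\lambda=0$. With $|\gamma|=6-2d$, $\mathcal F^{pq}(V_B)=(\mathrm{Sym}(\mathrm{Cyc}^*(V_B)[d-4])[[\gamma]][3-d],\,d+\nabla+\gamma\delta,\,\{\cdot,\cdot\})$, with $d,\nabla$ extended as derivations and $\delta$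 the Chevalley–Eilenberg differential of the bracket. A quantization of $\mathcal C$ is $I^q\in MCE(\mathcal F^{pq}(V_B))$ of degree $3-d$, without constant terms (i.e. zero component in the ground field and in the span of the $\nu$'s), whose image under the projection to $\mathrm{Sym}^1$, $\gamma=\nu=0$, is $I$. Graphs. A $B$-colored stable ribbon graph $\Gamma$: a finite set $H$ of half-edges, a partition of $H$ into vertices, an involution $\sigma_1$ of $H$ (fixed points: leaves; 2-cycles: internal edges), for each vertex $v$ a partition of its half-edges into $c(v)$ cyclically ordered cycles, and defects $g(v),b_\lambda(v)\in\mathbb N_{\ge0}$ ($\lambda\in B$), with $|v|\ge3$ whenever all defects of $v$ vanish and $c(v)=1$. With $\sigma_0$ given by the cyclic orders, faces are the cycles of $\sigma_0^{-1}\sigma_1$; a free boundary of a face is a pair of cyclically consecutive leaves in it (a face without leaves counts as one free boundary); each free boundary is colored by an element of $B$. Orientation: an ordering of the internal edges. Arithmetic genus: $g(\Gamma)=1-v+\frac12(e+c-f)+\sum_vg(v)$ (numbers of vertices, internal edges, cycles, faces). Ribbon tree: connected, all defects zero, $c(v)=1$ for all $v$, one face and genus $0$. Contracting an internal edge $e$: (1) if $e$ joins distinct vertices, they merge, the two cycles containing its ends coalesce, defects add; if both cycles are single half-edges they are deleted and $b_\lambda$ increases by $1$, $\lambda$ the color of the face they form (not contractible if these were the only cycles of both vertices). (2) If $e$ is a loop joining distinct cycles of $v$, these coalesce and $g(v)$ increases by $1$; if both are single half-edges they are deleted and both $g(v)$ and $b_\lambda(v)$ increase by $1$. (3) If $e$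 is a loop with both ends in one cycle, the cycle splits into two; if the ends are adjacent it does not split but $b_\lambda$ increases by $1$ for the color $\lambda$ of the enclosed face; if the cycle consists only of the ends of $e$, it is deleted and the boundary defect increases by one for each of the two enclosed face colors (not contractible if $v$ has no other cycle). $s\mathcal{RG}^B_c$ is spanned by isomorphism classes of connected oriented $B$-colored stable ribbon graphs modulo (orientation reversal $=-1$), graded by internal edges, $\partial\Gamma=\sum_e\Gamma/e$; $\mathcal{RT}^B_c$ is the subcomplex of ribbon trees. Put $s\mathcal{RG}_B[[\gamma]]=\mathrm{Sym}((s\mathcal{RG}^B_c)^\vee[2d-6])[[\gamma]][3-d]$ and $\mathcal{RT}_B=\mathrm{Sym}((\mathcal{RT}^B_c)^\vee[d-3])$. In the dual bases: $d$ is dual to $\partial$; $\{\Gamma_1,\Gamma_2\}$ sums over isomorphism classes obtained by gluing a leaf of $\Gamma_1$ to a leaf of $\Gamma_2$ (orientation: edges of $\Gamma_1$, new edge, edges of $\Gamma_2$), extended by Leibniz; $\nabla$ (resp. $\delta_i$) is the derivation summing over gluings of two leaves of a connected graph in the same face (resp. different faces), new edge first; $\delta_e$ is the Chevalley–Eilenberg differential of the bracket. $\mathcal{RT}_B$ has differential $-d$; $s\mathcal{RG}_B[[\gamma]]$ has differential $-d+\nabla+\delta_i+\gamma\delta_e$. $p:s\mathcal{RG}_B[[\gamma]]\to\mathcal{RT}_B$ projects to $\mathrm{Sym}^1$, $\gamma=0$, then restricts to ribbon trees. The maps $\rho$. For a connected stable ribbon graph $\Gamma$, let $I^q|_v$ be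 the component of $I^q$ with $\gamma$-power $g(v)$, $\nu$-part $\prod_\lambda\nu_\lambda^{b_\lambda(v)}$, and symmetric products of $c(v)$ cyclic words of lengths and boundary conditions prescribed by the cycles at $v$ and the coloring, viewed as an invariant tensor. $\rho_{I^q}(\Gamma)$ is obtained from $\bigotimes_vI^q|_v$ by contracting with $\langle\cdot,\cdot\rangle^{-1}$ along the internal edges (in the order of the orientation), projecting the leaf factors to the symmetric product, over faces with leaves, of the corresponding cyclic words, and multiplying by $\gamma^{g(\Gamma)}\prod_{v,\lambda}\nu_\lambda^{b_\lambda(v)}\prod_{\text{faces without leaves}}\nu_{\text{color}}$; it is extended multiplicatively and $\gamma$-linearly to $\rho_{I^q}:s\mathcal{RG}_B[[\gamma]]\to\mathcal F^{pq}(V_B)$. $\rho_I:\mathcal{RT}_B\to\mathcal F^{fr}(V_B)$ is given by the same recipe with $I$ on ribbon trees.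
   Formalization: Graphs are restricted to those with a leaf in every component; "without constant terms" excludes all terms without cyclic words (also powers of γ and products of ν's); the bracket of graphs counts gluings with multiplicity, dual to cutting edges; Hom spaces are finite dimensional. *)

theory Defs
  imports Complex_Main "HOL-Library.Multiset" "HOL-Library.Disjoint_Sets"
    "HOL-Combinatorics.Permutations" "HOL-Combinatorics.Orbits"
begin

section \<open>Koszul signs\<close>

definition psign :: "int \<Rightarrow> 'k::field_char_0" where
  "psign n = (if even n then 1 else - 1)"

definition before :: "'a list \<Rightarrow> 'a \<Rightarrow> 'a \<Rightarrow> bool" where
  "before xs a b \<longleftrightarrow> (\<exists>i j. i < j \<and> j < length xs \<and> xs ! i = a \<and> xs ! j = b)"

text \<open>The sign of rearranging the graded symbols \<open>xs\<close> (no repetitions) into the order \<open>ys\<close>.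
  With constant degree 1 it is the sign of the rearranging permutation.\<close>

definition ksign :: "('a \<Rightarrow> int) \<Rightarrow> 'a list \<Rightarrow> 'a list \<Rightarrow> 'k::field_char_0" where
  "ksign dg xs ys =
     (- 1) ^ card {(a, b). before xs a b \<and> before ys b a \<and> odd (dg a) \<and> odd (dg b)}"

abbreviation reorder_sign :: "'a list \<Rightarrow> 'a list \<Rightarrow> 'k::field_char_0" where
  "reorder_sign \<equiv> ksign (\<lambda>_. 1)"


section \<open>Cyclic chain complexes and cyclic A-infinity categories\<close>

text \<open>The objects are the elements of the type \<open>'o\<close>. \<open>Hom V l m i\<close> is the degree \<open>i\<close> part of
  \<open>Hom(l, m)\<close>, a subspace of an ambient vector space. \<open>pair V m l i u v\<close> is the pairing of
  \<open>u \<in> Hom(m, l)\<close> of degree \<open>i\<close> with \<open>v \<in> Hom(l, m)\<close> of degree \<open>d - i\<close>; for other degrees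
  of \<open>v\<close> the pairing vanishes for degree reasons and is not recorded.\<close>

record ('o, 'k, 'v) complexes =
  smul :: "'k \<Rightarrow> 'v \<Rightarrow> 'v"
  Hom :: "'o \<Rightarrow> 'o \<Rightarrow> int \<Rightarrow> 'v set"
  dif :: "'o \<Rightarrow> 'o \<Rightarrow> int \<Rightarrow> 'v \<Rightarrow> 'v"
  pair :: "'o \<Rightarrow> 'o \<Rightarrow> int \<Rightarrow> 'v \<Rightarrow> 'v \<Rightarrow> 'k"

text \<open>A homogeneous morphism: its source object, its (unshifted) degree and the vector. The target
  is determined by the position in a path or cyclic word.\<close>

type_synonym ('o, 'v) arrow = "'o \<times> int \<times> 'v"

record ('o, 'k, 'v) ainf = "('o, 'k, 'v) complexes" +
  mult :: "('o, 'v) arrow list \<Rightarrow> 'o \<Rightarrow> 'v"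

definition lin_on ::
  "('k \<Rightarrow> 'v \<Rightarrow> 'v) \<Rightarrow> ('k \<Rightarrow> 'w \<Rightarrow> 'w) \<Rightarrow> 'v set \<Rightarrow> ('v::ab_group_add \<Rightarrow> 'w::ab_group_add) \<Rightarrow> bool"
  where
  "lin_on s t S f \<longleftrightarrow>
     (\<forall>x\<in>S. \<forall>y\<in>S. f (x + y) = f x + f y) \<and> (\<forall>c. \<forall>x\<in>S. f (s c x) = t c (f x))"

text \<open>Non-degeneracy includes that every \<open>Hom(l, m)\<close> is finite dimensional, so that the inverse
  pairing exists.\<close>

definition cyclic_complexes ::
  "int \<Rightarrow> ('o, 'k::field_char_0, 'v::ab_group_add, 'z) complexes_scheme \<Rightarrow> bool" where
  "cyclic_complexes d V \<longleftrightarrow>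
     vector_space (smul V) \<and>
     (\<forall>l m i. module.subspace (smul V) (Hom V l m i) \<and>
        (\<exists>A. finite A \<and> Hom V l m i = module.span (smul V) A)) \<and>
     (\<forall>l m. finite {i. Hom V l m i \<noteq> {0}}) \<and>
     (\<forall>l m i. lin_on (smul V) (smul V) (Hom V l m i) (dif V l m i) \<and>
        (\<forall>x \<in> Hom V l m i. dif V l m i x \<in> Hom V l m (i + 1) \<and>
           dif V l m (i + 1) (dif V l m i x) = 0)) \<and>
     (\<forall>l m i. \<forall>u \<in> Hom V m l i. lin_on (smul V) (*) (Hom V l m (d - i)) (pair V m l i u)) \<and>
     (\<forall>l m i. \<forall>v \<in> Hom V l m (d - i). lin_on (smul V) (*) (Hom V m l i) (\<lambda>u. pair V m l i u v)) \<and>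
     (\<forall>l m i. \<forall>u \<in> Hom V m l i. \<forall>v \<in> Hom V l m (d - i).
        pair V m l i u v = psign (i * (d - i)) * pair V l m (d - i) v u) \<and>
     (\<forall>l m i. \<forall>u \<in> Hom V m l i. u \<noteq> 0 \<longrightarrow> (\<exists>v \<in> Hom V l m (d - i). pair V m l i u v \<noteq> 0)) \<and>
     (\<forall>l m i. \<forall>u \<in> Hom V m l i. \<forall>v \<in> Hom V l m (d - 1 - i).
        pair V m l (i + 1) (dif V m l i u) v + psign i * pair V m l i u (dif V l m (d - 1 - i) v) = 0)"

text \<open>Degree in \<open>Hom[1]\<close>.\<close>

definition sdeg :: "('o, 'v) arrow \<Rightarrow> int" where
  "sdeg x = fst (snd x) - 1"

abbreviation sdegs :: "('o, 'v) arrow list \<Rightarrow> int" where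
  "sdegs xs \<equiv> sum_list (map sdeg xs)"

definition tgt :: "('o, 'v) arrow list \<Rightarrow> 'o \<Rightarrow> 'o" where
  "tgt xs t = (if xs = [] then t else fst (hd xs))"

definition is_path ::
  "('o, 'k, 'v, 'z) complexes_scheme \<Rightarrow> ('o, 'v) arrow list \<Rightarrow> 'o \<Rightarrow> bool" where
  "is_path V xs t \<longleftrightarrow>
     (\<forall>j < length xs. case xs ! j of (a, i, v) \<Rightarrow> v \<in> Hom V a (tgt (drop (Suc j) xs) t) i)"

text \<open>\<open>dif_arrow V t x\<close> applies the differential to \<open>x\<close>, which has target \<open>t\<close>;
  \<open>mult_arrow C xs t\<close> is the product of a path ending at \<open>t\<close>, which has degree \<open>1\<close> on \<open>Hom[1]\<close>.\<close>

definition dif_arrow ::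
  "('o, 'k, 'v, 'z) complexes_scheme \<Rightarrow> 'o \<Rightarrow> ('o, 'v) arrow \<Rightarrow> ('o, 'v) arrow" where
  "dif_arrow V t x = (case x of (a, i, v) \<Rightarrow> (a, i + 1, dif V a t i v))"

definition mult_arrow ::
  "('o, 'k, 'v, 'z) ainf_scheme \<Rightarrow> ('o, 'v) arrow list \<Rightarrow> 'o \<Rightarrow> ('o, 'v) arrow" where
  "mult_arrow C xs t = (fst (hd xs), sdegs xs + 2, mult C xs t)"

definition ainf_category ::
  "('o, 'k::field_char_0, 'v::ab_group_add, 'z) ainf_scheme \<Rightarrow> bool" where
  "ainf_category C \<longleftrightarrow>
     (\<forall>xs t. xs \<noteq> [] \<and> is_path C xs t \<longrightarrow>
        mult C xs t \<in> Hom C (fst (hd xs)) t (sdegs xs + 2)) \<and>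
     (\<forall>p a i q t. is_path C (p @ (a, i, 0) # q) t \<longrightarrow>
        lin_on (smul C) (smul C) (Hom C a (tgt q t) i) (\<lambda>v. mult C (p @ (a, i, v) # q) t)) \<and>
     (\<forall>x t. is_path C [x] t \<longrightarrow> mult C [x] t = 0) \<and>
     \<comment> \<open>the coderivation squares to zero\<close>
     (\<forall>xs t. xs \<noteq> [] \<and> is_path C xs t \<longrightarrow>
        (\<Sum>p<length xs. \<Sum>q\<in>{1..length xs - p}.
           smul C (psign (sdegs (take p xs)))
             (mult C (take p xs @
                mult_arrow C (take q (drop p xs)) (tgt (drop (p + q) xs) t) # drop (p + q) xs) t)) = 0) \<and>
     \<comment> \<open>and commutes, in the graded sense, with the internal differential\<close>
     (\<forall>xs t. xs \<noteq> [] \<and> is_path C xs t \<longrightarrow>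
        dif C (fst (hd xs)) t (sdegs xs + 2) (mult C xs t) +
        (\<Sum>j<length xs. smul C (psign (sdegs (take j xs)))
           (mult C (xs[j := dif_arrow C (tgt (drop (Suc j) xs) t) (xs ! j)]) t)) = 0)"

definition cword :: "('o, 'k, 'v, 'z) complexes_scheme \<Rightarrow> ('o, 'v) arrow list \<Rightarrow> bool" where
  "cword V w \<longleftrightarrow> w \<noteq> [] \<and> is_path V w (fst (hd w))"

text \<open>Sequences of cyclically composable words; functionals are evaluated on these.\<close>

definition cwords :: "('o, 'k, 'v, 'z) complexes_scheme \<Rightarrow> ('o, 'v) arrow list list \<Rightarrow> bool" where
  "cwords V ws \<longleftrightarrow> (\<forall>w \<in> set ws. cword V w)"

text \<open>\<open>\<langle>m(x\<^sub>1, \<dots>, x\<^sub>n\<^sub>-\<^sub>1), x\<^sub>n\<rangle>\<close> as an element of \<open>F\<^sup>f\<^sup>r\<close> concentrated in \<open>Sym\<^sup>1\<close>. The sign is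
  the one of transporting the pairing to the shifted spaces.\<close>

definition hamiltonian ::
  "int \<Rightarrow> ('o, 'k::field_char_0, 'v, 'z) ainf_scheme \<Rightarrow> ('o, 'v) arrow list list \<Rightarrow> 'k" where
  "hamiltonian d C ws =
     (case ws of
        [w] \<Rightarrow>
          if cword C w \<and> length w \<ge> 2 \<and> sdegs w = d - 3
          then (case mult_arrow C (butlast w) (fst (last w)) of (a, i, u) \<Rightarrow>
                  psign i * pair C a (fst (last w)) i u (snd (snd (last w))))
          else 0
      | _ \<Rightarrow> 0)"

text \<open>Cyclic symmetry of \<open>\<langle>d\<cdot>, \<cdot>\<rangle>\<close> is the chain map property of the symmetric pairing,
  which is part of \<^const>\<open>cyclic_complexes\<close>.\<close>

definition cyclic_ainf_category ::
  "int \<Rightarrow> ('o, 'k::field_char_0, 'v::ab_group_add, 'z) ainf_scheme \<Rightarrow> bool" where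
  "cyclic_ainf_category d C \<longleftrightarrow>
     cyclic_complexes d C \<and> ainf_category C \<and>
     (\<forall>x w. cword C (x # w) \<longrightarrow>
        hamiltonian d C [x # w] = psign (sdeg x * sdegs w) * hamiltonian d C [w @ [x]])"


section \<open>The algebras of cyclic words\<close>

text \<open>
  An element of \<open>F\<^sup>p\<^sup>q\<close> is represented by its coefficient functionals: \<open>F g b ws\<close> is the coefficient
  of \<open>\<gamma>\<^sup>g \<Prod>\<^sub>l \<nu>\<^sub>l\<^bsup>b(l)\<^esup>\<close>, a functional on products of cyclic words in the \<open>Hom[1]\<close>,
  evaluated on \<open>ws\<close>. A functional on \<open>ker(1 - t)\<close> is given by its values on the elements
  \<open>\<Sum>\<^sub>k t\<^sup>k(x\<^sub>1 \<otimes> \<dots> \<otimes> x\<^sub>n)\<close>, and similarly for the symmetric powers. So the product of the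
  cyclic words \<open>(a\<^sub>1 \<cdots> a\<^sub>n), (b\<^sub>1 \<cdots> b\<^sub>m), \<dots>\<close> is the functional whose value is the signed sum,
  over all rotations of each word and all permutations of the words, of the products of the
  letters evaluated on the arrows. Duals of infinite dimensional spaces being complete, symmetric
  powers are completed. As \<open>d\<close> is odd, the shifts \<open>[d - 4]\<close> and \<open>[3 - d]\<close> and the variables
  \<open>\<gamma>, \<nu>\<close> do not affect signs.
\<close>

type_synonym ('o, 'k, 'v) functional =
  "nat \<Rightarrow> 'o multiset \<Rightarrow> ('o, 'v) arrow list list \<Rightarrow> 'k"

definition functional_space ::
  "('o, 'k::field_char_0, 'v::ab_group_add, 'z) complexes_scheme \<Rightarrow> ('o, 'k, 'v) functional set" where
  "functional_space V =
     {F. (\<forall>g b ws. \<not> cwords V ws \<longrightarrow> F g b ws = 0) \<and>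
         (\<forall>g b us p a i q vs. cwords V (us @ (p @ (a, i, 0) # q) # vs) \<longrightarrow>
            lin_on (smul V) (*) (Hom V a (fst (hd (q @ p @ [(a, i, 0)]))) i)
              (\<lambda>v. F g b (us @ (p @ (a, i, v) # q) # vs))) \<and>
         (\<forall>g b x w ws. cwords V ((x # w) # ws) \<longrightarrow>
            F g b ((x # w) # ws) = psign (sdeg x * sdegs w) * F g b ((w @ [x]) # ws)) \<and>
         (\<forall>g b us u w vs. cwords V (us @ u # w # vs) \<longrightarrow>
            F g b (us @ u # w # vs) = psign (sdegs u * sdegs w) * F g b (us @ w # u # vs)) \<and>
         \<comment> \<open>for each power of \<open>\<gamma>\<close> only finitely many symmetric powers occur\<close>
         (\<forall>g. \<exists>N. \<forall>b ws. F g b ws \<noteq> 0 \<longrightarrow> size b + length ws \<le> N)}"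

text \<open>Components of degree \<open>3 - d\<close>: \<open>(a\<^sub>1 \<cdots> a\<^sub>n)\<close> has the sum of the degrees of its letters,
  \<open>\<nu>\<close> has degree \<open>0\<close>, each further symmetric factor contributes \<open>3 - d\<close>, and
  \<open>\<gamma>\<close> has degree \<open>6 - 2 d\<close>.\<close>

definition degree_pq :: "int \<Rightarrow> ('o, 'k::field_char_0, 'v) functional \<Rightarrow> bool" where
  "degree_pq d F \<longleftrightarrow>
     (\<forall>g b ws. F g b ws \<noteq> 0 \<longrightarrow>
        - sdegs (concat ws) + (3 - d) * (int (length ws) + int (size b) - 1) + (6 - 2 * d) * int g
          = 3 - d)"

text \<open>Inverse of the pairing, as an element \<open>\<Sum> u \<otimes> u'\<close> of \<open>Hom(a, b) \<otimes> Hom(b, a)\<close>, so that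
  \<open>\<langle>x, y\<rangle>\<^sup>-\<^sup>1 = \<Sum> x(u) y(u')\<close> for letters \<open>x\<close>, \<open>y\<close>. It is characterised by
  \<open>x = \<Sum> \<langle>u', x\<rangle> u\<close> for all \<open>x \<in> Hom(a, b)\<close>.\<close>

definition is_copairing ::
  "int \<Rightarrow> ('o, 'k, 'v::ab_group_add, 'z) complexes_scheme \<Rightarrow> 'o \<Rightarrow> 'o \<Rightarrow>
     (('o, 'v) arrow \<times> ('o, 'v) arrow) list \<Rightarrow> bool" where
  "is_copairing d V a b ps \<longleftrightarrow>
     (\<forall>p \<in> set ps. \<exists>i u u'. p = ((a, i, u), (b, d - i, u')) \<and> u \<in> Hom V a b i \<and> u' \<in> Hom V b a (d - i)) \<and>
     (\<forall>i. \<forall>x \<in> Hom V a b i.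
        x = (\<Sum>((_, j, u), (_, j', u')) \<leftarrow> ps. if j = i then smul V (pair V b a j' u' x) u else 0))"

definition copairing ::
  "int \<Rightarrow> ('o, 'k, 'v::ab_group_add, 'z) complexes_scheme \<Rightarrow> 'o \<Rightarrow> 'o \<Rightarrow>
     (('o, 'v) arrow \<times> ('o, 'v) arrow) list" where
  "copairing d V a b = (SOME ps. is_copairing d V a b ps)"

text \<open>\<open>labels k ws\<close> numbers the positions in \<open>ws\<close> consecutively, starting with \<open>k\<close>.\<close>

primrec labels :: "nat \<Rightarrow> 'a list list \<Rightarrow> nat list list" where
  "labels k [] = []"
| "labels k (w # ws) = [k..<k + length w] # labels (k + length w) ws"

text \<open>\<open>F\<close> evaluated on the words obtained by rearranging the arrows \<open>xs\<close> according to the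
  positions \<open>W\<close>, with the Koszul sign; \<open>eval2\<close> does the same for a product of two functionals.
  The additional sign of \<open>eval2\<close> is the parity of the first functional.\<close>

definition evalw ::
  "('o, 'k::field_char_0, 'v) functional \<Rightarrow> nat \<Rightarrow> 'o multiset \<Rightarrow> ('o, 'v) arrow list \<Rightarrow>
     nat list list \<Rightarrow> 'k" where
  "evalw F g b xs W =
     ksign (\<lambda>j. sdeg (xs ! j)) [0..<length xs] (concat W) * F g b (map (map (nth xs)) W)"

definition eval2 ::
  "('o, 'k::field_char_0, 'v) functional \<Rightarrow> ('o, 'k, 'v) functional \<Rightarrow> nat \<Rightarrow> 'o multiset \<Rightarrow> nat \<Rightarrow>
     'o multiset \<Rightarrow> ('o, 'v) arrow list \<Rightarrow> nat list list \<Rightarrow> nat list list \<Rightarrow> 'k" where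
  "eval2 F G g b g' b' xs W W' =
     psign (sdegs (map (nth xs) (concat W))) *
     ksign (\<lambda>j. sdeg (xs ! j)) [0..<length xs] (concat W @ concat W') *
     F g b (map (map (nth xs)) W) * G g' b' (map (map (nth xs)) W')"

definition src :: "('o, 'v) arrow list \<Rightarrow> nat \<Rightarrow> 'o" where
  "src w r = fst (w ! (r mod length w))"

definition pq_d ::
  "('o, 'k::field_char_0, 'v, 'z) complexes_scheme \<Rightarrow> ('o, 'k, 'v) functional \<Rightarrow> ('o, 'k, 'v) functional"
  where
  "pq_d V F g b ws =
     (\<Sum>k<length ws. \<Sum>j<length (ws ! k).
        psign (sdegs (concat (take k ws)) + sdegs (take j (ws ! k))) *
        F g b (ws[k := (ws ! k)[j := dif_arrow V (src (ws ! k) (Suc j)) (ws ! k ! j)]]))"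

text \<open>Dually to the formula for words, the cobracket inserts the inverse pairing (in positions
  \<open>0\<close> and \<open>1\<close>, to the left of all arguments) between two words, which become one; a factor
  \<open>\<nu>\<close> stands for an empty word. In the last summand both words are empty; the ordered pairs
  count each term twice.\<close>

definition pq_nabla ::
  "int \<Rightarrow> ('o, 'k::field_char_0, 'v::ab_group_add, 'z) complexes_scheme \<Rightarrow>
     ('o, 'k, 'v) functional \<Rightarrow> ('o, 'k, 'v) functional" where
  "pq_nabla d V F g b ws =
     (let L = labels 2 ws in
       (\<Sum>j<length ws. \<Sum>i<j. \<Sum>r<length (ws ! i). \<Sum>s<length (ws ! j).
          \<Sum>(e, e') \<leftarrow> copairing d V (src (ws ! j) s) (src (ws ! i) r).
            evalw F g b (e # e' # concat ws)
              ((0 # rotate r (L ! i) @ 1 # rotate s (L ! j)) # nths L (- {i, j}))) +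
       (\<Sum>l\<in>set_mset b. \<Sum>i<length ws. \<Sum>r<length (ws ! i).
          \<Sum>(e, e') \<leftarrow> copairing d V (src (ws ! i) r) l.
            evalw F g (b - {#l#}) (e # e' # concat ws) ((0 # 1 # rotate r (L ! i)) # nths L (- {i}))) +
       (\<Sum>(l, m)\<in>{(l, m). {#l, m#} \<subseteq># b}.
          \<Sum>(e, e') \<leftarrow> copairing d V l m. F g (b - {#l, m#}) ([e, e'] # ws)) / 2)"

text \<open>Chevalley--Eilenberg differential of the bracket of words. A word of the result is cut into two
  arcs, the lengths \<open>p = 0\<close> and \<open>p = length\<close> corresponding to one-letter words; \<open>\<nu>\<close> arises from
  two one-letter words. Ordered pairs of words are counted twice.\<close>

definition pq_delta ::
  "int \<Rightarrow> ('o, 'k::field_char_0, 'v::ab_group_add, 'z) complexes_scheme \<Rightarrow>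
     ('o, 'k, 'v) functional \<Rightarrow> ('o, 'k, 'v) functional" where
  "pq_delta d V F g b ws =
     (let L = labels 2 ws in
       (\<Sum>i<length ws. \<Sum>r<length (ws ! i). \<Sum>p\<le>length (ws ! i).
          \<Sum>(e, e') \<leftarrow> copairing d V (src (ws ! i) (r + p)) (src (ws ! i) r).
            evalw F g b (e # e' # concat ws)
              ((take p (rotate r (L ! i)) @ [0]) # (1 # drop p (rotate r (L ! i))) # nths L (- {i}))) / 2 +
       (\<Sum>l\<in>set_mset b. \<Sum>(e, e') \<leftarrow> copairing d V l l. F g (b - {#l#}) ([e] # [e'] # ws)) / 2)"

definition pq_gamma :: "('o, 'k::field_char_0, 'v) functional \<Rightarrow> ('o, 'k, 'v) functional" where
  "pq_gamma F g b ws = (if g = 0 then 0 else F (g - 1) b ws)"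

text \<open>The Leibniz extension of the bracket: one of the words is the bracket of a word of \<open>F\<close> with a
  word of \<open>G\<close>, and \<open>A\<close> is the set of the remaining words belonging to \<open>F\<close>.\<close>

definition pq_bracket ::
  "int \<Rightarrow> ('o, 'k::field_char_0, 'v::ab_group_add, 'z) complexes_scheme \<Rightarrow>
     ('o, 'k, 'v) functional \<Rightarrow> ('o, 'k, 'v) functional \<Rightarrow> ('o, 'k, 'v) functional" where
  "pq_bracket d V F G g b ws =
     (let L = labels 2 ws in
       \<Sum>h\<le>g. \<Sum>c\<in>{c. c \<subseteq># b}.
         (\<Sum>i<length ws. \<Sum>A\<in>Pow ({..<length ws} - {i}). \<Sum>r<length (ws ! i). \<Sum>p\<le>length (ws ! i).
            \<Sum>(e, e') \<leftarrow> copairing d V (src (ws ! i) (r + p)) (src (ws ! i) r).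
              eval2 F G h c (g - h) (b - c) (e # e' # concat ws)
                (nths L A @ [take p (rotate r (L ! i)) @ [0]])
                ((1 # drop p (rotate r (L ! i))) # nths L (- insert i A))) +
         (\<Sum>l\<in>set_mset (b - c). \<Sum>A\<in>Pow {..<length ws}.
            \<Sum>(e, e') \<leftarrow> copairing d V l l.
              eval2 F G h c (g - h) (b - c - {#l#}) (e # e' # concat ws)
                (nths L A @ [[0]]) ([1] # nths L (- A))))"

definition MCE_pq ::
  "int \<Rightarrow> ('o, 'k::field_char_0, 'v::ab_group_add, 'z) complexes_scheme \<Rightarrow> ('o, 'k, 'v) functional set"
  where
  "MCE_pq d V =
     {F \<in> functional_space V. degree_pq d F \<and>
        (\<forall>g b ws. cwords V ws \<longrightarrow>
           pq_d V F g b ws + pq_nabla d V F g b ws + pq_gamma (pq_delta d V F) g b ws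
             + pq_bracket d V F F g b ws / 2 = 0)}"

text \<open>An element of \<open>F\<^sup>f\<^sup>r\<close> is a functional not involving \<open>\<gamma>\<close> and \<open>\<nu>\<close>. The bracket of \<open>F\<^sup>f\<^sup>r\<close>
  is the one above without the terms producing \<open>\<nu>\<close>, which are those from two one-letter words.\<close>

definition fr_incl :: "(('o, 'v) arrow list list \<Rightarrow> 'k) \<Rightarrow> ('o, 'k::field_char_0, 'v) functional" where
  "fr_incl I g b ws = (if g = 0 \<and> b = {#} then I ws else 0)"

definition MCE_fr ::
  "int \<Rightarrow> ('o, 'k::field_char_0, 'v::ab_group_add, 'z) complexes_scheme \<Rightarrow>
     (('o, 'v) arrow list list \<Rightarrow> 'k) set" where
  "MCE_fr d V =
     {I. fr_incl I \<in> functional_space V \<and>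
        (\<forall>ws. I ws \<noteq> 0 \<longrightarrow> - sdegs (concat ws) = 3 - d) \<and>
        (\<forall>ws. cwords V ws \<longrightarrow>
           pq_d V (fr_incl I) 0 {#} ws + pq_bracket d V (fr_incl I) (fr_incl I) 0 {#} ws / 2 = 0)}"

text \<open>A constant term is one without cyclic words.\<close>

definition is_quantization ::
  "int \<Rightarrow> ('o, 'k::field_char_0, 'v::ab_group_add, 'z) ainf_scheme \<Rightarrow> ('o, 'k, 'v) functional \<Rightarrow> bool"
  where
  "is_quantization d C F \<longleftrightarrow>
     F \<in> MCE_pq d (complexes.truncate C) \<and>
     (\<forall>g b. F g b [] = 0) \<and>
     (\<lambda>ws. if length ws = 1 then F 0 {#} ws else 0) = hamiltonian d C"


section \<open>Colored stable ribbon graphs\<close>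

text \<open>
  Half-edges are labelled by natural numbers. \<open>sig1\<close> is the involution, \<open>sig0\<close> the successor in the
  cyclic orders, and the cycles at a vertex are the orbits of \<open>sig0\<close> in it. The orientation
  \<open>ori\<close> lists the internal edges \<open>{h, sig1 h}\<close>.

  \<open>col h\<close> is the color of the boundary passing through the corner between the predecessor of \<open>h\<close>
  and \<open>h\<close>. The corner between \<open>h\<close> and \<open>sig0 h\<close> continues along an internal edge \<open>h\<close> into
  the corner before \<open>sig1 h\<close> and ends at \<open>h\<close> if \<open>h\<close> is a leaf. So functions
  constant along internal edges are precisely the colorings of the free boundaries; the free
  boundary between consecutive leaves starts at the corner before a leaf.
\<close>

record 'o rgraph =
  hes :: "nat set"
  vts :: "nat set set"
  sig0 :: "nat \<Rightarrow> nat"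
  sig1 :: "nat \<Rightarrow> nat"
  gdf :: "nat set \<Rightarrow> nat"
  bdf :: "nat set \<Rightarrow> 'o multiset"
  col :: "nat \<Rightarrow> 'o"
  ori :: "nat set list"

definition leaves :: "'o rgraph \<Rightarrow> nat set" where
  "leaves \<Gamma> = {h \<in> hes \<Gamma>. sig1 \<Gamma> h = h}"

definition edges :: "'o rgraph \<Rightarrow> nat set set" where
  "edges \<Gamma> = {{h, sig1 \<Gamma> h} | h. h \<in> hes \<Gamma> - leaves \<Gamma>}"

definition cyc :: "'o rgraph \<Rightarrow> nat \<Rightarrow> nat set" where
  "cyc \<Gamma> h = orbit (sig0 \<Gamma>) h"

definition face :: "'o rgraph \<Rightarrow> nat \<Rightarrow> nat set" where
  "face \<Gamma> h = orbit (inv (sig0 \<Gamma>) \<circ> sig1 \<Gamma>) h"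

definition stable_ribbon_graph :: "'o rgraph \<Rightarrow> bool" where
  "stable_ribbon_graph \<Gamma> \<longleftrightarrow>
     finite (hes \<Gamma>) \<and> partition_on (hes \<Gamma>) (vts \<Gamma>) \<and>
     sig0 \<Gamma> permutes hes \<Gamma> \<and> (\<forall>v \<in> vts \<Gamma>. sig0 \<Gamma> ` v = v) \<and>
     sig1 \<Gamma> permutes hes \<Gamma> \<and> sig1 \<Gamma> \<circ> sig1 \<Gamma> = id \<and>
     (\<forall>v \<in> vts \<Gamma>. gdf \<Gamma> v = 0 \<and> bdf \<Gamma> v = {#} \<and> card (cyc \<Gamma> ` v) = 1 \<longrightarrow> card v \<ge> 3) \<and>
     (\<forall>h \<in> hes \<Gamma> - leaves \<Gamma>. col \<Gamma> (sig0 \<Gamma> h) = col \<Gamma> (sig1 \<Gamma> h)) \<and>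
     distinct (ori \<Gamma>) \<and> set (ori \<Gamma>) = edges \<Gamma>"

definition adjacent :: "'o rgraph \<Rightarrow> (nat \<times> nat) set" where
  "adjacent \<Gamma> =
     {(h, k). \<exists>v \<in> vts \<Gamma>. h \<in> v \<and> k \<in> v} \<union> {(h, sig1 \<Gamma> h) | h. h \<in> hes \<Gamma>}"

definition components :: "'o rgraph \<Rightarrow> nat set set" where
  "components \<Gamma> = (\<lambda>h. (adjacent \<Gamma>)\<^sup>* `` {h}) ` hes \<Gamma>"

definition connected_graph :: "'o rgraph \<Rightarrow> bool" where
  "connected_graph \<Gamma> \<longleftrightarrow> card (components \<Gamma>) = 1"

text \<open>The part of a graph on a union of components.\<close>

definition restrict_graph :: "'o rgraph \<Rightarrow> nat set \<Rightarrow> 'o rgraph" where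
  "restrict_graph \<Gamma> K =
     \<Gamma>\<lparr> hes := K, vts := {v \<in> vts \<Gamma>. v \<subseteq> K},
        sig0 := (\<lambda>h. if h \<in> K then sig0 \<Gamma> h else h),
        sig1 := (\<lambda>h. if h \<in> K then sig1 \<Gamma> h else h),
        ori := filter (\<lambda>e. e \<subseteq> K) (ori \<Gamma>) \<rparr>"

text \<open>For a connected graph this is the usual formula; for disconnected graphs it is additive, in
  accordance with the multiplicativity of \<open>\<gamma>\<^bsup>g(\<Gamma>)\<^esup>\<close>. The division is exact.\<close>

definition arith_genus :: "'o rgraph \<Rightarrow> int" where
  "arith_genus \<Gamma> =
     int (card (components \<Gamma>)) - int (card (vts \<Gamma>)) +
     (int (card (edges \<Gamma>)) + int (card (cyc \<Gamma> ` hes \<Gamma>)) - int (card (face \<Gamma> ` hes \<Gamma>))) div 2 +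
     (\<Sum>v \<in> vts \<Gamma>. int (gdf \<Gamma> v))"

definition ribbon_tree :: "'o rgraph \<Rightarrow> bool" where
  "ribbon_tree \<Gamma> \<longleftrightarrow>
     stable_ribbon_graph \<Gamma> \<and> connected_graph \<Gamma> \<and>
     (\<forall>v \<in> vts \<Gamma>. gdf \<Gamma> v = 0 \<and> bdf \<Gamma> v = {#} \<and> card (cyc \<Gamma> ` v) = 1) \<and>
     card (face \<Gamma> ` hes \<Gamma>) = 1 \<and> arith_genus \<Gamma> = 0"

text \<open>Isomorphisms, irrespective of the orientations.\<close>

definition graph_iso :: "(nat \<Rightarrow> nat) \<Rightarrow> 'o rgraph \<Rightarrow> 'o rgraph \<Rightarrow> bool" where
  "graph_iso f \<Gamma> \<Gamma>' \<longleftrightarrow>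
     bij_betw f (hes \<Gamma>) (hes \<Gamma>') \<and> vts \<Gamma>' = image f ` vts \<Gamma> \<and>
     (\<forall>h \<in> hes \<Gamma>. sig0 \<Gamma>' (f h) = f (sig0 \<Gamma> h) \<and> sig1 \<Gamma>' (f h) = f (sig1 \<Gamma> h) \<and>
        col \<Gamma>' (f h) = col \<Gamma> h) \<and>
     (\<forall>v \<in> vts \<Gamma>. gdf \<Gamma>' (f ` v) = gdf \<Gamma> v \<and> bdf \<Gamma>' (f ` v) = bdf \<Gamma> v)"

definition iso_rel :: "('o rgraph \<times> 'o rgraph) set" where
  "iso_rel = {(\<Gamma>, \<Gamma>'). stable_ribbon_graph \<Gamma> \<and> stable_ribbon_graph \<Gamma>' \<and> (\<exists>f. graph_iso f \<Gamma> \<Gamma>')}"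

definition automorphisms :: "'o rgraph \<Rightarrow> (nat \<Rightarrow> nat) set" where
  "automorphisms \<Gamma> = {f. f permutes hes \<Gamma> \<and> graph_iso f \<Gamma> \<Gamma>}"

subsection \<open>Contracting and cutting internal edges\<close>

text \<open>The merged vertex; for a loop it is the vertex without the half-edges of \<open>e\<close>.\<close>

definition merged_vertex :: "'o rgraph \<Rightarrow> nat set \<Rightarrow> nat set" where
  "merged_vertex \<Gamma> e = \<Union> {v \<in> vts \<Gamma>. v \<inter> e \<noteq> {}} - e"

definition contractible :: "'o rgraph \<Rightarrow> nat set \<Rightarrow> bool" where
  "contractible \<Gamma> e \<longleftrightarrow> e \<in> edges \<Gamma> \<and> merged_vertex \<Gamma> e \<noteq> {}"

definition is_loop :: "'o rgraph \<Rightarrow> nat set \<Rightarrow> bool" where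
  "is_loop \<Gamma> e \<longleftrightarrow> (\<exists>v \<in> vts \<Gamma>. e \<subseteq> v)"

definition same_cycle :: "'o rgraph \<Rightarrow> nat set \<Rightarrow> bool" where
  "same_cycle \<Gamma> e \<longleftrightarrow> (\<exists>h \<in> hes \<Gamma>. e \<subseteq> cyc \<Gamma> h)"

text \<open>If the ends of \<open>e\<close> lie in distinct cycles, a face is enclosed if both are single half-edges.
  If they lie in one cycle, a face is enclosed by each \<open>x\<close> in \<open>e\<close> directly following the
  other end.\<close>

definition enclosed_colors :: "'o rgraph \<Rightarrow> nat set \<Rightarrow> 'o multiset" where
  "enclosed_colors \<Gamma> e =
     (if same_cycle \<Gamma> e
      then image_mset (col \<Gamma>) (mset_set {x \<in> e. sig0 \<Gamma> (sig1 \<Gamma> x) = x})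
      else if \<forall>h \<in> e. sig0 \<Gamma> h = h then {# col \<Gamma> (Min e) #}
      else {#})"

text \<open>The new cyclic orders coalesce resp. split the cycles through \<open>e\<close>: a successor \<open>h \<in> e\<close> is
  replaced by the successor of the other end of \<open>e\<close>, and this once more if necessary.\<close>

definition contract :: "'o rgraph \<Rightarrow> nat set \<Rightarrow> 'o rgraph" where
  "contract \<Gamma> e =
     (let E = {v \<in> vts \<Gamma>. v \<inter> e \<noteq> {}}; w = merged_vertex \<Gamma> e;
          skip = (\<lambda>y. if y \<in> e then sig0 \<Gamma> (sig1 \<Gamma> y) else y)
      in \<Gamma>\<lparr> hes := hes \<Gamma> - e,
            vts := insert w (vts \<Gamma> - E),
            sig0 := (\<lambda>x. if x \<in> hes \<Gamma> - e then skip (skip (sig0 \<Gamma> x)) else x),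
            sig1 := (\<lambda>x. if x \<in> e then x else sig1 \<Gamma> x),
            gdf := (gdf \<Gamma>)(w := sum (gdf \<Gamma>) E +
                      (if is_loop \<Gamma> e \<and> \<not> same_cycle \<Gamma> e then 1 else 0)),
            bdf := (bdf \<Gamma>)(w := sum (bdf \<Gamma>) E + enclosed_colors \<Gamma> e),
            ori := remove1 e (ori \<Gamma>) \<rparr>)"

text \<open>Cutting an internal edge into two leaves is inverse to gluing two leaves.\<close>

definition cut :: "'o rgraph \<Rightarrow> nat set \<Rightarrow> 'o rgraph" where
  "cut \<Gamma> e = \<Gamma>\<lparr> sig1 := (\<lambda>x. if x \<in> e then x else sig1 \<Gamma> x), ori := remove1 e (ori \<Gamma>) \<rparr>"


section \<open>The algebras of graphs\<close>

text \<open>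
  An element of \<open>sRG\<^sub>B[[\<gamma>]]\<close> is represented by functions \<open>X k\<close>, the coefficient of \<open>\<gamma>\<^sup>k\<close>, on
  possibly disconnected oriented graphs: a functional on the symmetric algebra of the span of the
  connected graphs, where a product of connected graphs is their disjoint union, oriented by
  listing the edges of the factors one after the other. Each component is required to have a leaf:
  one-edge graphs without leaves are not contractible and arise by gluing leaves of one-vertex
  graphs, so that with them the sum of the latter would not be a Maurer--Cartan element. Graphs
  without leaves span a central ideal, which is divided out.
  All structures are written dually to operations on graphs, so gluing leaves becomes
  cutting edges. As \<open>d\<close> is odd, the shifts do not affect signs.
\<close>

type_synonym ('o, 'k) cochain = "nat \<Rightarrow> 'o rgraph \<Rightarrow> 'k"

definition admissible :: "'o rgraph \<Rightarrow> bool" where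
  "admissible \<Gamma> \<longleftrightarrow> stable_ribbon_graph \<Gamma> \<and> (\<forall>K \<in> components \<Gamma>. K \<inter> leaves \<Gamma> \<noteq> {})"

definition sRG :: "('o, 'k::field_char_0) cochain set" where
  "sRG =
     {X. (\<forall>k \<Gamma>. \<not> admissible \<Gamma> \<longrightarrow> X k \<Gamma> = 0) \<and>
         (\<forall>k \<Gamma> \<Gamma>' f. admissible \<Gamma> \<and> admissible \<Gamma>' \<and> graph_iso f \<Gamma> \<Gamma>' \<longrightarrow>
            X k \<Gamma>' = reorder_sign (map (image f) (ori \<Gamma>)) (ori \<Gamma>') * X k \<Gamma>) \<and>
         (\<forall>k. \<exists>N. \<forall>\<Gamma>. X k \<Gamma> \<noteq> 0 \<longrightarrow> card (components \<Gamma>) \<le> N)}"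

text \<open>Sign of moving \<open>e\<close> to the front of the orientation.\<close>

abbreviation edge_sign :: "'o rgraph \<Rightarrow> nat set \<Rightarrow> 'k::field_char_0" where
  "edge_sign \<Gamma> e \<equiv> reorder_sign (ori \<Gamma>) (e # remove1 e (ori \<Gamma>))"

definition separating :: "'o rgraph \<Rightarrow> nat set \<Rightarrow> bool" where
  "separating \<Gamma> e \<longleftrightarrow> card (components (cut \<Gamma> e)) \<noteq> card (components \<Gamma>)"

definition cut_in_one_face :: "'o rgraph \<Rightarrow> nat set \<Rightarrow> bool" where
  "cut_in_one_face \<Gamma> e \<longleftrightarrow> (\<exists>h \<in> hes \<Gamma>. e \<subseteq> face (cut \<Gamma> e) h)"

definition rg_d :: "('o, 'k::field_char_0) cochain \<Rightarrow> ('o, 'k) cochain" where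
  "rg_d X k \<Gamma> = (\<Sum>e \<in> {e. contractible \<Gamma> e}. edge_sign \<Gamma> e * X k (contract \<Gamma> e))"

definition rg_nabla :: "('o, 'k::field_char_0) cochain \<Rightarrow> ('o, 'k) cochain" where
  "rg_nabla X k \<Gamma> =
     (\<Sum>e \<in> {e \<in> edges \<Gamma>. \<not> separating \<Gamma> e \<and> cut_in_one_face \<Gamma> e}. edge_sign \<Gamma> e * X k (cut \<Gamma> e))"

definition rg_delta_i :: "('o, 'k::field_char_0) cochain \<Rightarrow> ('o, 'k) cochain" where
  "rg_delta_i X k \<Gamma> =
     (\<Sum>e \<in> {e \<in> edges \<Gamma>. \<not> separating \<Gamma> e \<and> \<not> cut_in_one_face \<Gamma> e}. edge_sign \<Gamma> e * X k (cut \<Gamma> e))"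

definition rg_delta_e :: "('o, 'k::field_char_0) cochain \<Rightarrow> ('o, 'k) cochain" where
  "rg_delta_e X k \<Gamma> = (\<Sum>e \<in> {e \<in> edges \<Gamma>. separating \<Gamma> e}. edge_sign \<Gamma> e * X k (cut \<Gamma> e))"

definition rg_gamma :: "('o, 'k::field_char_0) cochain \<Rightarrow> ('o, 'k) cochain" where
  "rg_gamma X k \<Gamma> = (if k = 0 then 0 else X (k - 1) \<Gamma>)"

text \<open>The components of the cut graph are distributed to the two arguments, separating the two ends
  of the cut edge; \<open>K\<close> is the part belonging to the first argument.\<close>

definition rg_bracket :: "('o, 'k::field_char_0) cochain \<Rightarrow> ('o, 'k) cochain \<Rightarrow> ('o, 'k) cochain" where
  "rg_bracket X Y k \<Gamma> =
     (\<Sum>j\<le>k. \<Sum>e \<in> edges \<Gamma>.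
       \<Sum>K \<in> {K. K \<subseteq> hes \<Gamma> \<and> (\<forall>c \<in> components (cut \<Gamma> e). c \<subseteq> K \<or> c \<inter> K = {}) \<and> card (K \<inter> e) = 1}.
         let \<Gamma>\<^sub>1 = restrict_graph (cut \<Gamma> e) K; \<Gamma>\<^sub>2 = restrict_graph (cut \<Gamma> e) (hes \<Gamma> - K)
         in reorder_sign (ori \<Gamma>) (ori \<Gamma>\<^sub>1 @ e # ori \<Gamma>\<^sub>2) * X j \<Gamma>\<^sub>1 * Y (k - j) \<Gamma>\<^sub>2)"

text \<open>The degree condition says that the components have degree \<open>3 - d\<close>, a graph with \<open>n\<close> internal
  edges having degree \<open>n\<close> in the dual of the graph complex.\<close>

definition MCE_sRG :: "int \<Rightarrow> ('o, 'k::field_char_0) cochain set" where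
  "MCE_sRG d =
     {X \<in> sRG.
        (\<forall>k \<Gamma>. X k \<Gamma> \<noteq> 0 \<longrightarrow>
           int (card (edges \<Gamma>)) - (2 * d - 6) * int (card (components \<Gamma>)) + (6 - 2 * d) * int k - (3 - d)
             = 3 - d) \<and>
        (\<forall>k \<Gamma>. admissible \<Gamma> \<longrightarrow>
           - rg_d X k \<Gamma> + rg_nabla X k \<Gamma> + rg_delta_i X k \<Gamma> + rg_gamma (rg_delta_e X) k \<Gamma>
             + rg_bracket X X k \<Gamma> / 2 = 0)}"

definition ribbon_forest :: "'o rgraph \<Rightarrow> bool" where
  "ribbon_forest \<Gamma> \<longleftrightarrow>
     stable_ribbon_graph \<Gamma> \<and> (\<forall>K \<in> components \<Gamma>. ribbon_tree (restrict_graph \<Gamma> K))"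

text \<open>Elements of \<open>RT\<^sub>B\<close> are functions on ribbon forests, extended by zero.\<close>

definition tree_incl :: "('o rgraph \<Rightarrow> 'k) \<Rightarrow> ('o, 'k::field_char_0) cochain" where
  "tree_incl X k \<Gamma> = (if k = 0 then X \<Gamma> else 0)"

definition RT :: "('o rgraph \<Rightarrow> 'k::field_char_0) set" where
  "RT = {X. tree_incl X \<in> sRG \<and> (\<forall>\<Gamma>. X \<Gamma> \<noteq> 0 \<longrightarrow> ribbon_forest \<Gamma>)}"

definition MCE_RT :: "int \<Rightarrow> ('o rgraph \<Rightarrow> 'k::field_char_0) set" where
  "MCE_RT d =
     {X \<in> RT.
        (\<forall>\<Gamma>. X \<Gamma> \<noteq> 0 \<longrightarrow>
           int (card (edges \<Gamma>)) - (d - 3) * int (card (components \<Gamma>)) = 3 - d) \<and>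
        (\<forall>\<Gamma>. ribbon_forest \<Gamma> \<longrightarrow>
           - rg_d (tree_incl X) 0 \<Gamma> + rg_bracket (tree_incl X) (tree_incl X) 0 \<Gamma> / 2 = 0)}"

definition tree_proj :: "('o, 'k::field_char_0) cochain \<Rightarrow> 'o rgraph \<Rightarrow> 'k" where
  "tree_proj X \<Gamma> = (if ribbon_tree \<Gamma> then X 0 \<Gamma> else 0)"

text \<open>The dual basis element of a connected graph (\<open>0\<close> if the graph has an automorphism reversing the
  orientation), and the sum of these over all isomorphism classes of the graphs in \<open>A\<close>. The sum is
  infinite, but for each argument at most one summand is not zero.\<close>

definition dual_graph :: "'o rgraph \<Rightarrow> 'o rgraph \<Rightarrow> 'k::field_char_0" where
  "dual_graph \<Gamma>\<^sub>0 \<Gamma> =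
     (if stable_ribbon_graph \<Gamma> then
        of_bool (\<exists>f. graph_iso f \<Gamma>\<^sub>0 \<Gamma> \<and> reorder_sign (map (image f) (ori \<Gamma>\<^sub>0)) (ori \<Gamma>) = (1::'k)) -
        of_bool (\<exists>f. graph_iso f \<Gamma>\<^sub>0 \<Gamma> \<and> reorder_sign (map (image f) (ori \<Gamma>\<^sub>0)) (ori \<Gamma>) = (- 1::'k))
      else 0)"

definition representative :: "'o rgraph set \<Rightarrow> 'o rgraph" where
  "representative c = (SOME \<Gamma>. \<Gamma> \<in> c)"

definition sum_of_classes :: "'o rgraph set \<Rightarrow> 'o rgraph \<Rightarrow> 'k::field_char_0" where
  "sum_of_classes A \<Gamma> =
     (\<Sum>c \<in> {c \<in> A // iso_rel. dual_graph (representative c) \<Gamma> \<noteq> (0::'k)}.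
        dual_graph (representative c) \<Gamma>)"


section \<open>The maps from graphs to cyclic words\<close>

text \<open>The leaf following \<open>h\<close> when going along the face in the direction of the cyclic orders, that
  is, inversely to \<open>sig0\<inverse> sig1\<close>.\<close>

definition next_leaf :: "'o rgraph \<Rightarrow> nat \<Rightarrow> nat" where
  "next_leaf \<Gamma> h =
     (let n = (LEAST n. n > 0 \<and> ((sig1 \<Gamma> \<circ> sig0 \<Gamma>) ^^ n) h \<in> leaves \<Gamma>)
      in ((sig1 \<Gamma> \<circ> sig0 \<Gamma>) ^^ n) h)"

text \<open>The ways of placing the cyclic words \<open>ws\<close> on the leaves, one word for each face with
  leaves, such that the objects agree with the colors. An arrow on the half-edge \<open>h\<close> has source
  \<open>col h\<close> and target \<open>col (sig0 h)\<close>.\<close>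

definition placements :: "'o rgraph \<Rightarrow> ('o, 'v) arrow list list \<Rightarrow> nat list list set" where
  "placements \<Gamma> ws =
     {hs. map (map (col \<Gamma>)) hs = map (map fst) ws \<and>
          distinct (concat hs) \<and> set (concat hs) = leaves \<Gamma> \<and>
          (\<forall>w \<in> set hs. \<forall>j < length w. w ! (Suc j mod length w) = next_leaf \<Gamma> (w ! j))}"

text \<open>A choice of orders of the vertices, of the cycles at each vertex, and of first half-edges of the
  cycles.\<close>

definition is_layout :: "'o rgraph \<Rightarrow> nat list list list \<Rightarrow> bool" where
  "is_layout \<Gamma> L \<longleftrightarrow>
     distinct (concat (concat L)) \<and> set (map (\<lambda>v. set (concat v)) L) = vts \<Gamma> \<and>
     (\<forall>v \<in> set L. v \<noteq> [] \<and> (\<forall>w \<in> set v. w \<noteq> [] \<and>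
        (\<forall>j < length w. w ! (Suc j mod length w) = sig0 \<Gamma> (w ! j))))"

definition layout :: "'o rgraph \<Rightarrow> nat list list list" where
  "layout \<Gamma> = (SOME L. is_layout \<Gamma> L)"

text \<open>The tensor \<open>\<Otimes>\<^sub>v F|\<^sub>v\<close>, evaluated on the inverse pairings \<open>cs\<close> on the internal edges and on
  the arrows \<open>ws\<close> at the leaves \<open>hs\<close>.\<close>

definition graph_tensor ::
  "('o, 'k::field_char_0, 'v) functional \<Rightarrow> 'o rgraph \<Rightarrow> (('o, 'v) arrow \<times> ('o, 'v) arrow) list \<Rightarrow>
     nat list list \<Rightarrow> ('o, 'v) arrow list list \<Rightarrow> 'k" where
  "graph_tensor F \<Gamma> cs hs ws =
     (let H = concat (map (\<lambda>e. [Min e, Max e]) (ori \<Gamma>)) @ concat hs;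
          xs = concat (map (\<lambda>(x, y). [x, y]) cs) @ concat ws;
          arg = (\<lambda>h. the (map_of (zip H xs) h))
      in ksign (\<lambda>h. sdeg (arg h)) H (concat (concat (layout \<Gamma>))) *
         (\<Prod>v \<leftarrow> layout \<Gamma>. F (gdf \<Gamma> (set (concat v))) (bdf \<Gamma> (set (concat v))) (map (map arg) v)))"

definition empty_face_colors :: "'o rgraph \<Rightarrow> 'o multiset" where
  "empty_face_colors \<Gamma> =
     image_mset (\<lambda>f. col \<Gamma> (sig1 \<Gamma> (Min f)))
       (mset_set {f \<in> face \<Gamma> ` hes \<Gamma>. f \<inter> leaves \<Gamma> = {}})"

text \<open>\<open>\<rho>\<close> on the dual basis element of \<open>\<Gamma>\<close>. The functionals \<open>F\<close> are sums over all rotations and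
  permutations of words; the division by the order of the automorphism group accounts for this. In
  particular for a graph with one vertex and no internal edges the result is the
  component of \<open>F\<close> prescribed by it. For a disjoint union of \<open>\<Gamma>\<^sub>i\<close>, \<open>n\<^sub>i\<close> times each, the
  dual basis element is the product of the powers of the \<open>\<Gamma>\<^sub>i\<close> divided by \<open>\<Prod>\<^sub>i n\<^sub>i!\<close>, so that
  the formula is the multiplicative extension of the one for connected graphs.\<close>

definition rho_graph ::
  "int \<Rightarrow> ('o, 'k::field_char_0, 'v::ab_group_add, 'z) complexes_scheme \<Rightarrow> ('o, 'k, 'v) functional \<Rightarrow>
     'o rgraph \<Rightarrow> ('o, 'k, 'v) functional" where
  "rho_graph d V F \<Gamma> g b ws =
     (if cwords V ws \<and> int g = arith_genus \<Gamma> \<and> b = sum (bdf \<Gamma>) (vts \<Gamma>) + empty_face_colors \<Gamma> then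
        (\<Sum>hs \<in> placements \<Gamma> ws.
           \<Sum>cs \<leftarrow> product_lists (map (\<lambda>e. copairing d V (col \<Gamma> (Min e)) (col \<Gamma> (Max e))) (ori \<Gamma>)).
             graph_tensor F \<Gamma> cs hs ws) / of_nat (card (automorphisms \<Gamma>))
      else 0)"

definition rho ::
  "int \<Rightarrow> ('o, 'k::field_char_0, 'v::ab_group_add, 'z) complexes_scheme \<Rightarrow> ('o, 'k, 'v) functional \<Rightarrow>
     ('o, 'k) cochain \<Rightarrow> ('o, 'k, 'v) functional" where
  "rho d V F X g b ws =
     (let term = (\<lambda>c. \<Sum>k\<le>g. X k (representative c) * rho_graph d V F (representative c) (g - k) b ws)
      in \<Sum>c \<in> {c \<in> {\<Gamma>. admissible \<Gamma>} // iso_rel. term c \<noteq> 0}. term c)"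

definition rho_tree ::
  "int \<Rightarrow> ('o, 'k::field_char_0, 'v::ab_group_add, 'z) complexes_scheme \<Rightarrow>
     (('o, 'v) arrow list list \<Rightarrow> 'k) \<Rightarrow> ('o rgraph \<Rightarrow> 'k) \<Rightarrow> ('o, 'v) arrow list list \<Rightarrow> 'k" where
  "rho_tree d V I X ws = rho d V (fr_incl I) (tree_incl X) 0 {#} ws"

end

theory Submission
  imports Defs "HOL-Combinatorics.Cycles"
begin

text \<open>
  Call a stable graph with one vertex and no internal edges a corolla. On a graph \<open>\<Gamma>\<close> every term
  of the Maurer--Cartan equation of the sum of the corollas vanishes unless \<open>\<Gamma>\<close> has a single
  internal edge, meeting all vertices. If this edge is a loop, contracting and cutting it both give
  a corolla, and these two terms cancel; if it joins two vertices, contracting it gives a corolla and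
  cutting it gives two, which the bracket counts twice. In a ribbon forest a contracted loop is not
  a tree and a cut loop does not contribute to the bracket, so the same holds for the trees among
  the corollas.

  The map \<open>\<rho>\<close> sends a corolla to the component of the functional prescribed by it: the placements of
  the words on its leaves form a torsor under its automorphisms, and by its symmetries the
  functional has the same value on each of them. Every product of words lies on exactly one corolla.
\<close>

section \<open>Splicing cycles of a permutation\<close>

text \<open>Wherever a term survives, the orientations involved have at most one entry, so all
  orientation signs are 1 and the cancellations are \<open>-1 + 1\<close> for a loop and
  \<open>-1 + 2/2\<close> for a bridge. The obstacle is stability. A contraction must be shown to
  give a stable graph, and the bound of three half-edges applies just when all defects vanish and
  the vertex has one cycle; so one has to know how many cycles the contracted vertex has. This is
  why the cyclic orders are studied as bare permutations. A half-edge off the edge must also remain;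
  a leaf provides it in the full complex, the valence bound in forests. On the side of
  \<open>rho\<close> the bound matches \<open>m_1 = 0\<close>, which makes the Hamiltonian vanish on
  words of length two: no component of \<open>I\<close> or of the quantization falls on an unstable
  corolla. The absence of constant terms does the same for empty products of words.\<close>

lemma orbit_subset_invariant:
  assumes "x \<in> Z" "\<And>y. y \<in> Z \<Longrightarrow> f y \<in> Z"
  shows "orbit f x \<subseteq> Z"
proof
  fix y assume "y \<in> orbit f x"
  then show "y \<in> Z" by induction (use assms in auto)
qed

lemma orbit_eq_orbit_if_mem:
  assumes "permutation f" "y \<in> orbit f x"
  shows "orbit f y = orbit f x"
  by (rule orbit_cyclic_eq3[OF cyclic_on_orbit'[OF assms(1)] assms(2)])

lemma orbit_eq_orbit_iff:
  assumes "permutation f"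
  shows "orbit f x = orbit f y \<longleftrightarrow> y \<in> orbit f x"
  by (metis assms orbit_eq_orbit_if_mem permutation_self_in_orbit)

text \<open>The successor permutation after contracting an edge with ends \<open>a\<close> and \<open>b\<close>: the first return map
  to \<open>H - {a, b}\<close> of \<open>s \<circ> (a b)\<close>. Two detours suffice to leave \<open>{a, b}\<close>.\<close>

definition bypass :: "('a \<Rightarrow> 'a) \<Rightarrow> 'a \<Rightarrow> 'a \<Rightarrow> 'a \<Rightarrow> 'a" where
  "bypass s a b y = (if y = a then s b else if y = b then s a else y)"

definition splice :: "('a \<Rightarrow> 'a) \<Rightarrow> 'a set \<Rightarrow> 'a \<Rightarrow> 'a \<Rightarrow> 'a \<Rightarrow> 'a" where
  "splice s H a b x = (if x \<in> H - {a, b} then bypass s a b (bypass s a b (s x)) else x)"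

locale marked_permutation =
  fixes s :: "'a \<Rightarrow> 'a" and H a b
  assumes perm: "s permutes H" and fin: "finite H"
    and a_in: "a \<in> H" and b_in: "b \<in> H" and ab: "a \<noteq> b"
begin

abbreviation "p \<equiv> splice s H a b"

lemma s_inj [simp]: "s x = s y \<longleftrightarrow> x = y"
  by (meson inj_eq perm permutes_inj)

lemma s_in [simp]: "s x \<in> H \<longleftrightarrow> x \<in> H"
  by (rule permutes_in_image[OF perm])

lemma permutation_s: "permutation s"
  using fin perm permutation_permutes by blast

lemma splice_simps:
  assumes "x \<in> H" "x \<noteq> a" "x \<noteq> b"
  shows "s x \<noteq> a \<Longrightarrow> s x \<noteq> b \<Longrightarrow> p x = s x"
    and "s x = a \<Longrightarrow> s b \<noteq> b \<Longrightarrow> p x = s b"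
    and "s x = b \<Longrightarrow> s a \<noteq> a \<Longrightarrow> p x = s a"
  using assms ab s_inj[of x a] s_inj[of x b] s_inj[of a b]
  by (auto simp: splice_def bypass_def simp del: s_inj split: if_splits)

text \<open>Injectivity is the reason that two detours suffice. If \<open>s x = a\<close> with
  \<open>x\<close> outside, then neither \<open>s a\<close> nor \<open>s b\<close> is
  \<open>a\<close>. The detour \<open>s b\<close> is therefore outside unless \<open>b\<close> is
  fixed, and then the second detour \<open>s a\<close> is outside, because the only preimage of
  \<open>b\<close> is \<open>b\<close>.\<close>

lemma splice_in:
  assumes "x \<in> H - {a, b}"
  shows "p x \<in> H - {a, b}"
  using assms ab a_in b_in s_inj[of x a] s_inj[of x b] s_inj[of a b]
  by (auto simp: splice_def bypass_def simp del: s_inj split: if_splits)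

lemma inj_on_splice: "inj_on p (H - {a, b})"
proof (rule inj_onI)
  fix x y assume "x \<in> H - {a, b}" "y \<in> H - {a, b}" "p x = p y"
  then show "x = y"
    using ab s_inj[of x a] s_inj[of x b] s_inj[of a b] s_inj[of y a] s_inj[of y b] s_inj[of x y]
    by (auto simp: splice_def bypass_def simp del: s_inj split: if_splits)
qed

lemma splice_permutes: "p permutes (H - {a, b})"
proof (rule bij_imp_permutes)
  have "p ` (H - {a, b}) \<subseteq> H - {a, b}"
    by (intro image_subsetI splice_in)
  then have "p ` (H - {a, b}) = H - {a, b}"
    by (rule endo_inj_surj[OF finite_Diff[OF fin] _ inj_on_splice])
  then show "bij_betw p (H - {a, b}) (H - {a, b})"
    using inj_on_splice by (simp add: bij_betw_def)
qed (auto simp: splice_def)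

lemma permutation_splice: "permutation p"
  using fin splice_permutes permutation_permutes by blast

text \<open>A cycle through neither end never meets a detour, so it survives the
  contraction.\<close>

lemma orbit_splice_subset:
  assumes "x \<in> H" "a \<notin> orbit s x" "b \<notin> orbit s x"
  shows "orbit p x \<subseteq> orbit s x"
proof (rule orbit_subset_invariant)
  show "x \<in> orbit s x"
    by (rule permutation_self_in_orbit[OF permutation_s])
  fix y assume y: "y \<in> orbit s x"
  have "y \<in> H"
    using y permutes_orbit_subset[OF perm \<open>x \<in> H\<close>] by blast
  moreover have "s y \<in> orbit s x"
    using y by (rule orbit.step)
  ultimately show "p y \<in> orbit s x"
    using y assms splice_simps(1) by metis
qed

text \<open>The points strictly between \<open>a\<close> and \<open>b\<close> are closed under \<open>p\<close>.\<close>

lemma orbit_splice_split: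
  assumes "b \<in> orbit s a" "s a \<noteq> b" "s b \<noteq> a"
  shows "s a \<in> H - {a, b}" "s b \<in> H - {a, b}" "orbit p (s a) \<noteq> orbit p (s b)"
proof -
  have "s a \<noteq> a" "s b \<noteq> b"
    using assms(1) ab orbit_eq_singleton_iff[of s a] orbit_eq_singleton_iff[of s b]
      orbit_swap[OF permutation_self_in_orbit[OF permutation_s] assms(1)] by (metis singletonD)+
  then show sa: "s a \<in> H - {a, b}" and sb: "s b \<in> H - {a, b}"
    using assms a_in b_in by auto
  define m where "m = funpow_dist1 s a b"
  have m: "(s ^^ m) a = b"
    unfolding m_def by (rule funpow_dist1_prop[OF assms(1)])
  have least: "(s ^^ i) a \<noteq> b" if "0 < i" "i < m" for i
    using that funpow_dist1_least unfolding m_def by metis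
  have "m \<noteq> 1"
    using m assms(2) by auto
  then have "1 < m"
    unfolding m_def by linarith
  have noa: "(s ^^ i) a \<noteq> a" if "0 < i" "i < m" for i
    using funpow_neq_less_funpow_dist1[OF assms(1), of i 0] that unfolding m_def by simp
  let ?Z = "{(s ^^ i) a | i. 0 < i \<and> i < m}"
  have saZ: "s a \<in> ?Z"
    using \<open>1 < m\<close> by (auto intro!: exI[of _ 1])
  have "orbit p (s a) \<subseteq> ?Z"
  proof (rule orbit_subset_invariant[OF saZ])
    fix y assume "y \<in> ?Z"
    then obtain i where i: "y = (s ^^ i) a" "0 < i" "i < m" by auto
    have y: "y \<in> H" "y \<noteq> a" "y \<noteq> b"
      using i noa least a_in permutes_in_funpow_image[OF perm a_in] by auto
    show "p y \<in> ?Z"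
    proof (cases "Suc i < m")
      case True
      then have "s y \<noteq> a" "s y \<noteq> b"
        using noa[of "Suc i"] least[of "Suc i"] i by auto
      then have "p y = (s ^^ Suc i) a"
        using splice_simps(1)[OF y] i by simp
      then show ?thesis
        using True by blast
    next
      case False
      then have "Suc i = m"
        using i by simp
      \<comment> \<open>At the last point of the arc the detour around \<open>b\<close> leads back
        to its first point \<open>s a\<close>.\<close>
      then have "s y = b"
        using i m by auto
      then show ?thesis
        using splice_simps(3)[OF y] \<open>s a \<noteq> a\<close> saZ by simp
    qed
  qed
  \<comment> \<open>Otherwise injectivity would put \<open>b\<close> itself inside the open arc or
    make it equal to \<open>a\<close>.\<close>
  moreover have "s b \<notin> ?Z"
  proof
    assume "s b \<in> ?Z"
    then obtain i where i: "s b = (s ^^ i) a" "0 < i" "i < m" by auto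
    then obtain j where "i = Suc j" by (cases i) auto
    then have "b = (s ^^ j) a" using i by simp
    then show False
      using least[of j] i \<open>i = Suc j\<close> ab by (cases j) auto
  qed
  ultimately show "orbit p (s a) \<noteq> orbit p (s b)"
    using permutation_self_in_orbit[OF permutation_splice, of "s b"] by blast
qed

text \<open>From \<open>s a\<close> the spliced permutation follows the first cycle up to the
  predecessor of \<open>a\<close>, where the detour takes it to \<open>s b\<close>; so the two arcs
  are traversed one after the other. The hypothesis \<open>ne\<close> keeps both arcs
  nonempty.\<close>

lemma orbit_splice_join:
  assumes disj: "b \<notin> orbit s a" and H: "H = orbit s a \<union> orbit s b"
    and ne: "s a \<noteq> a" "s b \<noteq> b"
    and x: "x \<in> H - {a, b}"
  shows "orbit p x = orbit p (s a)"
proof -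
  interpret sym: marked_permutation s H b a
    using perm fin a_in b_in ab by unfold_locales auto
  have psym: "sym.p = p"
    using ab by (auto simp: fun_eq_iff splice_def bypass_def)
  \<comment> \<open>On the cycle of \<open>u\<close> only the step into \<open>u\<close> is
    diverted, so everything else there is reached from \<open>s u\<close>. The ends are variable
    because this is needed from both sides.\<close>
  have arc: "y \<in> orbit (splice s H u v) (s u)"
    if "marked_permutation s H u v" "v \<notin> orbit s u" "y \<in> orbit s u" "y \<noteq> u" for u v y
  proof -
    interpret uv: marked_permutation s H u v by fact
    have "(s ^^ n) u \<noteq> u \<Longrightarrow> (s ^^ n) u \<in> orbit uv.p (s u)" for n
    proof (induction n)
      case (Suc n)
      show ?case
      proof (cases "(s ^^ n) u = u")
        case True
        then show ?thesis
          by (simp add: permutation_self_in_orbit[OF uv.permutation_splice])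
      next
        case False
        have *: "(s ^^ k) u \<in> orbit s u" for k
          by (rule funpow_in_orbit[OF permutation_self_in_orbit[OF permutation_s]])
        have "uv.p ((s ^^ n) u) = s ((s ^^ n) u)"
          using uv.splice_simps(1)[of "(s ^^ n) u"] False Suc.prems *[of n] *[of "Suc n"] that(2)
            permutes_in_funpow_image[OF perm uv.a_in] by auto
        then show ?thesis
          using orbit.step[OF Suc.IH[OF False]] by simp
      qed
    qed simp
    then show ?thesis
      using that(3,4) orbit_altdef_permutation[OF permutation_s] by auto
  qed
  have disj': "a \<notin> orbit s b"
    using disj orbit_swap[OF permutation_self_in_orbit[OF permutation_s]] by blast
  \<comment> \<open>The predecessor of \<open>a\<close>: the step from it is diverted to
    \<open>s b\<close>, which links the two arcs.\<close>
  define c where "c = inv s a"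
  have c: "s c = a" "c \<in> orbit s a"
    using permutes_inverses(1)[OF perm] orbit.base[of "inv s" a] orbit_inv_eq[OF permutation_s]
    by (auto simp: c_def)
  have cH: "c \<in> H" "c \<noteq> a" "c \<noteq> b"
    using c ne disj H by auto
  have "p c = s b"
    using splice_simps(2)[OF cH] c ne by simp
  then have "s b \<in> orbit p (s a)"
    using orbit.step[OF arc[OF marked_permutation_axioms disj c(2) cH(2)]] by simp
  then have sb: "orbit p (s b) = orbit p (s a)"
    by (rule orbit_eq_orbit_if_mem[OF permutation_splice])
  show ?thesis
  proof (cases "x \<in> orbit s a")
    case True
    then show ?thesis
      using arc[OF marked_permutation_axioms disj] x orbit_eq_orbit_if_mem[OF permutation_splice]
      by blast
  next
    case False
    then have "x \<in> orbit sym.p (s b)"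
      using arc[OF sym.marked_permutation_axioms disj'] x H by blast
    then show ?thesis
      using sb psym orbit_eq_orbit_if_mem[OF permutation_splice] by metis
  qed
qed

end

section \<open>Stable ribbon graphs and corollas\<close>

text \<open>A list with at most one entry has no inversions. This disposes of the orientation signs
  on corollas and one-edge graphs.\<close>

lemma ksign_Nil [simp]: "ksign dg [] ys = 1"
  by (simp add: ksign_def before_def)

lemma ksign_singleton [simp]: "ksign dg [x] ys = 1"
  by (simp add: ksign_def before_def)

lemma graph_iso_refl: "graph_iso id \<Gamma> \<Gamma>"
  by (simp add: graph_iso_def)

lemma graph_iso_comp:
  assumes "graph_iso f \<Gamma>\<^sub>1 \<Gamma>\<^sub>2" "graph_iso g \<Gamma>\<^sub>2 \<Gamma>\<^sub>3"
  shows "graph_iso (g \<circ> f) \<Gamma>\<^sub>1 \<Gamma>\<^sub>3"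
proof -
  have "(g \<circ> f) ` v = g ` f ` v" for v
    by (rule image_comp[symmetric])
  then show ?thesis
    using assms unfolding graph_iso_def
    by (auto intro: bij_betw_trans simp: image_image bij_betw_apply[of f])
qed

context
  fixes \<Gamma> :: "'o rgraph"
  assumes stable: "stable_ribbon_graph \<Gamma>"
begin

lemma finite_hes: "finite (hes \<Gamma>)"
  and partition_vts: "partition_on (hes \<Gamma>) (vts \<Gamma>)"
  and sig0_permutes: "sig0 \<Gamma> permutes hes \<Gamma>"
  and sig1_permutes: "sig1 \<Gamma> permutes hes \<Gamma>"
  and sig0_image_vts: "v \<in> vts \<Gamma> \<Longrightarrow> sig0 \<Gamma> ` v = v"
  and distinct_ori: "distinct (ori \<Gamma>)"
  and set_ori: "set (ori \<Gamma>) = edges \<Gamma>"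
  using stable unfolding stable_ribbon_graph_def by auto

lemma stable_vertex:
  "v \<in> vts \<Gamma> \<Longrightarrow> gdf \<Gamma> v = 0 \<Longrightarrow> bdf \<Gamma> v = {#} \<Longrightarrow> card (cyc \<Gamma> ` v) = 1 \<Longrightarrow> card v \<ge> 3"
  using stable unfolding stable_ribbon_graph_def by auto

lemma sig1_sig1: "sig1 \<Gamma> (sig1 \<Gamma> h) = h"
  using stable unfolding stable_ribbon_graph_def by (auto dest: fun_cong)

lemma permutation_sig0: "permutation (sig0 \<Gamma>)"
  using finite_hes sig0_permutes permutation_permutes by blast

lemma sig1_in: "sig1 \<Gamma> h \<in> hes \<Gamma> \<longleftrightarrow> h \<in> hes \<Gamma>"
  by (rule permutes_in_image[OF sig1_permutes])

lemma vertex_subset: "v \<in> vts \<Gamma> \<Longrightarrow> v \<subseteq> hes \<Gamma>"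
  using partition_vts by (auto simp: partition_on_def)

lemma vertex_nonempty: "v \<in> vts \<Gamma> \<Longrightarrow> v \<noteq> {}"
  using partition_vts by (auto simp: partition_on_def)

lemma vertex_unique: "v \<in> vts \<Gamma> \<Longrightarrow> w \<in> vts \<Gamma> \<Longrightarrow> h \<in> v \<Longrightarrow> h \<in> w \<Longrightarrow> v = w"
  using partition_vts by (auto simp: partition_on_def disjoint_def)

lemma obtain_vertex:
  assumes "h \<in> hes \<Gamma>"
  obtains v where "v \<in> vts \<Gamma>" "h \<in> v"
  using partition_vts assms by (auto simp: partition_on_def)

lemma vertex_orbit: "v \<in> vts \<Gamma> \<Longrightarrow> h \<in> v \<Longrightarrow> orbit (sig0 \<Gamma>) h \<subseteq> v"
  using sig0_image_vts by (intro orbit_subset_invariant) auto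

lemma edgeE:
  assumes "e \<in> edges \<Gamma>"
  obtains a b where "e = {a, b}" "a \<noteq> b" "a \<in> hes \<Gamma>" "b \<in> hes \<Gamma>" "sig1 \<Gamma> a = b" "sig1 \<Gamma> b = a"
proof -
  obtain h where h: "e = {h, sig1 \<Gamma> h}" "h \<in> hes \<Gamma>" "sig1 \<Gamma> h \<noteq> h"
    using assms by (auto simp: edges_def leaves_def)
  with that[of h "sig1 \<Gamma> h"] show thesis
    by (simp add: sig1_sig1 sig1_in)
qed

lemma edge_subset: "e \<in> edges \<Gamma> \<Longrightarrow> e \<subseteq> hes \<Gamma>"
  by (auto elim: edgeE)

lemma edge_eq:
  assumes "e \<in> edges \<Gamma>" "h \<in> e"
  shows "e = {h, sig1 \<Gamma> h}"
  using assms by (auto elim!: edgeE)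

lemma edge_iff: "{h, sig1 \<Gamma> h} \<in> edges \<Gamma> \<longleftrightarrow> h \<in> hes \<Gamma> \<and> sig1 \<Gamma> h \<noteq> h"
  by (auto simp: edges_def leaves_def doubleton_eq_iff sig1_in)

lemma finite_edges: "finite (edges \<Gamma>)"
  using set_ori by (metis List.finite_set)

lemma edges_Diff:
  assumes "e \<in> edges \<Gamma>"
  shows "edges \<Gamma> - {e} = {{h, sig1 \<Gamma> h} | h. h \<in> hes \<Gamma> \<and> sig1 \<Gamma> h \<noteq> h \<and> h \<notin> e}"
proof -
  have "{h, sig1 \<Gamma> h} = e \<longleftrightarrow> h \<in> e" for h
    using edge_eq[OF assms] by auto
  then show ?thesis
    unfolding edges_def leaves_def by blast
qed

lemma edges_cut:
  assumes "e \<in> edges \<Gamma>"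
  shows "edges (cut \<Gamma> e) = edges \<Gamma> - {e}"
  unfolding edges_Diff[OF assms] by (auto simp: edges_def leaves_def cut_def split: if_splits)

lemma edges_contract:
  assumes "e \<in> edges \<Gamma>"
  shows "edges (contract \<Gamma> e) = edges \<Gamma> - {e}"
  unfolding edges_Diff[OF assms]
  by (auto simp: edges_def leaves_def contract_def Let_def split: if_splits)

lemma sig1_no_edges: "edges \<Gamma> = {} \<Longrightarrow> sig1 \<Gamma> = id"
  using edge_iff permutes_not_in[OF sig1_permutes] by fastforce

lemma ori_no_edges: "edges \<Gamma> = {} \<Longrightarrow> ori \<Gamma> = []"
  using set_ori by simp

lemma ori_one_edge: "edges \<Gamma> = {e} \<Longrightarrow> ori \<Gamma> = [e]"
  using set_ori distinct_ori distinct_card[of "ori \<Gamma>"]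
  by (cases "ori \<Gamma>"; cases "tl (ori \<Gamma>)") auto

text \<open>Adjacency leaves a vertex only through \<open>sig1\<close>, so a vertex closed under it
  is a whole component.\<close>

lemma component_eq_vertex:
  assumes "v \<in> vts \<Gamma>" "h \<in> v" "\<And>k. k \<in> v \<Longrightarrow> sig1 \<Gamma> k \<in> v"
  shows "(adjacent \<Gamma>)\<^sup>* `` {h} = v"
proof
  show "(adjacent \<Gamma>)\<^sup>* `` {h} \<subseteq> v"
  proof
    fix k assume "k \<in> (adjacent \<Gamma>)\<^sup>* `` {h}"
    then have "(h, k) \<in> (adjacent \<Gamma>)\<^sup>*" by simp
    then show "k \<in> v"
      by (induction rule: rtrancl_induct)
        (use assms vertex_unique in \<open>auto simp: adjacent_def\<close>)
  qed
  show "v \<subseteq> (adjacent \<Gamma>)\<^sup>* `` {h}"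
    using assms by (auto simp: adjacent_def)
qed

lemma components_one_vertex:
  assumes "vts \<Gamma> = {v}"
  shows "components \<Gamma> = {v}" "v = hes \<Gamma>"
proof -
  show v: "v = hes \<Gamma>"
    using partition_vts assms by (auto simp: partition_on_def)
  have "hes \<Gamma> \<noteq> {}"
    using vertex_nonempty assms v by blast
  then show "components \<Gamma> = {v}"
    using component_eq_vertex[of v] assms sig1_in v unfolding components_def by auto
qed

lemma components_no_edges:
  assumes "edges \<Gamma> = {}"
  shows "components \<Gamma> = vts \<Gamma>"
proof
  show "components \<Gamma> \<subseteq> vts \<Gamma>"
  proof
    fix K assume "K \<in> components \<Gamma>"
    then obtain h where "h \<in> hes \<Gamma>" "K = (adjacent \<Gamma>)\<^sup>* `` {h}"
      by (auto simp: components_def)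
    then show "K \<in> vts \<Gamma>"
      using component_eq_vertex sig1_no_edges[OF assms] by (metis id_apply obtain_vertex)
  qed
  show "vts \<Gamma> \<subseteq> components \<Gamma>"
  proof
    fix v assume v: "v \<in> vts \<Gamma>"
    then obtain h where "h \<in> v" using vertex_nonempty by blast
    then show "v \<in> components \<Gamma>"
      using component_eq_vertex[OF v, of h] sig1_no_edges[OF assms] vertex_subset[OF v]
      by (auto simp: components_def)
  qed
qed

lemma vertex_in_component:
  assumes "v \<in> vts \<Gamma>"
  obtains c where "c \<in> components \<Gamma>" "v \<subseteq> c"
proof -
  obtain h where h: "h \<in> v" using vertex_nonempty[OF assms] by blast
  have "v \<subseteq> (adjacent \<Gamma>)\<^sup>* `` {h}"
    using assms h by (auto simp: adjacent_def)
  then show thesis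
    using that h vertex_subset[OF assms] by (auto simp: components_def)
qed

lemma graph_iso_inverse:
  assumes iso: "graph_iso f \<Gamma> \<Gamma>'"
  shows "\<exists>g. graph_iso g \<Gamma>' \<Gamma>"
proof -
  define g where "g = inv_into (hes \<Gamma>) f"
  have bij: "bij_betw f (hes \<Gamma>) (hes \<Gamma>')"
    using iso by (simp add: graph_iso_def)
  have gf: "g (f h) = h" if "h \<in> hes \<Gamma>" for h
    using bij that by (simp add: g_def bij_betw_inv_into_left)
  have gv: "g ` f ` v = v" if "v \<in> vts \<Gamma>" for v
    using gf vertex_subset[OF that] by (force simp: image_image)
  have "bij_betw g (hes \<Gamma>') (hes \<Gamma>)"
    unfolding g_def by (rule bij_betw_inv_into[OF bij])
  moreover have "vts \<Gamma> = image g ` vts \<Gamma>'"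
    using iso gv by (auto simp: graph_iso_def image_image)
  moreover have "sig0 \<Gamma> (g h') = g (sig0 \<Gamma>' h') \<and> sig1 \<Gamma> (g h') = g (sig1 \<Gamma>' h') \<and>
      col \<Gamma> (g h') = col \<Gamma>' h'" if "h' \<in> hes \<Gamma>'" for h'
  proof -
    obtain h where h: "h \<in> hes \<Gamma>" "h' = f h"
      using bij \<open>h' \<in> hes \<Gamma>'\<close> by (auto simp: bij_betw_def)
    then show ?thesis
      using iso gf sig1_in permutes_in_image[OF sig0_permutes] by (simp add: graph_iso_def)
  qed
  moreover have "gdf \<Gamma> (g ` v') = gdf \<Gamma>' v' \<and> bdf \<Gamma> (g ` v') = bdf \<Gamma>' v'" if "v' \<in> vts \<Gamma>'" for v'
    using iso gv that by (auto simp: graph_iso_def)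
  ultimately show ?thesis
    unfolding graph_iso_def by blast
qed

end

section \<open>Isomorphism classes of graphs, and corollas\<close>

lemma equiv_iso_rel: "equiv {\<Gamma>. stable_ribbon_graph \<Gamma>} iso_rel"
proof (rule equivI)
  show "iso_rel \<subseteq> {\<Gamma>. stable_ribbon_graph \<Gamma>} \<times> {\<Gamma>. stable_ribbon_graph \<Gamma>}"
    by (auto simp: iso_rel_def)
  show "refl_on {\<Gamma>. stable_ribbon_graph \<Gamma>} iso_rel"
    using graph_iso_refl by (auto simp: iso_rel_def refl_on_def)
  show "sym iso_rel"
    using graph_iso_inverse by (auto simp: iso_rel_def sym_def)
  show "trans iso_rel"
    using graph_iso_comp by (fastforce simp: iso_rel_def trans_def)
qed

lemma representative_in:
  assumes "c \<in> A // iso_rel" "A \<subseteq> {\<Gamma>. stable_ribbon_graph \<Gamma>}"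
  shows "representative c \<in> c"
proof -
  obtain \<Gamma> where "c = iso_rel `` {\<Gamma>}" "stable_ribbon_graph \<Gamma>"
    using assms by (auto elim!: quotientE)
  then have "\<Gamma> \<in> c"
    using equiv_class_self[OF equiv_iso_rel, of \<Gamma>] by simp
  then show ?thesis
    unfolding representative_def by (rule someI)
qed

definition corolla :: "'o rgraph \<Rightarrow> bool" where
  "corolla \<Gamma> \<longleftrightarrow> stable_ribbon_graph \<Gamma> \<and> card (vts \<Gamma>) = 1 \<and> edges \<Gamma> = {}"

lemma corolla_stable: "corolla \<Gamma> \<Longrightarrow> stable_ribbon_graph \<Gamma>"
  and corolla_edges: "corolla \<Gamma> \<Longrightarrow> edges \<Gamma> = {}"
  by (auto simp: corolla_def)

context
  fixes \<Gamma> :: "'o rgraph"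
  assumes corolla: "corolla \<Gamma>"
begin

lemma corolla_vts: "vts \<Gamma> = {hes \<Gamma>}"
  using corolla components_one_vertex(2) by (metis card_1_singletonE corolla_def)

lemma corolla_components: "components \<Gamma> = {hes \<Gamma>}"
  using components_one_vertex(1)[OF corolla_stable[OF corolla]] corolla_vts by simp

lemma corolla_hes_nonempty: "hes \<Gamma> \<noteq> {}"
  using vertex_nonempty[OF corolla_stable[OF corolla]] corolla_vts by blast

lemma corolla_ori: "ori \<Gamma> = []"
  using corolla by (simp add: corolla_def ori_no_edges)

lemma corolla_sig1: "sig1 \<Gamma> = id"
  using corolla by (simp add: corolla_def sig1_no_edges)

lemma corolla_leaves: "leaves \<Gamma> = hes \<Gamma>"
  by (auto simp: leaves_def corolla_sig1)

text \<open>A vertex is nonempty, and without edges each of its half-edges is a leaf. Hence the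
  graphs with \<open>n > 0\<close> leaves in the description of \<open>S\<close> are exactly the
  corollas.\<close>

lemma corolla_card_leaves: "card (leaves \<Gamma>) > 0"
  using finite_hes[OF corolla_stable[OF corolla]] corolla_hes_nonempty
  by (simp add: corolla_leaves card_gt_0_iff)

lemma corolla_face: "face \<Gamma> = cyc \<Gamma>"
  using orbit_inv_eq[OF permutation_sig0[OF corolla_stable[OF corolla]]]
  by (simp add: face_def cyc_def corolla_sig1 fun_eq_iff)

text \<open>The faces are the cycles, so their numbers cancel, and so do the one component and the
  one vertex. Thus \<open>rho\<close> weights a corolla with the power of \<gamma> given by its
  genus defect.\<close>

lemma corolla_arith_genus: "arith_genus \<Gamma> = int (gdf \<Gamma> (hes \<Gamma>))"
  by (simp add: arith_genus_def corolla_components corolla_vts corolla_face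
      corolla_edges[OF corolla])

lemma corolla_admissible: "admissible \<Gamma>"
  using corolla corolla_hes_nonempty
  by (simp add: admissible_def corolla_stable corolla_components corolla_leaves)

lemma corolla_empty_face_colors: "empty_face_colors \<Gamma> = {#}"
proof -
  have "f \<inter> leaves \<Gamma> \<noteq> {}" if "f \<in> face \<Gamma> ` hes \<Gamma>" for f
    using that permutation_self_in_orbit[OF permutation_sig0[OF corolla_stable[OF corolla]]]
    by (auto simp: corolla_face cyc_def corolla_leaves)
  then have "{f \<in> face \<Gamma> ` hes \<Gamma>. f \<inter> leaves \<Gamma> = {}} = {}"
    by blast
  then show ?thesis
    unfolding empty_face_colors_def by (simp only: mset_set.empty image_mset_empty)
qed

lemma corolla_iso:
  assumes "(\<Gamma>, \<Gamma>') \<in> iso_rel"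
  shows "corolla \<Gamma>'"
proof -
  obtain f where f: "graph_iso f \<Gamma> \<Gamma>'" and stable: "stable_ribbon_graph \<Gamma>'"
    using assms by (auto simp: iso_rel_def)
  have "hes \<Gamma>' = f ` hes \<Gamma>"
    using f by (auto simp: graph_iso_def bij_betw_def)
  then have "sig1 \<Gamma>' h = h" if "h \<in> hes \<Gamma>'" for h
    using f that by (auto simp: graph_iso_def corolla_sig1)
  then have "edges \<Gamma>' = {}"
    by (auto simp: edges_def leaves_def)
  then show ?thesis
    using f stable by (auto simp: corolla_def graph_iso_def corolla_vts)
qed

end

text \<open>Phrased by data at the vertex, because these can be computed after a contraction; on a
  corolla the conditions of \<open>ribbon_tree\<close> on the face and the genus then
  follow.\<close>

definition tree_corolla :: "'o rgraph \<Rightarrow> bool" where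
  "tree_corolla \<Gamma> \<longleftrightarrow> corolla \<Gamma> \<and>
     (\<forall>v \<in> vts \<Gamma>. gdf \<Gamma> v = 0 \<and> bdf \<Gamma> v = {#} \<and> card (cyc \<Gamma> ` v) = 1)"

lemma tree_corolla_iff: "tree_corolla \<Gamma> \<longleftrightarrow> corolla \<Gamma> \<and> ribbon_tree \<Gamma>"
proof (cases "corolla \<Gamma>")
  case True
  then show ?thesis
    unfolding tree_corolla_def ribbon_tree_def connected_graph_def
    by (auto simp: corolla_stable corolla_components corolla_face corolla_arith_genus corolla_vts)
qed (simp add: tree_corolla_def)

text \<open>This is the stability bound itself; it accounts for \<open>n > 2\<close> in the
  description of \<open>D\<close>.\<close>

lemma tree_corolla_card_leaves: "tree_corolla \<Gamma> \<Longrightarrow> card (leaves \<Gamma>) > 2"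
  using stable_vertex[OF corolla_stable, of \<Gamma> "hes \<Gamma>"]
  by (auto simp: tree_corolla_def corolla_vts corolla_leaves)

lemma cyc_graph_iso:
  assumes "graph_iso f \<Gamma> \<Gamma>'" "stable_ribbon_graph \<Gamma>" "h \<in> hes \<Gamma>"
  shows "cyc \<Gamma>' (f h) = f ` cyc \<Gamma> h"
proof -
  have "orbit (sig0 \<Gamma>) h \<subseteq> hes \<Gamma>"
    by (rule permutes_orbit_subset[OF sig0_permutes[OF assms(2)] assms(3)])
  then have "f ` orbit (sig0 \<Gamma>) h = orbit (sig0 \<Gamma>') (f h)"
    using assms(1) by (intro orbit_inverse permutation_self_in_orbit permutation_sig0 assms)
      (auto simp: graph_iso_def)
  then show ?thesis by (simp add: cyc_def)
qed

lemma tree_corolla_iso: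
  assumes "tree_corolla \<Gamma>" "(\<Gamma>, \<Gamma>') \<in> iso_rel"
  shows "tree_corolla \<Gamma>'"
proof -
  have cor: "corolla \<Gamma>" and cor': "corolla \<Gamma>'"
    using assms corolla_iso by (auto simp: tree_corolla_def)
  obtain f where f: "graph_iso f \<Gamma> \<Gamma>'"
    using assms by (auto simp: iso_rel_def)
  then have hes: "hes \<Gamma>' = f ` hes \<Gamma>"
    by (auto simp: graph_iso_def bij_betw_def)
  have "cyc \<Gamma>' ` hes \<Gamma>' = image f ` cyc \<Gamma> ` hes \<Gamma>"
    using cyc_graph_iso[OF f corolla_stable[OF cor]] by (force simp: hes image_image)
  moreover obtain K where "cyc \<Gamma> ` hes \<Gamma> = {K}"
    using assms(1) by (auto simp: tree_corolla_def corolla_vts[OF cor] card_1_singleton_iff)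
  ultimately have "card (cyc \<Gamma>' ` hes \<Gamma>') = 1"
    by simp
  moreover have "gdf \<Gamma>' (hes \<Gamma>') = 0" "bdf \<Gamma>' (hes \<Gamma>') = {#}"
    using f assms(1) unfolding tree_corolla_def
    by (auto simp: graph_iso_def corolla_vts[OF cor] hes)
  ultimately show ?thesis
    using cor' by (simp add: tree_corolla_def corolla_vts)
qed

text \<open>Corollas have an empty orientation, so no isomorphism reverses it and the dual basis
  element of a corolla is the indicator function of its class. As \<open>A\<close> is a disjoint
  union of classes, these add up to the indicator function of \<open>A\<close>.\<close>

lemma sum_of_classes_corollas:
  assumes corollas: "\<And>\<Gamma>. \<Gamma> \<in> A \<Longrightarrow> corolla \<Gamma>"
    and iso: "\<And>\<Gamma> \<Gamma>'. \<Gamma> \<in> A \<Longrightarrow> (\<Gamma>, \<Gamma>') \<in> iso_rel \<Longrightarrow> \<Gamma>' \<in> A"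
  shows "sum_of_classes A \<Gamma> = (of_bool (\<Gamma> \<in> A) :: 'k::field_char_0)"
proof -
  have stable: "A \<subseteq> {\<Gamma>. stable_ribbon_graph \<Gamma>}"
    using corollas corolla_stable by blast
  have dual: "dual_graph (representative c) \<Gamma> = (of_bool (\<Gamma> \<in> c) :: 'k)" if c_in: "c \<in> A // iso_rel" for c
  proof -
    have rep: "representative c \<in> c"
      by (rule representative_in[OF c_in stable])
    obtain \<Gamma>\<^sub>0 where c: "c = iso_rel `` {\<Gamma>\<^sub>0}" "\<Gamma>\<^sub>0 \<in> A"
      using c_in by (auto simp: quotient_def)
    have "corolla (representative c)"
      using rep c corollas iso by auto
    then have "ori (representative c) = []" "stable_ribbon_graph (representative c)"
      by (auto simp: corolla_ori corolla_stable)
    moreover have "c = iso_rel `` {representative c}"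
      using rep c equiv_class_eq[OF equiv_iso_rel] by auto
    then have "\<Gamma> \<in> c \<longleftrightarrow> (representative c, \<Gamma>) \<in> iso_rel"
      by blast
    ultimately show ?thesis
      by (auto simp: dual_graph_def iso_rel_def)
  qed
  have "{c \<in> A // iso_rel. \<Gamma> \<in> c} = (if \<Gamma> \<in> A then {iso_rel `` {\<Gamma>}} else {})"
  proof -
    have *: "\<Gamma> \<in> A" "c = iso_rel `` {\<Gamma>}" if c: "c \<in> A // iso_rel" "\<Gamma> \<in> c" for c
    proof -
      obtain \<Gamma>\<^sub>0 where "c = iso_rel `` {\<Gamma>\<^sub>0}" "\<Gamma>\<^sub>0 \<in> A"
        using c(1) by (auto simp: quotient_def)
      then show "\<Gamma> \<in> A" "c = iso_rel `` {\<Gamma>}"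
        using c(2) iso equiv_class_eq[OF equiv_iso_rel, of \<Gamma>\<^sub>0 \<Gamma>] by auto
    qed
    have "iso_rel `` {\<Gamma>} \<in> {c \<in> A // iso_rel. \<Gamma> \<in> c}" if "\<Gamma> \<in> A"
      using that stable equiv_class_self[OF equiv_iso_rel, of \<Gamma>] quotientI[OF that] by auto
    then have "c \<in> A // iso_rel \<and> \<Gamma> \<in> c \<longleftrightarrow> \<Gamma> \<in> A \<and> c = iso_rel `` {\<Gamma>}" for c
      using * by (metis (no_types, lifting) mem_Collect_eq)
    then show ?thesis
      by simp
  qed
  moreover have "{c \<in> A // iso_rel. dual_graph (representative c) \<Gamma> \<noteq> (0::'k)} =
      {c \<in> A // iso_rel. \<Gamma> \<in> c}"
    by (intro Collect_cong conj_cong refl) (simp add: dual)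
  moreover have "dual_graph (representative (iso_rel `` {\<Gamma>})) \<Gamma> = (1 :: 'k)" if "\<Gamma> \<in> A"
    using that stable dual[OF quotientI[OF that]] equiv_class_self[OF equiv_iso_rel, of \<Gamma>] by auto
  ultimately show ?thesis
    unfolding sum_of_classes_def by simp
qed

lemma sum_of_classes_corolla:
  "sum_of_classes {\<Gamma>. stable_ribbon_graph \<Gamma> \<and> card (vts \<Gamma>) = 1 \<and> edges \<Gamma> = {} \<and>
     card (leaves \<Gamma>) > 0} = (\<lambda>\<Gamma>. of_bool (corolla \<Gamma>))"
proof -
  have *: "{\<Gamma>. stable_ribbon_graph \<Gamma> \<and> card (vts \<Gamma>) = 1 \<and> edges \<Gamma> = {} \<and> card (leaves \<Gamma>) > 0} =
      {\<Gamma>. corolla \<Gamma>}"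
    using corolla_card_leaves by (auto simp: corolla_def)
  show ?thesis
    unfolding * by (rule ext, subst sum_of_classes_corollas) (auto intro: corolla_iso)
qed

lemma sum_of_classes_tree_corolla:
  "sum_of_classes {\<Gamma>. ribbon_tree \<Gamma> \<and> card (vts \<Gamma>) = 1 \<and> edges \<Gamma> = {} \<and> card (leaves \<Gamma>) > 2} =
     (\<lambda>\<Gamma>. of_bool (tree_corolla \<Gamma>))"
proof -
  have *: "{\<Gamma>. ribbon_tree \<Gamma> \<and> card (vts \<Gamma>) = 1 \<and> edges \<Gamma> = {} \<and> card (leaves \<Gamma>) > 2} =
      {\<Gamma>. tree_corolla \<Gamma>}"
    using tree_corolla_card_leaves by (auto simp: tree_corolla_iff corolla_def ribbon_tree_def)
  have "\<And>\<Gamma>. tree_corolla \<Gamma> \<Longrightarrow> corolla \<Gamma>"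
    by (simp add: tree_corolla_def)
  then show ?thesis
    unfolding * by (intro ext, subst sum_of_classes_corollas) (auto intro: tree_corolla_iso)
qed

section \<open>Contracting the edge of a one-edge graph\<close>

lemma card_image_1_eq:
  assumes "card (f ` A) = 1" "x \<in> A" "y \<in> A"
  shows "f x = f y"
  using assms by (metis card_1_singletonE imageI singletonD)

lemma vertex_one_cycle:
  assumes "stable_ribbon_graph \<Gamma>" "v \<in> vts \<Gamma>" "card (cyc \<Gamma> ` v) = 1" "h \<in> v"
  shows "orbit (sig0 \<Gamma>) h = v"
proof
  show "orbit (sig0 \<Gamma>) h \<subseteq> v"
    by (rule vertex_orbit) fact+
  show "v \<subseteq> orbit (sig0 \<Gamma>) h"
  proof
    fix k assume "k \<in> v"
    then have "orbit (sig0 \<Gamma>) k = orbit (sig0 \<Gamma>) h"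
      using card_image_1_eq[OF assms(3) _ assms(4)] by (simp add: cyc_def)
    then show "k \<in> orbit (sig0 \<Gamma>) h"
      using permutation_self_in_orbit[OF permutation_sig0[OF assms(1)]] by blast
  qed
qed

lemma vertex_other_cycle:
  assumes "stable_ribbon_graph \<Gamma>" "v \<in> vts \<Gamma>" "h \<in> v" "card (cyc \<Gamma> ` v) \<noteq> 1"
  obtains x where "x \<in> v" "h \<notin> orbit (sig0 \<Gamma>) x"
proof -
  have "\<exists>x\<in>v. h \<notin> orbit (sig0 \<Gamma>) x"
  proof (rule ccontr)
    assume "\<not> ?thesis"
    then have "cyc \<Gamma> x = cyc \<Gamma> h" if "x \<in> v" for x
      using orbit_eq_orbit_iff[OF permutation_sig0[OF assms(1)], of x h] that by (simp add: cyc_def)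
    then have "cyc \<Gamma> ` v = {cyc \<Gamma> h}"
      using assms(3) by blast
    then show False
      using assms(4) by simp
  qed
  then show thesis
    using that by blast
qed

text \<open>By \<open>touching\<close> all vertices merge in the contraction, and by
  \<open>rest\<close> something of them remains; so the contracted graph has exactly one
  vertex.\<close>

locale one_edge_graph =
  fixes \<Gamma> :: "'o rgraph" and a b :: nat
  assumes stable: "stable_ribbon_graph \<Gamma>"
    and edges: "edges \<Gamma> = {{a, b}}" and ab: "a \<noteq> b"
    and a_in: "a \<in> hes \<Gamma>" and b_in: "b \<in> hes \<Gamma>"
    and sig1_a: "sig1 \<Gamma> a = b" and sig1_b: "sig1 \<Gamma> b = a"
    and touching: "v \<in> vts \<Gamma> \<Longrightarrow> v \<inter> {a, b} \<noteq> {}"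
    and rest: "hes \<Gamma> - {a, b} \<noteq> {}"
begin

sublocale marked_permutation "sig0 \<Gamma>" "hes \<Gamma>" a b
  using finite_hes sig0_permutes stable a_in b_in ab by unfold_locales auto

abbreviation "\<Gamma>' \<equiv> contract \<Gamma> {a, b}"
abbreviation "w \<equiv> hes \<Gamma> - {a, b}"

lemma merged: "merged_vertex \<Gamma> {a, b} = w" "{v \<in> vts \<Gamma>. v \<inter> {a, b} \<noteq> {}} = vts \<Gamma>"
  using partition_vts[OF stable] touching unfolding merged_vertex_def partition_on_def by blast+

lemma contractible: "contractible \<Gamma> {a, b}"
  using rest edges by (simp add: contractible_def merged)

text \<open>As \<open>sig1\<close> exchanges \<open>a\<close> and \<open>b\<close>, the
  \<open>skip\<close> of \<open>contract\<close> is \<open>bypass\<close> on the ends, which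
  identifies the new cyclic orders with the spliced permutation.\<close>

lemma contract_simps:
  "hes \<Gamma>' = w" "vts \<Gamma>' = {w}" "sig0 \<Gamma>' = p"
  "gdf \<Gamma>' w = sum (gdf \<Gamma>) (vts \<Gamma>) +
     (if is_loop \<Gamma> {a, b} \<and> \<not> same_cycle \<Gamma> {a, b} then 1 else 0)"
  "bdf \<Gamma>' w = sum (bdf \<Gamma>) (vts \<Gamma>) + enclosed_colors \<Gamma> {a, b}"
  unfolding contract_def Let_def merged
  by (auto simp: fun_eq_iff splice_def bypass_def sig1_a sig1_b)

lemma edges_contracted: "edges \<Gamma>' = {}"
  using edges_contract[OF stable, of "{a, b}"] edges by simp

lemma sig1_contracted: "sig1 \<Gamma>' = id"
proof
  fix h show "sig1 \<Gamma>' h = id h"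
  proof (cases "h \<in> {a, b} \<or> h \<notin> hes \<Gamma>")
    case True
    then show ?thesis
      using permutes_not_in[OF sig1_permutes[OF stable]] by (auto simp: contract_def Let_def)
  next
    case False
    then have "{h, sig1 \<Gamma> h} \<notin> edges \<Gamma>"
      unfolding edges by blast
    then show ?thesis
      using False edge_iff[OF stable] by (auto simp: contract_def Let_def)
  qed
qed

text \<open>Of the conditions for a stable graph only the valence bound can fail: no edges are left
  to constrain the colors, and the splice is a permutation.\<close>

lemma corolla_contract_if:
  assumes "gdf \<Gamma>' w = 0 \<Longrightarrow> bdf \<Gamma>' w = {#} \<Longrightarrow> card (cyc \<Gamma>' ` w) = 1 \<Longrightarrow> card w \<ge> 3"
  shows "corolla \<Gamma>'"
proof -
  have "ori \<Gamma>' = []"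
    using ori_one_edge[OF stable edges] by (simp add: contract_def Let_def)
  moreover have "leaves \<Gamma>' = w"
    by (auto simp: leaves_def sig1_contracted contract_simps)
  moreover have "partition_on w {w}"
    using rest by (simp add: partition_on_def)
  ultimately have "stable_ribbon_graph \<Gamma>'"
    using assms fin permutes_image[OF splice_permutes] splice_permutes
    by (simp add: stable_ribbon_graph_def contract_simps(1-3) sig1_contracted edges_contracted
        permutes_id)
  then show ?thesis
    using edges_contracted by (simp add: corolla_def contract_simps(2))
qed

lemma cyc_contract: "cyc \<Gamma>' = orbit p"
  by (simp add: cyc_def contract_simps fun_eq_iff)

end

locale loop_graph = one_edge_graph +
  assumes vts: "vts \<Gamma> = {hes \<Gamma>}"
begin

text \<open>Contracting a loop with non-adjacent ends in one cycle splits this cycle; in all other cases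
  a defect increases.\<close>

lemma contracted_loop_nontrivial:
  assumes "gdf \<Gamma>' w = 0" "bdf \<Gamma>' w = {#}"
  shows "card (cyc \<Gamma>' ` w) \<noteq> 1"
proof -
  have "is_loop \<Gamma> {a, b}"
    using vts a_in b_in by (simp add: is_loop_def)
  then have same: "same_cycle \<Gamma> {a, b}"
    using assms(1) by (auto simp: contract_simps split: if_splits)
  then obtain h where "{a, b} \<subseteq> orbit (sig0 \<Gamma>) h"
    by (auto simp: same_cycle_def cyc_def)
  then have "b \<in> orbit (sig0 \<Gamma>) a"
    using orbit_eq_orbit_if_mem[OF permutation_s] by auto
  \<comment> \<open>No boundary defect has been added, so neither end directly follows the other.
    This is what \<open>orbit_splice_split\<close> requires.\<close>
  moreover have "mset_set {x \<in> {a, b}. sig0 \<Gamma> (sig1 \<Gamma> x) = x} = {#}"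
    using assms(2) same by (simp add: contract_simps enclosed_colors_def)
  then have "{x \<in> {a, b}. sig0 \<Gamma> (sig1 \<Gamma> x) = x} = {}"
    by (subst (asm) mset_set_empty_iff) simp_all
  then have "sig0 \<Gamma> a \<noteq> b" "sig0 \<Gamma> b \<noteq> a"
    using sig1_a sig1_b by auto
  ultimately have "orbit p (sig0 \<Gamma> a) \<noteq> orbit p (sig0 \<Gamma> b)" "sig0 \<Gamma> a \<in> w" "sig0 \<Gamma> b \<in> w"
    using orbit_splice_split by auto
  then have "\<not> orbit p ` w \<subseteq> {K}" for K
    by blast
  then show ?thesis
    unfolding cyc_contract by (auto simp: card_1_singleton_iff)
qed

lemma corolla_contract: "corolla \<Gamma>'"
  using contracted_loop_nontrivial by (intro corolla_contract_if) blast

lemma not_tree_corolla_contract: "\<not> tree_corolla \<Gamma>'"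
  using contracted_loop_nontrivial by (auto simp: tree_corolla_def contract_simps(2))

end

locale bridge_graph = one_edge_graph +
  fixes va vb :: "nat set"
  assumes va: "va \<in> vts \<Gamma>" "a \<in> va" and vb: "vb \<in> vts \<Gamma>" "b \<in> vb" and distinct: "va \<noteq> vb"
begin

lemma vts: "vts \<Gamma> = {va, vb}"
  using touching va vb vertex_unique[OF stable] by blast

lemma hes: "hes \<Gamma> = va \<union> vb"
  using partition_vts[OF stable] by (auto simp: partition_on_def vts)

lemma disjoint: "va \<inter> vb = {}"
  using va vb distinct vertex_unique[OF stable] by blast

lemma not_in: "b \<notin> va" "a \<notin> vb"
  using va vb disjoint by auto

lemma orbits_subset: "x \<in> va \<Longrightarrow> orbit (sig0 \<Gamma>) x \<subseteq> va" "x \<in> vb \<Longrightarrow> orbit (sig0 \<Gamma>) x \<subseteq> vb"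
  using vertex_orbit[OF stable] va vb by auto

lemma not_loop: "\<not> is_loop \<Gamma> {a, b}"
  using not_in by (auto simp: is_loop_def vts)

lemma not_same_cycle: "\<not> same_cycle \<Gamma> {a, b}"
proof
  assume "same_cycle \<Gamma> {a, b}"
  then obtain h where "{a, b} \<subseteq> orbit (sig0 \<Gamma>) h" "h \<in> va \<union> vb"
    by (auto simp: same_cycle_def cyc_def hes)
  then show False
    using orbits_subset not_in by blast
qed

lemma contract_defects:
  "gdf \<Gamma>' w = gdf \<Gamma> va + gdf \<Gamma> vb"
  "bdf \<Gamma>' w = bdf \<Gamma> va + bdf \<Gamma> vb + enclosed_colors \<Gamma> {a, b}"
  using not_loop distinct by (simp_all add: contract_simps vts)

text \<open>If \<open>u\<close> had a second cycle, this would not pass through the edge and would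
  survive inside \<open>u\<close>. On the other hand \<open>v\<close> leaves something behind, since
  with trivial defects it cannot be a single half-edge. The contracted vertex would then have two
  cycles.\<close>

lemma contracted_cycle_pulled_back:
  assumes one: "card (cyc \<Gamma>' ` w) = 1"
    and u: "u \<in> {va, vb}" and v: "v \<in> {va, vb}" and uv: "u \<noteq> v"
    and trivial: "gdf \<Gamma> v = 0" "bdf \<Gamma> v = {#}"
  shows "card (cyc \<Gamma> ` u) = 1"
proof (rule ccontr)
  assume ne1: "card (cyc \<Gamma> ` u) \<noteq> 1"
  \<comment> \<open>The end in \<open>u\<close> and the end in \<open>v\<close>, whichever of them
    is called \<open>a\<close>.\<close>
  obtain h k where hk: "{h, k} = {a, b}" "h \<in> u" "k \<in> v" "h \<notin> v" "k \<notin> u"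
    using u v uv va vb not_in that[of a b] that[of b a] by auto
  have vertices: "u \<in> vts \<Gamma>" "v \<in> vts \<Gamma>"
    using u v vts by auto
  obtain x where x: "x \<in> u" "h \<notin> orbit (sig0 \<Gamma>) x"
    using vertex_other_cycle[OF stable vertices(1) hk(2) ne1] by blast
  have orbx: "orbit (sig0 \<Gamma>) x \<subseteq> u"
    using vertex_orbit[OF stable vertices(1) x(1)] .
  have "k \<notin> orbit (sig0 \<Gamma>) x"
    using orbx hk by blast
  then have avoid: "a \<notin> orbit (sig0 \<Gamma>) x" "b \<notin> orbit (sig0 \<Gamma>) x"
    using x hk(1) by (auto simp: doubleton_eq_iff)
  have xH: "x \<in> hes \<Gamma>"
    using x vertices(1) vertex_subset[OF stable] by blast
  have "x \<in> orbit (sig0 \<Gamma>) x"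
    by (rule permutation_self_in_orbit[OF permutation_s])
  then have xw: "x \<in> w"
    using avoid xH by auto
  have "v \<noteq> {k}"
  proof
    assume "v = {k}"
    then have "card (cyc \<Gamma> ` v) = 1" "card v = 1" by auto
    then show False
      using stable_vertex[OF stable vertices(2) trivial] by simp
  qed
  then obtain y where y: "y \<in> v" "y \<noteq> k"
    using hk(3) by blast
  then have yw: "y \<in> w"
    using hk vertex_subset[OF stable vertices(2)] by (auto simp: doubleton_eq_iff)
  have "orbit p x = orbit p y"
    using card_image_1_eq[OF one xw yw] by (simp add: cyc_contract)
  then have "y \<in> orbit p x"
    using permutation_self_in_orbit[OF permutation_splice] by blast
  also have "orbit p x \<subseteq> u"
    using orbit_splice_subset[OF xH avoid] orbx by blast
  finally show False
    using y(1) vertices uv vertex_unique[OF stable] by blast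
qed

text \<open>Only a contracted vertex with trivial defects and one cycle is constrained. Both
  vertices of the bridge are then of this kind, hence have at least three half-edges, and at least
  \<open>3 + 3 - 2 = 4\<close> remain.\<close>

lemma corolla_contract: "corolla \<Gamma>'"
proof (rule corolla_contract_if)
  assume "gdf \<Gamma>' w = 0" "bdf \<Gamma>' w = {#}" and one: "card (cyc \<Gamma>' ` w) = 1"
  then have trivial: "gdf \<Gamma> va = 0" "bdf \<Gamma> va = {#}" "gdf \<Gamma> vb = 0" "bdf \<Gamma> vb = {#}"
    by (auto simp: contract_defects)
  have "card (cyc \<Gamma> ` va) = 1" "card (cyc \<Gamma> ` vb) = 1"
    using contracted_cycle_pulled_back[OF one, of va vb]
      contracted_cycle_pulled_back[OF one, of vb va] trivial distinct by simp_all
  then have "card va \<ge> 3" "card vb \<ge> 3"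
    using stable_vertex[OF stable] trivial va vb by blast+
  moreover have "card (hes \<Gamma>) = card va + card vb"
    using fin disjoint unfolding hes by (intro card_Un_disjoint) auto
  moreover have "card w = card (hes \<Gamma>) - 2"
    using fin a_in b_in ab by (subst card_Diff_subset) auto
  ultimately show "card w \<ge> 3"
    by simp
qed

text \<open>A single cycle of at least three half-edges has no fixed point of \<open>sig0\<close>,
  so the two cycles join to one and the edge encloses no face.\<close>

lemma tree_corolla_contract:
  assumes trees: "\<And>v. v \<in> vts \<Gamma> \<Longrightarrow> gdf \<Gamma> v = 0 \<and> bdf \<Gamma> v = {#} \<and> card (cyc \<Gamma> ` v) = 1"
  shows "tree_corolla \<Gamma>'"
proof -
  have orb: "orbit (sig0 \<Gamma>) a = va" "orbit (sig0 \<Gamma>) b = vb"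
    using vertex_one_cycle[OF stable] trees va vb by auto
  have card: "card va \<ge> 3" "card vb \<ge> 3"
    using trees va vb by (auto intro!: stable_vertex[OF stable])
  have fixed: "sig0 \<Gamma> a \<noteq> a" "sig0 \<Gamma> b \<noteq> b"
    using card orb orbit_eq_singleton_iff[of "sig0 \<Gamma>" a] orbit_eq_singleton_iff[of "sig0 \<Gamma>" b]
    by auto
  have "orbit p x = orbit p (sig0 \<Gamma> a)" if "x \<in> w" for x
    using orbit_splice_join[OF _ _ fixed that] not_in by (simp add: orb hes)
  then have "cyc \<Gamma>' ` w = {orbit p (sig0 \<Gamma> a)}"
    using rest unfolding cyc_contract by (simp add: image_constant_conv cong: image_cong_simp)
  moreover have "enclosed_colors \<Gamma> {a, b} = {#}"
    using fixed not_same_cycle by (simp add: enclosed_colors_def)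
  ultimately show ?thesis
    using corolla_contract trees va vb
    by (simp add: tree_corolla_def contract_simps(2) contract_defects)
qed

end

section \<open>The Maurer--Cartan equations\<close>

text \<open>\<open>tree_incl\<close> only places a function at the power 0 of \<gamma>, where both
  \<open>S\<close> and \<open>D\<close> live; with \<open>P\<close> variable the two sums are
  treated by the same computations.\<close>

abbreviation corolla_sum :: "('o rgraph \<Rightarrow> bool) \<Rightarrow> ('o, 'k::field_char_0) cochain" where
  "corolla_sum P \<equiv> tree_incl (\<lambda>\<Gamma>. of_bool (P \<Gamma>))"

lemma cut_simps [simp]:
  "hes (cut \<Gamma> e) = hes \<Gamma>" "vts (cut \<Gamma> e) = vts \<Gamma>" "sig0 (cut \<Gamma> e) = sig0 \<Gamma>"
  "gdf (cut \<Gamma> e) = gdf \<Gamma>" "bdf (cut \<Gamma> e) = bdf \<Gamma>" "col (cut \<Gamma> e) = col \<Gamma>"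
  "ori (cut \<Gamma> e) = remove1 e (ori \<Gamma>)" "cyc (cut \<Gamma> e) = cyc \<Gamma>"
  by (simp_all add: cut_def cyc_def fun_eq_iff)

lemma stable_cut:
  assumes stable: "stable_ribbon_graph \<Gamma>" and e: "e \<in> edges \<Gamma>"
  shows "stable_ribbon_graph (cut \<Gamma> e)"
proof -
  obtain a b where ab: "e = {a, b}" "a \<noteq> b" "a \<in> hes \<Gamma>" "b \<in> hes \<Gamma>" "sig1 \<Gamma> a = b" "sig1 \<Gamma> b = a"
    using edgeE[OF stable e] .
  let ?s = "sig1 (cut \<Gamma> e)"
  have s: "?s = (\<lambda>x. if x \<in> e then x else sig1 \<Gamma> x)"
    by (simp add: cut_def)
  have inv: "?s (?s x) = x" for x
    using edge_eq[OF stable e, of "sig1 \<Gamma> x"] sig1_sig1[OF stable] unfolding s by auto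
  have "bij ?s"
    using inv by (intro o_bij[of ?s]) (auto simp: fun_eq_iff)
  moreover have "?s x = x" if "x \<notin> hes \<Gamma>" for x
    using permutes_not_in[OF sig1_permutes[OF stable] that] by (simp add: s)
  ultimately have "?s permutes hes \<Gamma>"
    by (simp add: permutes_def bij_iff)
  moreover have "?s \<circ> ?s = id"
    using inv by (simp add: fun_eq_iff)
  moreover have "\<forall>h \<in> hes \<Gamma> - leaves (cut \<Gamma> e). col \<Gamma> (sig0 \<Gamma> h) = col \<Gamma> (?s h)"
    using stable by (auto simp: leaves_def s stable_ribbon_graph_def)
  moreover have "set (remove1 e (ori \<Gamma>)) = edges (cut \<Gamma> e)" "distinct (remove1 e (ori \<Gamma>))"
    using edges_cut[OF stable e] distinct_ori[OF stable] set_ori[OF stable] by simp_all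
  ultimately show ?thesis
    using stable unfolding stable_ribbon_graph_def cut_simps by blast
qed

text \<open>Contraction removes one edge and a corolla has none, so only graphs with a single edge
  contribute. Their orientation is a one-element list, so the sign is 1.\<close>

lemma rg_d_corolla_sum:
  assumes P: "\<And>\<Gamma>. P \<Gamma> \<Longrightarrow> corolla \<Gamma>" and stable: "stable_ribbon_graph \<Gamma>"
  shows "rg_d (corolla_sum P) 0 \<Gamma> =
    (of_bool (\<exists>e. edges \<Gamma> = {e} \<and> contractible \<Gamma> e \<and> P (contract \<Gamma> e)) :: 'k::field_char_0)"
proof (cases "\<exists>e. edges \<Gamma> = {e}")
  case True
  then obtain e where e: "edges \<Gamma> = {e}" by blast
  then have "{e. contractible \<Gamma> e} = (if contractible \<Gamma> e then {e} else {})"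
    by (auto simp: contractible_def)
  then show ?thesis
    using e ori_one_edge[OF stable e] by (simp add: rg_d_def tree_incl_def)
next
  case False
  have "\<not> P (contract \<Gamma> e)" if "e \<in> edges \<Gamma>" for e
  proof
    assume "P (contract \<Gamma> e)"
    then have "edges \<Gamma> - {e} = {}"
      using corolla_edges[OF P] edges_contract[OF stable that] by simp
    then have "edges \<Gamma> = {e}"
      using that by auto
    then show False
      using False by blast
  qed
  then have "rg_d (corolla_sum P) 0 \<Gamma> = (0 :: 'k)"
    unfolding rg_d_def by (intro sum.neutral) (auto simp: contractible_def tree_incl_def)
  then show ?thesis
    using False by simp
qed

text \<open>Together the two operators sum over all non-separating edges, so the distinction by
  faces disappears; as for contractions, only the cut of a single edge can leave a corolla.\<close>

lemma rg_nabla_delta_i_corolla_sum: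
  assumes P: "\<And>\<Gamma>. P \<Gamma> \<Longrightarrow> corolla \<Gamma>" and stable: "stable_ribbon_graph \<Gamma>"
  shows "rg_nabla (corolla_sum P) 0 \<Gamma> + rg_delta_i (corolla_sum P) 0 \<Gamma> =
    (of_bool (\<exists>e. edges \<Gamma> = {e} \<and> \<not> separating \<Gamma> e \<and> P (cut \<Gamma> e)) :: 'k::field_char_0)"
proof -
  let ?f = "\<lambda>e. edge_sign \<Gamma> e * corolla_sum P 0 (cut \<Gamma> e) :: 'k"
  let ?A = "{e \<in> edges \<Gamma>. \<not> separating \<Gamma> e}"
  have "rg_nabla (corolla_sum P) 0 \<Gamma> + rg_delta_i (corolla_sum P) 0 \<Gamma> = sum ?f ?A"
    unfolding rg_nabla_def rg_delta_i_def
    by (subst sum.union_disjoint[symmetric])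
      (use finite_edges[OF stable] in \<open>auto intro!: sum.cong\<close>)
  also have "\<dots> = of_bool (\<exists>e. edges \<Gamma> = {e} \<and> \<not> separating \<Gamma> e \<and> P (cut \<Gamma> e))"
  proof (cases "\<exists>e. edges \<Gamma> = {e}")
    case True
    then obtain e where e: "edges \<Gamma> = {e}" by blast
    then have "?A = (if separating \<Gamma> e then {} else {e})"
      by auto
    then show ?thesis
      using e ori_one_edge[OF stable e] by (simp add: tree_incl_def)
  next
    case False
    have "\<not> P (cut \<Gamma> e)" if "e \<in> edges \<Gamma>" for e
    proof
      assume "P (cut \<Gamma> e)"
      then have "edges \<Gamma> - {e} = {}"
        using corolla_edges[OF P] edges_cut[OF stable that] by simp
      then have "edges \<Gamma> = {e}"
        using that by auto
      then show False
        using False by blast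
    qed
    then have "sum ?f ?A = 0"
      by (intro sum.neutral) (auto simp: tree_incl_def)
    then show ?thesis
      using False by simp
  qed
  finally show ?thesis .
qed

lemma corolla_cut_vts:
  assumes "corolla (cut \<Gamma> e)"
  shows "vts \<Gamma> = {hes \<Gamma>}"
  using corolla_vts[OF assms] by (simp add: cut_def)

text \<open>Cutting keeps the vertices, so a graph whose cut is a corolla has one vertex. It is
  connected before and after the cut, and the edge does not separate.\<close>

lemma rg_delta_e_corolla_sum:
  assumes P: "\<And>\<Gamma>. P \<Gamma> \<Longrightarrow> corolla \<Gamma>" and stable: "stable_ribbon_graph \<Gamma>"
  shows "rg_delta_e (corolla_sum P) 0 \<Gamma> = 0"
proof -
  have "\<not> P (cut \<Gamma> e)" if "separating \<Gamma> e" for e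
  proof
    assume "P (cut \<Gamma> e)"
    then have c: "corolla (cut \<Gamma> e)" by (rule P)
    then show False
      using that components_one_vertex(1)[OF stable corolla_cut_vts[OF c]] corolla_components[OF c]
      by (simp add: separating_def)
  qed
  then show ?thesis
    unfolding rg_delta_e_def by (intro sum.neutral) (auto simp: tree_incl_def)
qed

text \<open>The inner index set of \<open>rg_bracket\<close>: the possible sets of half-edges going
  to the first argument.\<close>

definition bracket_parts :: "'o rgraph \<Rightarrow> nat set \<Rightarrow> nat set set" where
  "bracket_parts \<Gamma> e =
     {K. K \<subseteq> hes \<Gamma> \<and> (\<forall>c \<in> components (cut \<Gamma> e). c \<subseteq> K \<or> c \<inter> K = {}) \<and> card (K \<inter> e) = 1}"

text \<open>A vertex cannot be divided between the two sides, because it lies in one component of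
  the cut graph; so each side is one vertex. At an end of an edge other than \<open>e\<close>, the
  involution of that side would not be the identity, which a corolla excludes.\<close>

lemma corolla_parts:
  assumes stable: "stable_ribbon_graph \<Gamma>" and e: "e \<in> edges \<Gamma>" and K: "K \<in> bracket_parts \<Gamma> e"
    and corollas: "corolla (restrict_graph (cut \<Gamma> e) K)"
      "corolla (restrict_graph (cut \<Gamma> e) (hes \<Gamma> - K))"
  shows "edges \<Gamma> = {e}" "vts \<Gamma> = {K, hes \<Gamma> - K}"
proof -
  have parts: "{v \<in> vts \<Gamma>. v \<subseteq> K} = {K}" "{v \<in> vts \<Gamma>. v \<subseteq> hes \<Gamma> - K} = {hes \<Gamma> - K}"
    using corollas[THEN corolla_vts] by (simp_all add: restrict_graph_def cut_def)
  have inside: "c \<subseteq> K \<or> c \<subseteq> hes \<Gamma> - K" if "c \<in> vts \<Gamma>" for c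
  proof -
    have "c \<in> vts (cut \<Gamma> e)"
      using that by (simp add: cut_def)
    then obtain c' where "c' \<in> components (cut \<Gamma> e)" "c \<subseteq> c'"
      using vertex_in_component[OF stable_cut[OF stable e]] by blast
    moreover from this(1) K have "c' \<subseteq> K \<or> c' \<inter> K = {}"
      by (simp add: bracket_parts_def)
    ultimately show ?thesis
      using vertex_subset[OF stable that] by blast
  qed
  have "c \<in> {K, hes \<Gamma> - K}" if "c \<in> vts \<Gamma>" for c
  proof -
    have "c \<in> {v \<in> vts \<Gamma>. v \<subseteq> K} \<or> c \<in> {v \<in> vts \<Gamma>. v \<subseteq> hes \<Gamma> - K}"
      using inside[OF that] that by simp
    then show ?thesis
      unfolding parts by simp
  qed
  moreover have "K \<in> {v \<in> vts \<Gamma>. v \<subseteq> K}" "hes \<Gamma> - K \<in> {v \<in> vts \<Gamma>. v \<subseteq> hes \<Gamma> - K}"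
    unfolding parts by simp_all
  ultimately show "vts \<Gamma> = {K, hes \<Gamma> - K}"
    by (intro equalityI subsetI) auto
  have "h \<in> e" if h: "h \<in> hes \<Gamma>" "sig1 \<Gamma> h \<noteq> h" for h
  proof (rule ccontr)
    assume "h \<notin> e"
    \<comment> \<open>The side that contains \<open>h\<close>.\<close>
    define J where "J = (if h \<in> K then K else hes \<Gamma> - K)"
    have J: "corolla (restrict_graph (cut \<Gamma> e) J)" "h \<in> J"
      using corollas h by (auto simp: J_def)
    have "sig1 (restrict_graph (cut \<Gamma> e) J) h = sig1 \<Gamma> h"
      using J(2) \<open>h \<notin> e\<close> by (simp add: restrict_graph_def cut_def)
    then show False
      using corolla_sig1[OF J(1)] h by simp
  qed
  then have "f = e" if "f \<in> edges \<Gamma>" for f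
    using edgeE[OF stable that] edge_eq[OF stable] e that by metis
  then show "edges \<Gamma> = {e}"
    using e by blast
qed

text \<open>By \<open>corolla_parts\<close> the conditions on edges and vertices follow from the two
  values of \<open>P\<close>. They are displayed to let the summand vanish visibly on graphs of any
  other shape.\<close>

lemma rg_bracket_corolla_sum:
  assumes P: "\<And>\<Gamma>. P \<Gamma> \<Longrightarrow> corolla \<Gamma>" and stable: "stable_ribbon_graph \<Gamma>"
  shows "rg_bracket (corolla_sum P) (corolla_sum P) 0 \<Gamma> =
    (\<Sum>e \<in> edges \<Gamma>. \<Sum>K \<in> bracket_parts \<Gamma> e.
       of_bool (edges \<Gamma> = {e} \<and> vts \<Gamma> = {K, hes \<Gamma> - K} \<and> P (restrict_graph (cut \<Gamma> e) K) \<and>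
         P (restrict_graph (cut \<Gamma> e) (hes \<Gamma> - K))) :: 'k::field_char_0)"
proof -
  have "reorder_sign (ori \<Gamma>) (xs @ e # ys) * corolla_sum P 0 (restrict_graph (cut \<Gamma> e) K) *
      corolla_sum P 0 (restrict_graph (cut \<Gamma> e) (hes \<Gamma> - K)) =
    (of_bool (edges \<Gamma> = {e} \<and> vts \<Gamma> = {K, hes \<Gamma> - K} \<and> P (restrict_graph (cut \<Gamma> e) K) \<and>
         P (restrict_graph (cut \<Gamma> e) (hes \<Gamma> - K))) :: 'k)"
    if "e \<in> edges \<Gamma>" "K \<in> bracket_parts \<Gamma> e" for e K xs ys
    using corolla_parts[OF stable that] P ori_one_edge[OF stable, of e]
    by (auto simp: tree_incl_def)
  then show ?thesis
    unfolding rg_bracket_def bracket_parts_def[symmetric] Let_def by (auto intro!: sum.cong)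
qed

text \<open>A vertex away from \<open>e\<close> would survive next to the merged vertex, so it would
  have to be equal to it. But the merged vertex is made of half-edges of vertices meeting
  \<open>e\<close>, and distinct vertices are disjoint.\<close>

lemma corolla_contract_touching:
  assumes stable: "stable_ribbon_graph \<Gamma>" and e: "contractible \<Gamma> e"
    and corolla: "corolla (contract \<Gamma> e)" and v: "v \<in> vts \<Gamma>"
  shows "v \<inter> e \<noteq> {}"
proof
  assume disj: "v \<inter> e = {}"
  have "v \<in> vts (contract \<Gamma> e)" "merged_vertex \<Gamma> e \<in> vts (contract \<Gamma> e)"
    using v disj by (auto simp: contract_def Let_def)
  then have "v = merged_vertex \<Gamma> e"
    using corolla_vts[OF corolla] by auto
  then show False
    using disj vertex_unique[OF stable v] vertex_nonempty[OF stable v]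
    unfolding merged_vertex_def by blast
qed

text \<open>Cutting the bridge separates its two vertices, and a union of components with exactly
  one end of the edge is one of them.\<close>

lemma (in bridge_graph) bracket_parts: "bracket_parts \<Gamma> {a, b} = {va, vb}"
proof -
  have e: "{a, b} \<in> edges \<Gamma>" using edges by simp
  have "components (cut \<Gamma> {a, b}) = {va, vb}"
    using components_no_edges[OF stable_cut[OF stable e]] edges_cut[OF stable e] edges
    by (simp add: cut_def vts)
  moreover have "K = va \<or> K = vb"
    if "K \<subseteq> hes \<Gamma>" "va \<subseteq> K \<or> va \<inter> K = {}" "vb \<subseteq> K \<or> vb \<inter> K = {}" "card (K \<inter> {a, b}) = 1" for K
  proof -
    have "K \<inter> {a, b} \<noteq> {}"
      using that(4) by (metis card.empty zero_neq_one)
    moreover have "K \<inter> {a, b} \<noteq> {a, b}"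
    proof
      assume eq: "K \<inter> {a, b} = {a, b}"
      show False
        using that(4) ab unfolding eq by simp
    qed
    ultimately have "a \<in> K \<longleftrightarrow> b \<notin> K"
      by blast
    then show ?thesis
      using that(1-3) va vb disjoint unfolding hes by blast
  qed
  moreover have "va \<inter> {a, b} = {a}" "vb \<inter> {a, b} = {b}"
    using va vb not_in by auto
  ultimately show ?thesis
    using disjoint unfolding bracket_parts_def by (auto simp: hes)
qed

text \<open>Restricting to a vertex keeps its cycles and defects, so the stability of the whole
  graph passes to each side.\<close>

lemma (in bridge_graph) parts:
  assumes v: "v \<in> {va, vb}"
  shows "corolla (restrict_graph (cut \<Gamma> {a, b}) v)"
    "card (cyc \<Gamma> ` v) = 1 \<Longrightarrow> gdf \<Gamma> v = 0 \<Longrightarrow> bdf \<Gamma> v = {#} \<Longrightarrow>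
      tree_corolla (restrict_graph (cut \<Gamma> {a, b}) v)"
proof -
  let ?R = "restrict_graph (cut \<Gamma> {a, b}) v"
  have v': "v \<in> vts \<Gamma>" using v vts by simp
  have vs: "{u \<in> vts \<Gamma>. u \<subseteq> v} = {v}"
    using v vts disjoint va vb by auto
  have cyc: "cyc ?R h = cyc \<Gamma> h" if "h \<in> v" for h
    unfolding cyc_def using that sig0_image_vts[OF stable v']
    by (intro orbit_cong0[of _ v]) (auto simp: restrict_graph_def cut_def)
  then have cycs: "cyc ?R ` v = cyc \<Gamma> ` v"
    by auto
  have e: "{a, b} \<in> edges \<Gamma>" using edges by simp
  have cut: "sig1 (cut \<Gamma> {a, b}) = id"
    using sig1_no_edges[OF stable_cut[OF stable e]] edges_cut[OF stable e] edges by simp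
  have R: "hes ?R = v" "vts ?R = {v}" "sig1 ?R = id" "ori ?R = []"
    "sig0 ?R = (\<lambda>h. if h \<in> v then sig0 \<Gamma> h else h)" "gdf ?R = gdf \<Gamma>" "bdf ?R = bdf \<Gamma>"
    using vs cut ori_one_edge[OF stable edges]
    by (simp_all add: restrict_graph_def fun_eq_iff)
  have "(\<lambda>h. if h \<in> v then sig0 \<Gamma> h else h) permutes v"
  proof (rule bij_imp_permutes)
    show "bij_betw (\<lambda>h. if h \<in> v then sig0 \<Gamma> h else h) v v"
      using sig0_image_vts[OF stable v'] by (auto simp: bij_betw_def inj_on_def image_iff)
  qed auto
  moreover have "edges ?R = {}" "leaves ?R = v"
    by (auto simp: edges_def leaves_def R)
  moreover have "partition_on v {v}"
    using vertex_nonempty[OF stable v'] by (simp add: partition_on_def)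
  moreover have "finite v"
    using fin vertex_subset[OF stable v'] finite_subset by blast
  ultimately show cor: "corolla ?R"
    using sig0_image_vts[OF stable v'] stable_vertex[OF stable v'] cycs
    by (simp add: corolla_def stable_ribbon_graph_def R permutes_id cong: image_cong_simp)
  show "tree_corolla ?R" if "card (cyc \<Gamma> ` v) = 1" "gdf \<Gamma> v = 0" "bdf \<Gamma> v = {#}"
    using that cor cycs by (simp add: tree_corolla_def R)
qed

lemma one_edge_graphI:
  assumes "stable_ribbon_graph \<Gamma>" "edges \<Gamma> = {e}" "\<And>v. v \<in> vts \<Gamma> \<Longrightarrow> v \<inter> e \<noteq> {}"
    "hes \<Gamma> - e \<noteq> {}"
  obtains a b where "e = {a, b}" "one_edge_graph \<Gamma> a b"
proof -
  have "e \<in> edges \<Gamma>" using assms(2) by simp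
  then obtain a b where ab: "e = {a, b}" "a \<noteq> b" "a \<in> hes \<Gamma>" "b \<in> hes \<Gamma>"
      "sig1 \<Gamma> a = b" "sig1 \<Gamma> b = a"
    by (rule edgeE[OF assms(1)])
  then have "one_edge_graph \<Gamma> a b"
    using assms by unfold_locales auto
  then show thesis
    using that ab(1) by blast
qed

lemma (in one_edge_graph) loop_or_bridge:
  obtains "loop_graph \<Gamma> a b" | va vb where "bridge_graph \<Gamma> a b va vb"
proof -
  obtain va vb where v: "va \<in> vts \<Gamma>" "a \<in> va" "vb \<in> vts \<Gamma>" "b \<in> vb"
    using obtain_vertex[OF stable] a_in b_in by metis
  have vts: "vts \<Gamma> = {va, vb}"
    using touching v vertex_unique[OF stable] by blast
  show thesis
  proof (cases "va = vb")
    case True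
    then have "vts \<Gamma> = {hes \<Gamma>}"
      using vts components_one_vertex(2)[OF stable, of va] by simp
    then have "loop_graph \<Gamma> a b"
      by unfold_locales
    then show thesis by (rule that(1))
  next
    case False
    then have "bridge_graph \<Gamma> a b va vb"
      using v by unfold_locales auto
    then show thesis by (rule that(2))
  qed
qed

lemma (in loop_graph) loop_terms:
  "\<not> separating \<Gamma> {a, b}" "corolla (cut \<Gamma> {a, b})" "vts \<Gamma> \<noteq> {K, hes \<Gamma> - K}"
proof -
  have e: "{a, b} \<in> edges \<Gamma>" using edges by simp
  show c: "corolla (cut \<Gamma> {a, b})"
    using stable_cut[OF stable e] edges_cut[OF stable e] by (simp add: corolla_def vts edges)
  show "\<not> separating \<Gamma> {a, b}"
    using corolla_components[OF c] components_one_vertex(1)[OF stable vts] by (simp add: separating_def)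
  show "vts \<Gamma> \<noteq> {K, hes \<Gamma> - K}"
  proof
    assume "vts \<Gamma> = {K, hes \<Gamma> - K}"
    then have "K = hes \<Gamma>" "hes \<Gamma> - K = hes \<Gamma>"
      using vts by auto
    then show False
      using a_in by blast
  qed
qed

text \<open>Either vertex may go to the first argument, which gives the 2 that compensates the
  factor 1/2 of the equation.\<close>

lemma (in bridge_graph) bracket_value:
  "rg_bracket (corolla_sum P) (corolla_sum P) 0 \<Gamma> = (2 :: 'k::field_char_0)"
  if P: "\<And>\<Gamma>. P \<Gamma> \<Longrightarrow> corolla \<Gamma>"
    and "P (restrict_graph (cut \<Gamma> {a, b}) va)" "P (restrict_graph (cut \<Gamma> {a, b}) vb)"
proof -
  have "hes \<Gamma> - va = vb" "hes \<Gamma> - vb = va"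
    using hes disjoint by auto
  then show ?thesis
    using rg_bracket_corolla_sum[of P, OF P stable, where ?'k = 'k] distinct edges vts that
    by (simp add: bracket_parts insert_commute)
qed

text \<open>Each kind of nonzero term forces the edge to meet every vertex: a contraction by
  \<open>corolla_contract_touching\<close>, a cut because a corolla has only one vertex, the bracket
  because the two sides are single vertices, each holding one end.\<close>

lemma no_edge_terms:
  assumes P: "\<And>\<Gamma>. P \<Gamma> \<Longrightarrow> corolla \<Gamma>" and stable: "stable_ribbon_graph \<Gamma>"
    and no: "\<nexists>e. edges \<Gamma> = {e} \<and> (\<forall>v \<in> vts \<Gamma>. v \<inter> e \<noteq> {})"
  shows "rg_d (corolla_sum P) 0 \<Gamma> = (0 :: 'k::field_char_0)"
    "rg_nabla (corolla_sum P) 0 \<Gamma> + rg_delta_i (corolla_sum P) 0 \<Gamma> = (0 :: 'k)"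
    "rg_bracket (corolla_sum P) (corolla_sum P) 0 \<Gamma> = (0 :: 'k)"
proof -
  have *: False if "edges \<Gamma> = {e}" "\<And>v. v \<in> vts \<Gamma> \<Longrightarrow> v \<inter> e \<noteq> {}" for e
    using no that by blast
  have "\<not> (edges \<Gamma> = {e} \<and> contractible \<Gamma> e \<and> P (contract \<Gamma> e))" for e
    using *[of e] corolla_contract_touching[OF stable _ P] by blast
  then show "rg_d (corolla_sum P) 0 \<Gamma> = (0 :: 'k)"
    by (subst rg_d_corolla_sum[of P, OF P stable]) auto
  have "\<not> P (cut \<Gamma> e)" if e: "edges \<Gamma> = {e}" for e
  proof
    assume "P (cut \<Gamma> e)"
    then have vts: "vts \<Gamma> = {hes \<Gamma>}"
      by (intro corolla_cut_vts P)
    have "e \<in> edges \<Gamma>" using e by simp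
    then obtain a b where "e = {a, b}" "a \<in> hes \<Gamma>"
      by (rule edgeE[OF stable])
    then show False
      by (intro *[OF e]) (auto simp: vts)
  qed
  then show "rg_nabla (corolla_sum P) 0 \<Gamma> + rg_delta_i (corolla_sum P) 0 \<Gamma> = (0 :: 'k)"
    by (subst rg_nabla_delta_i_corolla_sum[of P, OF P stable]) auto
  have none: "\<not> (edges \<Gamma> = {e} \<and> vts \<Gamma> = {K, hes \<Gamma> - K})" if K: "K \<in> bracket_parts \<Gamma> e" for e K
  proof
    assume A: "edges \<Gamma> = {e} \<and> vts \<Gamma> = {K, hes \<Gamma> - K}"
    then have "e \<in> edges \<Gamma>" by simp
    then obtain a b where ab: "e = {a, b}" "a \<noteq> b" "a \<in> hes \<Gamma>" "b \<in> hes \<Gamma>"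
      by (rule edgeE[OF stable])
    have one: "card (K \<inter> e) = 1"
      using K by (simp add: bracket_parts_def)
    then have "K \<inter> e \<noteq> {}"
      by auto
    moreover have "(hes \<Gamma> - K) \<inter> e \<noteq> {}"
    proof
      assume "(hes \<Gamma> - K) \<inter> e = {}"
      then have eq: "K \<inter> e = e" using ab by auto
      show False
        using one ab unfolding eq by simp
    qed
    ultimately have "v \<inter> e \<noteq> {}" if "v \<in> vts \<Gamma>" for v
      using A that by auto
    then show False
      using * A by blast
  qed
  have "(of_bool (edges \<Gamma> = {e} \<and> vts \<Gamma> = {K, hes \<Gamma> - K} \<and> A \<and> B) :: 'k) = 0"
    if "K \<in> bracket_parts \<Gamma> e" for e K A B
    using none[OF that] by (simp only: of_bool_eq_0_iff) blast
  then show "rg_bracket (corolla_sum P) (corolla_sum P) 0 \<Gamma> = (0 :: 'k)"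
    by (subst rg_bracket_corolla_sum[of P, OF P stable]) (auto simp only: intro!: sum.neutral)
qed

lemma corolla_sum_mem_sRG:
  assumes P: "\<And>\<Gamma>. P \<Gamma> \<Longrightarrow> corolla \<Gamma>"
    and iso: "\<And>\<Gamma> \<Gamma>'. P \<Gamma> \<Longrightarrow> (\<Gamma>, \<Gamma>') \<in> iso_rel \<Longrightarrow> P \<Gamma>'"
  shows "corolla_sum P \<in> (sRG :: ('o, 'k::field_char_0) cochain set)"
proof -
  have "P \<Gamma> \<longleftrightarrow> P \<Gamma>'" if "admissible \<Gamma>" "admissible \<Gamma>'" "graph_iso f \<Gamma> \<Gamma>'" for \<Gamma> \<Gamma>' f
  proof -
    have "(\<Gamma>, \<Gamma>') \<in> iso_rel"
      using that by (auto simp: iso_rel_def admissible_def)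
    moreover from this have "(\<Gamma>', \<Gamma>) \<in> iso_rel"
      using equiv_iso_rel by (meson equivE symE)
    ultimately show ?thesis
      using iso by blast
  qed
  moreover have "admissible \<Gamma>" if "P \<Gamma>" for \<Gamma>
    using corolla_admissible[OF P[OF that]] .
  moreover have "card (components \<Gamma>) \<le> 1" if "P \<Gamma>" for \<Gamma>
    using corolla_components[OF P[OF that]] by simp
  moreover have "ori \<Gamma> = []" if "P \<Gamma>" for \<Gamma>
    using corolla_ori[OF P[OF that]] .
  ultimately show ?thesis
    unfolding sRG_def tree_incl_def by auto
qed

lemma corolla_sum_MCE:
  "corolla_sum corolla \<in> (MCE_sRG d :: ('o, 'k::field_char_0) cochain set)"
proof -
  let ?S = "corolla_sum corolla :: ('o, 'k) cochain"
  have "- rg_d ?S k \<Gamma> + rg_nabla ?S k \<Gamma> + rg_delta_i ?S k \<Gamma> + rg_gamma (rg_delta_e ?S) k \<Gamma>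
      + rg_bracket ?S ?S k \<Gamma> / 2 = 0" if adm: "admissible \<Gamma>" for k \<Gamma>
  proof (cases "k = 0")
    \<comment> \<open>For \<open>k > 0\<close> only \<open>rg_delta_e\<close> could contribute,
      through the shift by \<open>rg_gamma\<close>, and it vanishes.\<close>
    case False
    have "?S k = (\<lambda>_. 0)"
      using False by (simp add: tree_incl_def fun_eq_iff)
    moreover have "?S j \<Gamma>\<^sub>1 * ?S (k - j) \<Gamma>\<^sub>2 = 0" for j \<Gamma>\<^sub>1 \<Gamma>\<^sub>2
      using False by (simp add: tree_incl_def)
    then have "rg_bracket ?S ?S k \<Gamma> = 0"
      unfolding rg_bracket_def Let_def mult.assoc by (simp only: mult_zero_right sum.neutral_const)
    moreover have "rg_delta_e ?S (k - 1) \<Gamma> = 0"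
    proof (cases "k = 1")
      case True
      then show ?thesis
        using rg_delta_e_corolla_sum[of corolla \<Gamma>] adm by (simp add: admissible_def)
    qed (use False in \<open>simp add: rg_delta_e_def tree_incl_def\<close>)
    ultimately show ?thesis
      by (simp add: rg_d_def rg_nabla_def rg_delta_i_def rg_gamma_def)
  next
    case True
    have stable: "stable_ribbon_graph \<Gamma>"
      using adm by (simp add: admissible_def)
    have "- rg_d ?S 0 \<Gamma> + (rg_nabla ?S 0 \<Gamma> + rg_delta_i ?S 0 \<Gamma>) + rg_bracket ?S ?S 0 \<Gamma> / 2 = 0"
    proof (cases "\<exists>e. edges \<Gamma> = {e} \<and> (\<forall>v \<in> vts \<Gamma>. v \<inter> e \<noteq> {})")
      case False
      then show ?thesis
        using no_edge_terms[of corolla, OF _ stable False, where ?'k = 'k] by simp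
    next
      case True
      then obtain e where e: "edges \<Gamma> = {e}" "\<forall>v \<in> vts \<Gamma>. v \<inter> e \<noteq> {}"
        by (elim exE conjE) (rule that)
      have "e \<in> edges \<Gamma>" using e(1) by simp
      then obtain a b where e': "e = {a, b}" "a \<noteq> b" "a \<in> hes \<Gamma>" "sig1 \<Gamma> a = b" "sig1 \<Gamma> b = a"
        by (rule edgeE[OF stable])
      \<comment> \<open>A leaf is a half-edge outside \<open>e\<close>. Without one the edge would
        not be contractible, while its cut could still consist of corollas, and nothing would cancel
        that term.\<close>
      have "leaves \<Gamma> \<noteq> {}"
        using adm e'(3) unfolding admissible_def components_def by blast
      then obtain l where l: "l \<in> hes \<Gamma>" "sig1 \<Gamma> l = l"
        by (auto simp: leaves_def)
      then have "l \<noteq> a" "l \<noteq> b"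
        using e' by metis+
      then have "hes \<Gamma> - e \<noteq> {}"
        using l(1) e'(1) by blast
      then obtain a b where ab: "e = {a, b}" "one_edge_graph \<Gamma> a b"
        using one_edge_graphI[OF stable e(1) bspec[OF e(2)]] by metis
      interpret one_edge_graph \<Gamma> a b by fact
      from loop_or_bridge show ?thesis
      proof cases
        case 1
        then interpret loop_graph \<Gamma> a b .
        have "rg_d ?S 0 \<Gamma> = 1" "rg_nabla ?S 0 \<Gamma> + rg_delta_i ?S 0 \<Gamma> = 1"
          using rg_d_corolla_sum[of corolla \<Gamma>] rg_nabla_delta_i_corolla_sum[of corolla \<Gamma>]
            stable edges contractible corolla_contract loop_terms by simp_all
        moreover have "rg_bracket ?S ?S 0 \<Gamma> = 0"
          using rg_bracket_corolla_sum[of corolla \<Gamma>] stable loop_terms(3) by simp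
        ultimately show ?thesis
          by simp
      next
        case (2 va vb)
        then interpret bridge_graph \<Gamma> a b va vb .
        have "\<not> corolla (cut \<Gamma> {a, b})"
          using vts distinct by (auto simp: corolla_def)
        then have "rg_d ?S 0 \<Gamma> = 1" "rg_nabla ?S 0 \<Gamma> + rg_delta_i ?S 0 \<Gamma> = 0"
          using rg_d_corolla_sum[of corolla \<Gamma>] rg_nabla_delta_i_corolla_sum[of corolla \<Gamma>]
            stable edges contractible corolla_contract by simp_all
        moreover have "rg_bracket ?S ?S 0 \<Gamma> = 2"
          using parts by (intro bracket_value) auto
        ultimately show ?thesis
          by simp
      qed
    qed
    then show ?thesis
      using \<open>k = 0\<close> by (simp add: rg_gamma_def algebra_simps)
  qed
  moreover have "?S \<in> sRG"
    by (rule corolla_sum_mem_sRG) (auto intro: corolla_iso)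
  ultimately show ?thesis
    unfolding MCE_sRG_def by (auto simp: tree_incl_def corolla_edges corolla_components)
qed

section \<open>The equation for trees, on ribbon forests\<close>

lemma restrict_graph_hes:
  assumes "stable_ribbon_graph \<Gamma>"
  shows "restrict_graph \<Gamma> (hes \<Gamma>) = \<Gamma>"
proof -
  have "{v \<in> vts \<Gamma>. v \<subseteq> hes \<Gamma>} = vts \<Gamma>"
    using vertex_subset[OF assms] by blast
  moreover have "filter (\<lambda>e. e \<subseteq> hes \<Gamma>) (ori \<Gamma>) = ori \<Gamma>"
    using edge_subset[OF assms] set_ori[OF assms] by (simp add: filter_id_conv)
  moreover have "(\<lambda>h. if h \<in> hes \<Gamma> then sig0 \<Gamma> h else h) = sig0 \<Gamma>"
    "(\<lambda>h. if h \<in> hes \<Gamma> then sig1 \<Gamma> h else h) = sig1 \<Gamma>"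
    using permutes_not_in[OF sig0_permutes[OF assms]] permutes_not_in[OF sig1_permutes[OF assms]]
    by (auto simp: fun_eq_iff)
  ultimately show ?thesis
    by (simp add: restrict_graph_def)
qed

text \<open>Passing to the component of a vertex keeps its defects and cycles, so the conditions can
  be read off from a ribbon tree.\<close>

lemma ribbon_forest_vertex:
  assumes "ribbon_forest \<Gamma>" "v \<in> vts \<Gamma>"
  shows "gdf \<Gamma> v = 0 \<and> bdf \<Gamma> v = {#} \<and> card (cyc \<Gamma> ` v) = 1"
proof -
  have stable: "stable_ribbon_graph \<Gamma>"
    using assms(1) by (simp add: ribbon_forest_def)
  obtain K where K: "K \<in> components \<Gamma>" "v \<subseteq> K"
    using vertex_in_component[OF stable assms(2)] .
  let ?R = "restrict_graph \<Gamma> K"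
  have "sig0 \<Gamma> h \<in> v" if "h \<in> v" for h
    using imageI[OF that, of "sig0 \<Gamma>"] sig0_image_vts[OF stable assms(2)] by simp
  then have "cyc ?R h = cyc \<Gamma> h" if "h \<in> v" for h
    unfolding cyc_def using that K(2)
    by (intro orbit_cong0[of _ v]) (auto simp: restrict_graph_def)
  then have "cyc ?R ` v = cyc \<Gamma> ` v"
    by (intro image_cong refl) auto
  moreover have "ribbon_tree ?R"
    using assms(1) K(1) by (simp add: ribbon_forest_def)
  moreover have "v \<in> vts ?R" "gdf ?R = gdf \<Gamma>" "bdf ?R = bdf \<Gamma>"
    using assms(2) K(2) by (auto simp: restrict_graph_def)
  ultimately show ?thesis
    unfolding ribbon_tree_def by metis
qed

lemma tree_corolla_sum_MCE:
  "(\<lambda>\<Gamma>. of_bool (tree_corolla \<Gamma>)) \<in> (MCE_RT d :: ('o rgraph \<Rightarrow> 'k::field_char_0) set)"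
proof -
  let ?D = "corolla_sum tree_corolla :: ('o, 'k) cochain"
  have cor: "corolla \<Gamma>" if "tree_corolla \<Gamma>" for \<Gamma> :: "'o rgraph"
    using that by (simp add: tree_corolla_def)
  have "ribbon_forest \<Gamma>" if "tree_corolla \<Gamma>" for \<Gamma> :: "'o rgraph"
    using that corolla_components[OF cor[OF that]] restrict_graph_hes[OF corolla_stable[OF cor[OF that]]]
    by (simp add: ribbon_forest_def tree_corolla_iff corolla_stable)
  moreover have "?D \<in> sRG"
    using cor by (intro corolla_sum_mem_sRG) (auto intro: tree_corolla_iso)
  moreover have "- rg_d ?D 0 \<Gamma> + rg_bracket ?D ?D 0 \<Gamma> / 2 = 0" if forest: "ribbon_forest \<Gamma>" for \<Gamma>
  proof -
    have stable: "stable_ribbon_graph \<Gamma>"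
      using forest by (simp add: ribbon_forest_def)
    note trivial = ribbon_forest_vertex[OF forest]
    show ?thesis
    proof (cases "\<exists>e. edges \<Gamma> = {e} \<and> (\<forall>v \<in> vts \<Gamma>. v \<inter> e \<noteq> {})")
      case False
      then show ?thesis
        using no_edge_terms[of tree_corolla, OF cor stable False, where ?'k = 'k] by simp
    next
      case True
      then obtain e where e: "edges \<Gamma> = {e}" "\<forall>v \<in> vts \<Gamma>. v \<inter> e \<noteq> {}"
        by (elim exE conjE) (rule that)
      have "e \<in> edges \<Gamma>" using e(1) by simp
      then obtain a b where e': "e = {a, b}" "a \<in> hes \<Gamma>" "b \<in> hes \<Gamma>"
        by (rule edgeE[OF stable])
      then obtain v where v: "v \<in> vts \<Gamma>"
        using obtain_vertex[OF stable] by blast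
      \<comment> \<open>In place of a leaf, the valence bound provides a half-edge outside
        \<open>e\<close>.\<close>
      then have "card v \<ge> 3"
        using stable_vertex[OF stable] trivial by blast
      then have "\<not> v \<subseteq> {a, b}"
        using card_mono[of "{a, b}" v] card_insert_le_m1[of 2 "{b}" a] by fastforce
      then have "hes \<Gamma> - e \<noteq> {}"
        using vertex_subset[OF stable v] e' by auto
      then obtain a b where ab: "e = {a, b}" "one_edge_graph \<Gamma> a b"
        using one_edge_graphI[OF stable e(1) bspec[OF e(2)]] by metis
      interpret one_edge_graph \<Gamma> a b by fact
      from loop_or_bridge show ?thesis
      proof cases
        case 1
        then interpret loop_graph \<Gamma> a b .
        \<comment> \<open>A loop is settled by the vanishing of both terms, without reference to
          faces or genus.\<close>
        have "rg_d ?D 0 \<Gamma> = 0" "rg_bracket ?D ?D 0 \<Gamma> = 0"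
          using rg_d_corolla_sum[of tree_corolla, OF cor stable] rg_bracket_corolla_sum[of tree_corolla, OF cor stable]
            edges not_tree_corolla_contract loop_terms(3) by simp_all
        then show ?thesis
          by simp
      next
        case (2 va vb)
        then interpret bridge_graph \<Gamma> a b va vb .
        have "rg_d ?D 0 \<Gamma> = 1"
          using rg_d_corolla_sum[of tree_corolla, OF cor stable] edges contractible tree_corolla_contract[OF trivial]
          by simp
        moreover have "rg_bracket ?D ?D 0 \<Gamma> = 2"
          using parts(2) trivial va vb by (intro bracket_value cor) auto
        ultimately show ?thesis
          by simp
      qed
    qed
  qed
  moreover have "edges \<Gamma> = {}" "components \<Gamma> = {hes \<Gamma>}" if "tree_corolla \<Gamma>" for \<Gamma> :: "'o rgraph"
    using cor[OF that] corolla_edges corolla_components by auto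
  ultimately show ?thesis
    unfolding MCE_RT_def RT_def by auto
qed

section \<open>Invariance of functionals under rearranging words\<close>

lemma psign_psign [simp]: "psign n * (psign n * x) = (x :: 'k::field_char_0)"
  by (simp add: psign_def)

lemma before_in_set: "before xs a b \<Longrightarrow> a \<in> set xs \<and> b \<in> set xs"
  unfolding before_def by (auto intro: nth_mem order.strict_trans)

lemma before_append:
  "before (xs @ ys) a b \<longleftrightarrow> before xs a b \<or> before ys a b \<or> a \<in> set xs \<and> b \<in> set ys"
proof
  assume "before (xs @ ys) a b"
  then obtain i j where ij: "i < j" "j < length xs + length ys" "(xs @ ys) ! i = a" "(xs @ ys) ! j = b"
    by (auto simp: before_def)
  consider "j < length xs" | "i < length xs" "j \<ge> length xs" | "i \<ge> length xs"
    using ij(1) by linarith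
  then show "before xs a b \<or> before ys a b \<or> a \<in> set xs \<and> b \<in> set ys"
  proof cases
    case 1
    then show ?thesis
      using ij unfolding before_def by (auto simp: nth_append)
  next
    case 2
    then have "a = xs ! i" "b = ys ! (j - length xs)" "j - length xs < length ys"
      using ij by (auto simp: nth_append)
    then show ?thesis
      using 2 by auto
  next
    case 3
    then have "i - length xs < j - length xs \<and> j - length xs < length ys \<and>
        ys ! (i - length xs) = a \<and> ys ! (j - length xs) = b"
      using ij by (auto simp: nth_append)
    then show ?thesis
      unfolding before_def by blast
  qed
next
  assume "before xs a b \<or> before ys a b \<or> a \<in> set xs \<and> b \<in> set ys"
  then consider "before xs a b" | "before ys a b" | "a \<in> set xs" "b \<in> set ys"
    by blast
  then show "before (xs @ ys) a b"
  proof cases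
    case 1
    then obtain i j where "i < j" "j < length xs" "xs ! i = a" "xs ! j = b"
      by (auto simp: before_def)
    then show ?thesis
      unfolding before_def by (intro exI[of _ i] exI[of _ j]) (simp add: nth_append)
  next
    case 2
    then obtain i j where "i < j" "j < length ys" "ys ! i = a" "ys ! j = b"
      by (auto simp: before_def)
    then show ?thesis
      unfolding before_def
      by (intro exI[of _ "length xs + i"] exI[of _ "length xs + j"]) (simp add: nth_append)
  next
    case 3
    then obtain i j where "i < length xs" "xs ! i = a" "j < length ys" "ys ! j = b"
      by (auto simp: in_set_conv_nth)
    then show ?thesis
      unfolding before_def
      by (intro exI[of _ i] exI[of _ "length xs + j"]) (simp add: nth_append)
  qed
qed

lemma before_total:
  assumes "distinct xs" "a \<in> set xs" "b \<in> set xs" "a \<noteq> b"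
  shows "before xs a b \<longleftrightarrow> \<not> before xs b a"
proof -
  obtain i j where ij: "i < length xs" "xs ! i = a" "j < length xs" "xs ! j = b"
    using assms by (auto simp: in_set_conv_nth)
  have "before xs (xs ! i) (xs ! j) \<longleftrightarrow> i < j" if "i < length xs" "j < length xs" for i j
    unfolding before_def using that assms(1) by (auto simp: nth_eq_iff_index_eq)
  then show ?thesis
    using ij assms(4) by (metis linorder_neqE_nat order.asym)
qed

lemma ksign_self:
  assumes "distinct xs"
  shows "ksign dg xs xs = 1"
proof -
  have "\<not> (before xs a b \<and> before xs b a)" for a b
  proof (cases "a = b")
    case True
    then show ?thesis
      using assms unfolding before_def by (auto simp: nth_eq_iff_index_eq)
  next
    case False
    then show ?thesis
      using before_total[OF assms] before_in_set by metis
  qed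
  then have "{(a, b). before xs a b \<and> before xs b a \<and> odd (dg a) \<and> odd (dg b)} = {}"
    by blast
  then show ?thesis
    unfolding ksign_def by (simp only: card.empty power_0)
qed

lemma even_sum_list_iff:
  assumes "distinct xs"
  shows "even (sum_list (map dg xs)) \<longleftrightarrow> even (card {x \<in> set xs. odd (dg x :: int)})"
  using assms
proof (induction xs)
  case (Cons x xs)
  have "{y \<in> set (x # xs). odd (dg y)} =
      (if odd (dg x) then insert x {y \<in> set xs. odd (dg y)} else {y \<in> set xs. odd (dg y)})"
    by auto
  then show ?case
    using Cons by simp
qed simp

text \<open>Only pairs with one symbol in \<open>u\<close> and one in \<open>w\<close> change their
  relative order, and each of these is out of order against \<open>xs\<close> in exactly one of the
  two arrangements. So on these pairs the two numbers of odd inversions add up to the product of the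
  numbers of odd symbols in the blocks, which has the parity of the product of the degrees.\<close>

lemma ksign_swap_blocks:
  assumes xs: "distinct xs" "set xs = set (p @ u @ w @ q)" and ys: "distinct (p @ u @ w @ q)"
  shows "ksign dg xs (p @ w @ u @ q) =
    psign (sum_list (map dg u) * sum_list (map dg w)) * (ksign dg xs (p @ u @ w @ q) :: 'k::field_char_0)"
proof -
  let ?Inv = "\<lambda>zs. {(a, b). before xs a b \<and> before zs b a \<and> odd (dg a) \<and> odd (dg b)}"
  let ?cross = "\<lambda>u w. {(a, b). before xs a b \<and> a \<in> set w \<and> b \<in> set u \<and> odd (dg a) \<and> odd (dg b)}"
  \<comment> \<open>The inversions common to both arrangements.\<close>
  define N where "N = ?Inv (p @ u @ w @ q) - ?cross u w"
  have "?Inv zs \<subseteq> set xs \<times> set xs" "?cross s t \<subseteq> set xs \<times> set xs" for zs s t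
    using before_in_set[of xs] by blast+
  then have fin: "finite (?Inv zs)" "finite (?cross s t)" for zs s t
    by (meson List.finite_set finite_SigmaI finite_subset)+
  then have "finite N"
    by (simp add: N_def)
  have split: "before (p @ s @ t @ q) b a \<longleftrightarrow>
      (before p b a \<or> before s b a \<or> before t b a \<or> before q b a \<or>
        b \<in> set p \<and> a \<in> set s \<union> set t \<union> set q \<or> b \<in> set s \<union> set t \<and> a \<in> set q) \<or>
      b \<in> set s \<and> a \<in> set t" for s t a b
    by (auto simp: before_append)
  have disj: "set u \<inter> set w = {}" "set p \<inter> set u = {}" "set p \<inter> set w = {}" "set q \<inter> set u = {}"
    "set q \<inter> set w = {}"
    using ys by auto
  have cross: "\<not> (before p b a \<or> before u b a \<or> before w b a \<or> before q b a \<or>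
        b \<in> set p \<and> a \<in> set u \<union> set w \<union> set q \<or> b \<in> set u \<union> set w \<and> a \<in> set q)"
    if "b \<in> set u \<and> a \<in> set w \<or> b \<in> set w \<and> a \<in> set u" for a b
    using that disj before_in_set[of _ b a] by blast
  have I1: "?Inv (p @ u @ w @ q) = N \<union> ?cross u w" "N \<inter> ?cross u w = {}"
    unfolding N_def by (auto simp: before_append)
  have I2: "?Inv (p @ w @ u @ q) = N \<union> ?cross w u" "N \<inter> ?cross w u = {}"
    unfolding N_def split using cross disj by blast+
  let ?U = "{x \<in> set u. odd (dg x)}" and ?W = "{x \<in> set w. odd (dg x)}"
  have *: "before xs a b \<longleftrightarrow> \<not> before xs b a" if "a \<in> set w" "b \<in> set u" for a b
    using before_total[OF xs(1)] that disj(1) xs(2) by auto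
  have "?W \<times> ?U = ?cross u w \<union> prod.swap ` ?cross w u"
    by (auto simp: image_iff *)
  moreover have "?cross u w \<inter> prod.swap ` ?cross w u = {}"
    by (auto simp: *)
  ultimately have "card (?W \<times> ?U) = card (?cross u w) + card (prod.swap ` ?cross w u)"
    using fin by (simp add: card_Un_disjoint)
  then have count: "card ?W * card ?U = card (?cross u w) + card (?cross w u)"
    by (simp add: card_image card_cartesian_product)
  have "card (?Inv (p @ u @ w @ q)) = card N + card (?cross u w)"
    unfolding I1(1) by (rule card_Un_disjoint[OF \<open>finite N\<close> fin(2) I1(2)])
  moreover have "card (?Inv (p @ w @ u @ q)) = card N + card (?cross w u)"
    unfolding I2(1) by (rule card_Un_disjoint[OF \<open>finite N\<close> fin(2) I2(2)])
  moreover have "even (sum_list (map dg u) * sum_list (map dg w)) \<longleftrightarrow> even (card ?W * card ?U)"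
    using even_sum_list_iff[of u dg] even_sum_list_iff[of w dg] ys by auto
  ultimately show ?thesis
    unfolding ksign_def psign_def by (auto simp: count minus_one_power_iff)
qed

section \<open>Composable words and rearrangements of lists of words\<close>

lemma tgt_append: "tgt (xs @ ys) t = tgt xs (tgt ys t)"
  by (simp add: tgt_def)

lemma is_path_Nil [simp]: "is_path V [] t"
  by (simp add: is_path_def)

lemma is_path_Cons:
  "is_path V (x # xs) t \<longleftrightarrow>
     (case x of (a, i, v) \<Rightarrow> v \<in> Hom V a (tgt xs t) i) \<and> is_path V xs t"
  by (auto simp: is_path_def All_less_Suc2)

lemma is_path_append:
  "is_path V (xs @ ys) t \<longleftrightarrow> is_path V xs (tgt ys t) \<and> is_path V ys t"
  by (induction xs) (auto simp: is_path_Cons tgt_append)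

lemma cword_rotate1: "cword V (x # w) \<Longrightarrow> cword V (w @ [x])"
  by (cases w) (auto simp: cword_def is_path_append is_path_Cons tgt_def hd_append)

text \<open>The two moves are the symmetries built into \<open>functional_space\<close>. Rotating
  the first word is enough, as swaps bring any word to the front.\<close>

inductive reshuffle :: "'a list list \<Rightarrow> 'a list list \<Rightarrow> bool" for W where
  none: "reshuffle W W"
| swap: "reshuffle W (us @ u # w # vs) \<Longrightarrow> reshuffle W (us @ w # u # vs)"
| rot: "reshuffle W ((x # w) # ws) \<Longrightarrow> reshuffle W ((w @ [x]) # ws)"

lemma reshuffle_trans:
  assumes "reshuffle W W'" "reshuffle W' W''"
  shows "reshuffle W W''"
  using assms(2,1) by induction (auto intro: reshuffle.intros)

lemma reshuffle_Cons:
  assumes "reshuffle W W'"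
  shows "reshuffle (u # W) (u # W')"
  using assms
proof induction
  case (swap us v w vs)
  then show ?case
    using reshuffle.swap[of "u # W" "u # us" v w vs] by simp
next
  case (rot x w ws)
  \<comment> \<open>The word to be rotated is moved in front of \<open>u\<close> and afterwards back
    again.\<close>
  have "reshuffle (u # W) ((x # w) # u # ws)"
    using reshuffle.swap[of "u # W" "[]"] rot.IH by simp
  then have "reshuffle (u # W) ((w @ [x]) # u # ws)"
    by (rule reshuffle.rot)
  then show ?case
    using reshuffle.swap[of "u # W" "[]"] by simp
qed (rule reshuffle.none)

lemma reshuffle_rotate: "reshuffle (w # ws) (rotate n w # ws)"
proof (induction n)
  case (Suc n)
  then show ?case
    using reshuffle.rot by (cases "rotate n w") (auto simp: rotate_Suc)
qed (simp add: reshuffle.none)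

lemma reshuffle_bubble: "reshuffle (u # us @ vs) (us @ u # vs)"
proof (induction us)
  case (Cons w us)
  have "reshuffle (u # w # us @ vs) (w # u # us @ vs)"
    using reshuffle.swap[OF reshuffle.none, of "[]"] by simp
  then show ?case
    using reshuffle_trans reshuffle_Cons[OF Cons] by fastforce
qed (simp add: reshuffle.none)

lemma functional_space_support: "F \<in> functional_space V \<Longrightarrow> \<not> cwords V ws \<Longrightarrow> F g b ws = 0"
  by (simp add: functional_space_def)

lemma functional_space_rotate:
  "F \<in> functional_space V \<Longrightarrow> cwords V ((x # w) # ws) \<Longrightarrow>
    F g b ((x # w) # ws) = psign (sdeg x * sdegs w) * F g b ((w @ [x]) # ws)"
  unfolding functional_space_def by blast

lemma functional_space_swap:
  "F \<in> functional_space V \<Longrightarrow> cwords V (us @ u # w # vs) \<Longrightarrow>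
    F g b (us @ u # w # vs) = psign (sdegs u * sdegs w) * F g b (us @ w # u # vs)"
  unfolding functional_space_def by blast

text \<open>The words consist of distinct labels, as Koszul signs require, and \<open>arg\<close>
  attaches arrows to them. Each move multiplies the sign and the functional by the same factor,
  whose square is 1.\<close>

lemma reshuffle_invariant:
  fixes F :: "('o, 'k::field_char_0, 'v::ab_group_add) functional" and g b
  assumes F: "F \<in> functional_space V" and H: "distinct H"
    and W: "distinct (concat W)" "set (concat W) = set H" "cwords V (map (map arg) W)"
    and "reshuffle W W'"
  defines "Q \<equiv> \<lambda>W. ksign (\<lambda>h. sdeg (arg h)) H (concat W) * F g b (map (map arg) W)"
  shows "Q W' = Q W \<and> distinct (concat W') \<and> set (concat W') = set H \<and> cwords V (map (map arg) W')"
  using assms(6)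
proof induction
  case none
  then show ?case using W by simp
next
  case (swap us u w vs)
  have "F g b (map (map arg) (us @ u # w # vs)) =
      psign (sdegs (map arg u) * sdegs (map arg w)) * F g b (map (map arg) (us @ w # u # vs))"
    using functional_space_swap[OF F] swap.IH by simp
  moreover have "ksign (\<lambda>h. sdeg (arg h)) H (concat us @ w @ u @ concat vs) =
      psign (sdegs (map arg u) * sdegs (map arg w)) *
      (ksign (\<lambda>h. sdeg (arg h)) H (concat us @ u @ w @ concat vs) :: 'k)"
    using ksign_swap_blocks[OF H, of "concat us" u w "concat vs" "\<lambda>h. sdeg (arg h)"] swap.IH
    by (simp add: comp_def)
  ultimately have "Q (us @ w # u # vs) = Q (us @ u # w # vs)"
    unfolding Q_def by (simp add: mult_ac)
  then show ?case
    using swap.IH by (auto simp: cwords_def)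
next
  case (rot x w ws)
  have "F g b (map (map arg) ((x # w) # ws)) =
      psign (sdeg (arg x) * sdegs (map arg w)) * F g b (map (map arg) ((w @ [x]) # ws))"
    using functional_space_rotate[OF F] rot.IH by simp
  \<comment> \<open>A rotation is the exchange of the one-letter block \<open>x\<close> with the
    block \<open>w\<close>.\<close>
  moreover have "ksign (\<lambda>h. sdeg (arg h)) H (w @ x # concat ws) =
      psign (sdeg (arg x) * sdegs (map arg w)) *
      (ksign (\<lambda>h. sdeg (arg h)) H (x # w @ concat ws) :: 'k)"
    using ksign_swap_blocks[OF H, of "[]" "[x]" w "concat ws" "\<lambda>h. sdeg (arg h)"] rot.IH
    by (simp add: comp_def)
  ultimately have "Q ((w @ [x]) # ws) = Q ((x # w) # ws)"
    unfolding Q_def by (simp add: mult_ac)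
  moreover have "cword V (map arg w @ [arg x])"
    using rot.IH by (intro cword_rotate1) (simp add: cwords_def)
  ultimately show ?case
    using rot.IH by (auto simp: cwords_def)
qed

text \<open>The equation for \<open>rotate1\<close> says that \<open>s\<close> maps each letter to
  the cyclically next one, so the words spell cycles of \<open>s\<close>. This form iterates well;
  \<open>successor_word_iff\<close> links it to the indexed condition in placements and
  layouts.\<close>

definition cycle_words :: "('a \<Rightarrow> 'a) \<Rightarrow> 'a list list \<Rightarrow> bool" where
  "cycle_words s W \<longleftrightarrow> distinct (concat W) \<and> (\<forall>w \<in> set W. w \<noteq> [] \<and> rotate1 w = map s w)"

lemma successor_word_iff:
  "(\<forall>j < length w. w ! (Suc j mod length w) = s (w ! j)) \<longleftrightarrow> rotate1 w = map s w"
  by (simp add: list_eq_iff_nth_eq nth_rotate1)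

lemma rotate_eq_map_funpow:
  assumes "rotate1 w = map s w"
  shows "rotate n w = map (s ^^ n) w"
proof (induction n)
  case (Suc n)
  then show ?case
    by (simp add: rotate_Suc rotate1_map assms comp_def funpow_swap1)
qed simp

text \<open>The letter at position \<open>j\<close> is \<open>(s ^^ j) x\<close>, and by
  distinctness the length is the first return time of \<open>x\<close>; so the first letter
  determines the word.\<close>

lemma cycle_word_unique_start:
  assumes "distinct w" "rotate1 w = map s w" "w = x # w'"
    and "distinct u" "rotate1 u = map s u" "u = x # u'"
  shows "w = u"
proof -
  have nth: "v ! j = (s ^^ j) x" if "rotate1 v = map s v" "v = x # v'" "j < length v" for v v' j
    using arg_cong[OF rotate_eq_map_funpow[OF that(1), of j], of hd] that
    by (simp add: hd_rotate_conv_nth)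
  have period: "(s ^^ length v) x = x" if "rotate1 v = map s v" "v = x # v'" for v v'
    using rotate_eq_map_funpow[OF that(1), of "length v"] rotate_id[of "length v" v] that(2)
    by (metis list.map(2) list.inject mod_self)
  have le: "length v \<le> length v\<^sub>1"
    if "distinct v" "rotate1 v = map s v" "v = x # v'" "rotate1 v\<^sub>1 = map s v\<^sub>1" "v\<^sub>1 = x # v\<^sub>1'"
    for v v' v\<^sub>1 v\<^sub>1'
  proof (rule ccontr)
    assume "\<not> length v \<le> length v\<^sub>1"
    \<comment> \<open>At the return time of the shorter word the longer one repeats its first
      letter.\<close>
    then have "v ! length v\<^sub>1 = v ! 0"
      using nth[OF that(2,3)] period[OF that(4,5)] that(3) by auto
    then show False
      using \<open>\<not> length v \<le> length v\<^sub>1\<close> nth_eq_iff_index_eq[OF that(1), of "length v\<^sub>1" 0] that(3,5) by simp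
  qed
  have "length w = length u"
    using le[of w w' u u'] le[of u u' w w'] assms by simp
  then show ?thesis
    using nth assms by (intro nth_equalityI) metis+
qed

lemma cycle_word_rotate:
  assumes "distinct w" "rotate1 w = map s w" "distinct u" "rotate1 u = map s u"
    "x \<in> set w" "x \<in> set u"
  shows "\<exists>n. u = rotate n w"
proof -
  have start: "\<exists>k. k < length v \<and> (\<exists>v'. rotate k v = x # v')" if "x \<in> set v" for v
  proof -
    obtain k where k: "k < length v" "v ! k = x"
      using \<open>x \<in> set v\<close> by (auto simp: in_set_conv_nth)
    then have "v \<noteq> []" by auto
    then have "hd (rotate k v) = x" "rotate k v \<noteq> []"
      using hd_rotate_conv_nth[of v k] k by auto
    then show ?thesis
      using k by (metis list.collapse)
  qed
  obtain k w' where k: "rotate k w = x # w'"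
    using start[OF assms(5)] by blast
  obtain l u' where l: "l < length u" "rotate l u = x # u'"
    using start[OF assms(6)] by blast
  have step: "rotate1 (rotate n v) = map s (rotate n v)" if "rotate1 v = map s v" for n v
    by (metis rotate_map rotate1_rotate_swap that)
  have "rotate k w = rotate l u"
    by (rule cycle_word_unique_start[where s = s, OF _ _ k _ _ l(2)]) (use assms step in auto)
  then have "rotate (length u - l) (rotate k w) = rotate (length u - l + l) u"
    by (simp add: rotate_rotate)
  then have "u = rotate (length u - l + k) w"
    using l(1) by (simp add: rotate_rotate)
  then show ?thesis
    by blast
qed

text \<open>The word of \<open>W'\<close> containing the first letter of \<open>w\<close> spells the
  same cycle, so it is a rotation of \<open>w\<close>. With this pair removed, the remaining words
  are compared by induction.\<close>

lemma cycle_words_reshuffle: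
  assumes "cycle_words s W" "cycle_words s W'" "set (concat W) = set (concat W')"
  shows "reshuffle W W'"
  using assms
proof (induction W arbitrary: W')
  case Nil
  then have "W' = []"
    by (cases W') (auto simp: cycle_words_def)
  then show ?case by (simp add: reshuffle.none)
next
  case (Cons w W)
  have w: "w \<noteq> []" "distinct w" "rotate1 w = map s w" "set w \<inter> set (concat W) = {}"
    using Cons.prems(1) by (auto simp: cycle_words_def)
  then have "hd w \<in> set (concat W')"
    using Cons.prems(3) by (metis UnI1 concat.simps(2) hd_in_set set_append)
  then obtain u where u: "u \<in> set W'" "hd w \<in> set u" by auto
  then have u': "distinct u" "rotate1 u = map s u"
    using Cons.prems(2) by (auto simp: cycle_words_def distinct_concat_iff)
  obtain n where n: "u = rotate n w"
    using cycle_word_rotate[OF w(2,3) u' hd_in_set[OF w(1)] u(2)] by blast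
  obtain us vs where W': "W' = us @ u # vs"
    using u(1) by (auto simp: in_set_conv_decomp)
  have "reshuffle W (us @ vs)"
  proof (rule Cons.IH)
    show "cycle_words s W"
      using Cons.prems(1) by (auto simp: cycle_words_def)
    show "cycle_words s (us @ vs)"
      using Cons.prems(2) W' by (auto simp: cycle_words_def)
    have "set u \<inter> set (concat (us @ vs)) = {}"
      using Cons.prems(2) W' by (auto simp: cycle_words_def)
    moreover have "set u = set w"
      using n by simp
    moreover have "set w \<union> set (concat W) = set u \<union> set (concat (us @ vs))"
      using Cons.prems(3) W' by auto
    ultimately show "set (concat W) = set (concat (us @ vs))"
      using w(4) by blast
  qed
  then have "reshuffle (u # W) (us @ u # vs)"
    by (meson reshuffle_Cons reshuffle_bubble reshuffle_trans)
  then show ?case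
    using reshuffle_rotate[of w W n] reshuffle_trans n W' by metis
qed

text \<open>The permutation is the product of the cycles given by the words, whose supports are
  disjoint.\<close>

lemma cycle_words_exists:
  assumes "distinct (concat W)" "[] \<notin> set W"
  shows "\<exists>s. s permutes set (concat W) \<and> cycle_words s W"
  using assms
proof (induction W)
  case Nil
  then show ?case
    by (auto simp: cycle_words_def intro!: exI[of _ id] permutes_id)
next
  case (Cons w W)
  then obtain s where s: "s permutes set (concat W)" "cycle_words s W"
    by auto
  let ?c = "cycle_of_list w"
  have disj: "set w \<inter> set (concat W) = {}"
    using Cons.prems by auto
  have "?c \<circ> s permutes set (concat (w # W))"
    by (rule permutes_compose; rule permutes_subset[OF s(1)] permutes_subset[OF cycle_permutes]) auto
  moreover have "rotate1 w = map (?c \<circ> s) w"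
  proof -
    have "s h = h" if "h \<in> set w" for h
      using permutes_not_in[OF s(1)] disj that by blast
    then have "map (?c \<circ> s) w = map ?c w"
      by simp
    also have "\<dots> = rotate1 w"
      using cyclic_rotation[of w 1] Cons.prems by simp
    finally show ?thesis by simp
  qed
  moreover have "rotate1 u = map (?c \<circ> s) u" if "u \<in> set W" for u
  proof -
    have u: "rotate1 u = map s u"
      using s(2) that by (simp add: cycle_words_def)
    have "?c (s h) = s h" if "h \<in> set u" for h
    proof -
      have "s h \<in> set u"
        using arg_cong[OF u, of set] that by auto
      then show ?thesis
        using disj \<open>u \<in> set W\<close> by (intro id_outside_supp) auto
    qed
    then show ?thesis
      unfolding u by simp
  qed
  ultimately have "cycle_words (?c \<circ> s) (w # W)"
    using Cons.prems by (auto simp: cycle_words_def)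
  then show ?case
    using \<open>?c \<circ> s permutes set (concat (w # W))\<close> by blast
qed

section \<open>The maps to cyclic words on corollas\<close>

lemma map_the_map_of_zip:
  assumes "distinct H" "length H = length xs"
  shows "map (\<lambda>h. the (map_of (zip H xs) h)) H = xs"
  by (rule nth_equalityI) (use assms in \<open>auto simp: map_of_zip_nth\<close>)

lemma map_map_eq_if_concat_eq:
  assumes "map length xss = map length yss" "map f (concat xss) = concat yss"
  shows "map (map f) xss = yss"
proof (rule concat_injective)
  show "concat (map (map f) xss) = concat yss"
    using assms(2) by (simp add: map_concat)
  show "length (map (map f) xss) = length yss"
    using assms(1) by (metis length_map)
  show "\<forall>(x, y) \<in> set (zip (map (map f) xss) yss). length x = length y"
  proof clarify
    fix x y assume "(x, y) \<in> set (zip (map (map f) xss) yss)"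
    then obtain i where i: "i < length xss" "i < length yss" "x = map f (xss ! i)" "y = yss ! i"
      by (auto simp: set_zip)
    then show "length x = length y"
      using arg_cong[OF assms(1), of "\<lambda>l. l ! i"] by simp
  qed
qed

text \<open>Without edges one moves along the face by \<open>sig0\<close> alone, so the first step
  already ends at a leaf.\<close>

lemma next_leaf_corolla:
  assumes "corolla \<Gamma>" "h \<in> hes \<Gamma>"
  shows "next_leaf \<Gamma> h = sig0 \<Gamma> h"
proof -
  let ?P = "\<lambda>n. n > 0 \<and> ((sig1 \<Gamma> \<circ> sig0 \<Gamma>) ^^ n) h \<in> leaves \<Gamma>"
  have "sig0 \<Gamma> h \<in> hes \<Gamma>"
    using permutes_in_image[OF sig0_permutes[OF corolla_stable[OF assms(1)]]] assms(2) by blast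
  then have "(LEAST n. ?P n) = 1"
    by (intro Least_equality) (auto simp: corolla_sig1[OF assms(1)] corolla_leaves[OF assms(1)])
  then show ?thesis
    by (simp add: next_leaf_def corolla_sig1[OF assms(1)])
qed

lemma placements_corolla:
  assumes "corolla \<Gamma>" "cwords V ws"
  shows "hs \<in> placements \<Gamma> ws \<longleftrightarrow>
    map (map (col \<Gamma>)) hs = map (map fst) ws \<and> cycle_words (sig0 \<Gamma>) hs \<and> set (concat hs) = hes \<Gamma>"
proof -
  have nonempty: "w \<noteq> []" if "map (map (col \<Gamma>)) hs = map (map fst) ws" "w \<in> set hs" for w
  proof -
    have "map (col \<Gamma>) w \<in> set (map (map fst) ws)"
      using that by (metis image_eqI image_set)
    then show ?thesis
      using assms(2) by (auto simp: cwords_def cword_def)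
  qed
  have "(\<forall>j < length w. w ! (Suc j mod length w) = next_leaf \<Gamma> (w ! j)) \<longleftrightarrow>
      rotate1 w = map (sig0 \<Gamma>) w" if "set (concat hs) = hes \<Gamma>" "w \<in> set hs" for w
  proof -
    have "w ! j \<in> hes \<Gamma>" if "j < length w" for j
      using \<open>w \<in> set hs\<close> that unfolding \<open>set (concat hs) = hes \<Gamma>\<close>[symmetric]
      by (auto intro!: bexI[of _ w])
    then have "next_leaf \<Gamma> (w ! j) = sig0 \<Gamma> (w ! j)" if "j < length w" for j
      using next_leaf_corolla[OF assms(1)] that by blast
    then show ?thesis
      unfolding successor_word_iff[symmetric] by simp
  qed
  then show ?thesis
    unfolding placements_def corolla_leaves[OF assms(1)] cycle_words_def mem_Collect_eq
    using nonempty by blast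
qed

lemma placement_lengths:
  assumes "hs \<in> placements \<Gamma> ws"
  shows "map length hs = map length ws"
proof -
  have "map (map (col \<Gamma>)) hs = map (map fst) ws"
    using assms by (simp add: placements_def)
  then have "map length (map (map (col \<Gamma>)) hs) = map length (map (map fst) ws)"
    by (rule arg_cong)
  then show ?thesis
    by (simp add: comp_def)
qed

lemma placement_image:
  assumes "corolla \<Gamma>" "corolla \<Gamma>'" "cwords V ws" "graph_iso f \<Gamma> \<Gamma>'" "hs \<in> placements \<Gamma> ws"
  shows "map (map f) hs \<in> placements \<Gamma>' ws"
proof -
  have hs: "map (map (col \<Gamma>)) hs = map (map fst) ws" "distinct (concat hs)"
      "\<And>w. w \<in> set hs \<Longrightarrow> w \<noteq> [] \<and> rotate1 w = map (sig0 \<Gamma>) w" "set (concat hs) = hes \<Gamma>"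
    using assms(5) placements_corolla[OF assms(1,3)] by (auto simp: cycle_words_def)
  have f: "bij_betw f (hes \<Gamma>) (hes \<Gamma>')"
    "\<And>h. h \<in> hes \<Gamma> \<Longrightarrow> sig0 \<Gamma>' (f h) = f (sig0 \<Gamma> h) \<and> col \<Gamma>' (f h) = col \<Gamma> h"
    using assms(4) by (auto simp: graph_iso_def)
  have sub: "h \<in> hes \<Gamma>" if "w \<in> set hs" "h \<in> set w" for w h
    using hs(4) that by auto
  have "map (map (col \<Gamma>')) (map (map f) hs) = map (map (col \<Gamma>)) hs"
    using f(2) sub by simp
  moreover have concat: "concat (map (map f) hs) = map f (concat hs)"
    by (simp add: map_concat)
  then have "set (concat (map (map f) hs)) = hes \<Gamma>'"
    using f(1) hs(4) by (simp only: set_map bij_betw_def)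
  moreover have "distinct (concat (map (map f) hs))"
    unfolding concat distinct_map using f(1) hs(2,4) by (simp only: bij_betw_def)
  moreover have "rotate1 (map f w) = map (sig0 \<Gamma>') (map f w)" if "w \<in> set hs" for w
    using hs(3)[OF that] f(2) sub[OF that] by (simp add: rotate1_map)
  ultimately show ?thesis
    using hs(1,3) placements_corolla[OF assms(2,3)] by (auto simp: cycle_words_def)
qed

text \<open>On the half-edges the map is forced: it matches equal positions of the two placements.
  Neighbours in the words are successors in the cyclic orders, and the colors agree since both
  placements carry the sources of the arrows of \<open>ws\<close>. Outside it is the identity, so
  that for equal graphs it is an automorphism.\<close>

lemma placements_iso:
  assumes cor: "corolla \<Gamma>" "corolla \<Gamma>'" and ws: "cwords V ws"
    and hs: "hs \<in> placements \<Gamma> ws" "hs' \<in> placements \<Gamma>' ws"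
    and defects: "gdf \<Gamma> (hes \<Gamma>) = gdf \<Gamma>' (hes \<Gamma>')" "bdf \<Gamma> (hes \<Gamma>) = bdf \<Gamma>' (hes \<Gamma>')"
  obtains f where "graph_iso f \<Gamma> \<Gamma>'" "map (map f) hs = hs'" "\<And>h. h \<notin> hes \<Gamma> \<Longrightarrow> f h = h"
proof -
  have h: "map (map (col \<Gamma>)) hs = map (map fst) ws" "distinct (concat hs)"
      "\<And>w. w \<in> set hs \<Longrightarrow> rotate1 w = map (sig0 \<Gamma>) w" "set (concat hs) = hes \<Gamma>"
    using hs(1) placements_corolla[OF cor(1) ws] by (auto simp: cycle_words_def)
  have h': "map (map (col \<Gamma>')) hs' = map (map fst) ws" "distinct (concat hs')"
      "\<And>w. w \<in> set hs' \<Longrightarrow> rotate1 w = map (sig0 \<Gamma>') w" "set (concat hs') = hes \<Gamma>'"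
    using hs(2) placements_corolla[OF cor(2) ws] by (auto simp: cycle_words_def)
  have lengths: "map length hs = map length hs'"
    using placement_lengths hs by metis
  then have "length (concat hs) = length (concat hs')"
    by (simp add: length_concat)
  define f where
    "f h = (if h \<in> hes \<Gamma> then the (map_of (zip (concat hs) (concat hs')) h) else h)" for h
  have "map f (concat hs) = map (\<lambda>h. the (map_of (zip (concat hs) (concat hs')) h)) (concat hs)"
    using h(4) by (intro map_cong) (auto simp: f_def)
  also have "\<dots> = concat hs'"
    by (rule map_the_map_of_zip) fact+
  finally have concat: "map f (concat hs) = concat hs'" .
  then have map: "map (map f) hs = hs'"
    by (rule map_map_eq_if_concat_eq[OF lengths])
  have bij: "bij_betw f (hes \<Gamma>) (hes \<Gamma>')"
    using h(4) h'(2,4) concat unfolding bij_betw_def by (metis distinct_map set_map)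
  have pointwise: "sig0 \<Gamma>' (f x) = f (sig0 \<Gamma> x) \<and> col \<Gamma>' (f x) = col \<Gamma> x" if x: "x \<in> hes \<Gamma>" for x
  proof -
    obtain w where w: "w \<in> set hs" "x \<in> set w"
      using x unfolding h(4)[symmetric] by auto
    then have "map f w \<in> set hs'"
      using map by auto
    then have "map f (map (sig0 \<Gamma>) w) = map (sig0 \<Gamma>') (map f w)"
      using h'(3) h(3)[OF w(1)] rotate1_map[of f w] by metis
    moreover have "map (map (col \<Gamma>')) (map (map f) hs) = map (map (col \<Gamma>)) hs"
      using map h(1) h'(1) by simp
    then have "map (col \<Gamma>') (map f w) = map (col \<Gamma>) w"
      using w(1) by simp
    ultimately show ?thesis
      using w(2) by simp
  qed
  have "sig1 \<Gamma>' (f x) = f (sig1 \<Gamma> x)" for x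
    by (simp add: corolla_sig1[OF cor(1)] corolla_sig1[OF cor(2)])
  moreover have "f ` hes \<Gamma> = hes \<Gamma>'"
    using bij by (simp add: bij_betw_def)
  ultimately have "graph_iso f \<Gamma> \<Gamma>'"
    using bij pointwise defects
    by (simp add: graph_iso_def corolla_vts[OF cor(1)] corolla_vts[OF cor(2)])
  then show thesis
    using that map by (simp add: f_def)
qed

text \<open>The action of the automorphisms on placements is free because a placement lists every
  half-edge, and transitive by \<open>placements_iso\<close>.\<close>

lemma card_placements_corolla:
  assumes cor: "corolla \<Gamma>" and ws: "cwords V ws" and hs: "hs \<in> placements \<Gamma> ws"
  shows "card (placements \<Gamma> ws) = card (automorphisms \<Gamma>)" "card (automorphisms \<Gamma>) > 0"
proof -
  have set_hs: "set (concat hs) = hes \<Gamma>"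
    using hs placements_corolla[OF cor ws] by blast
  have "bij_betw (\<lambda>f. map (map f) hs) (automorphisms \<Gamma>) (placements \<Gamma> ws)"
    unfolding bij_betw_def
  proof
    show "inj_on (\<lambda>f. map (map f) hs) (automorphisms \<Gamma>)"
    proof (rule inj_onI)
      fix f f' assume "f \<in> automorphisms \<Gamma>" "f' \<in> automorphisms \<Gamma>" and eq: "map (map f) hs = map (map f') hs"
      then have perm: "f permutes hes \<Gamma>" "f' permutes hes \<Gamma>"
        by (auto simp: automorphisms_def)
      have "f h = f' h" if h: "h \<in> hes \<Gamma>" for h
      proof -
        obtain w where "w \<in> set hs" "h \<in> set w"
          using h unfolding set_hs[symmetric] by auto
        then show ?thesis
          using eq by auto
      qed
      then show "f = f'"
        using perm permutes_not_in by (metis ext)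
    qed
    show "(\<lambda>f. map (map f) hs) ` automorphisms \<Gamma> = placements \<Gamma> ws"
    proof (intro equalityI subsetI)
      fix hs' assume "hs' \<in> (\<lambda>f. map (map f) hs) ` automorphisms \<Gamma>"
      then show "hs' \<in> placements \<Gamma> ws"
        using placement_image[OF cor cor ws _ hs] by (auto simp: automorphisms_def)
    next
      fix hs' assume "hs' \<in> placements \<Gamma> ws"
      then obtain f where f: "graph_iso f \<Gamma> \<Gamma>" "map (map f) hs = hs'" "\<And>h. h \<notin> hes \<Gamma> \<Longrightarrow> f h = h"
        using placements_iso[OF cor cor ws hs] by blast
      then have "f permutes hes \<Gamma>"
        by (intro bij_imp_permutes) (auto simp: graph_iso_def)
      then show "hs' \<in> (\<lambda>f. map (map f) hs) ` automorphisms \<Gamma>"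
        using f by (auto simp: automorphisms_def)
    qed
  qed
  then show "card (placements \<Gamma> ws) = card (automorphisms \<Gamma>)"
    by (simp add: bij_betw_same_card)
  have "automorphisms \<Gamma> \<subseteq> {f. f permutes hes \<Gamma>}"
    by (auto simp: automorphisms_def)
  then have "finite (automorphisms \<Gamma>)"
    using finite_permutations[OF finite_hes[OF corolla_stable[OF cor]]] finite_subset by blast
  moreover have "id \<in> automorphisms \<Gamma>"
    by (simp add: automorphisms_def permutes_id graph_iso_refl)
  ultimately show "card (automorphisms \<Gamma>) > 0"
    by (auto simp: card_gt_0_iff)
qed

text \<open>The layout chosen in the definition and any placement list the same cycles, so they differ by
  a permutation of the words and rotations, under which functionals are invariant.\<close>

lemma graph_tensor_corolla:
  assumes cor: "corolla \<Gamma>" and F: "F \<in> functional_space V" and ws: "cwords V ws"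
    and hs: "hs \<in> placements \<Gamma> ws"
  shows "graph_tensor F \<Gamma> [] hs ws = F (gdf \<Gamma> (hes \<Gamma>)) (bdf \<Gamma> (hes \<Gamma>)) ws"
proof -
  have h: "cycle_words (sig0 \<Gamma>) hs" "set (concat hs) = hes \<Gamma>"
    using hs placements_corolla[OF cor ws] by blast+
  then have dist: "distinct (concat hs)"
    by (simp add: cycle_words_def)
  have "hs \<noteq> []"
    using h(2) corolla_hes_nonempty[OF cor] by auto
  \<comment> \<open>The placement itself is a layout, which justifies the choice in
    \<open>layout\<close>.\<close>
  then have "is_layout \<Gamma> [hs]"
    using h dist unfolding is_layout_def successor_word_iff
    by (simp add: cycle_words_def corolla_vts[OF cor])
  then have layout: "is_layout \<Gamma> (layout \<Gamma>)"
    unfolding layout_def by (rule someI)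
  obtain v where v: "layout \<Gamma> = [v]"
  proof -
    have sets: "set (concat v) = hes \<Gamma>" if "v \<in> set (layout \<Gamma>)" for v
      using layout that by (auto simp: is_layout_def corolla_vts[OF cor])
    have "layout \<Gamma> \<noteq> []"
      using layout by (auto simp: is_layout_def corolla_vts[OF cor])
    \<comment> \<open>Two entries of the layout would each cover all half-edges, although they are
      disjoint.\<close>
    moreover have False if L: "layout \<Gamma> = v # u # vs" for v u vs
    proof -
      have "set (concat v) \<inter> set (concat u) = {}"
        using layout unfolding is_layout_def L by auto
      then show False
        using sets[of v] sets[of u] L corolla_hes_nonempty[OF cor] by auto
    qed
    ultimately show thesis
      using that by (metis list.exhaust)
  qed
  have "cycle_words (sig0 \<Gamma>) v" "set (concat v) = hes \<Gamma>"
    using layout unfolding is_layout_def v successor_word_iff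
    by (auto simp: cycle_words_def corolla_vts[OF cor])
  then have "reshuffle hs v"
    using cycle_words_reshuffle h by metis
  define arg where "arg = (\<lambda>h. the (map_of (zip (concat hs) (concat ws)) h))"
  have lengths: "map length hs = map length ws"
    by (rule placement_lengths[OF hs])
  then have "length (concat hs) = length (concat ws)"
    by (simp add: length_concat)
  then have "map arg (concat hs) = concat ws"
    unfolding arg_def by (rule map_the_map_of_zip[OF dist])
  then have arg: "map (map arg) hs = ws"
    by (rule map_map_eq_if_concat_eq[OF lengths])
  have "ksign (\<lambda>h. sdeg (arg h)) (concat hs) (concat v) * F g b (map (map arg) v) = F g b ws" for g b
    using reshuffle_invariant[OF F dist dist _ _ \<open>reshuffle hs v\<close>, of arg g b] ws
    by (simp add: arg ksign_self[OF dist])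
  then show ?thesis
    using \<open>set (concat v) = hes \<Gamma>\<close>
    by (simp add: graph_tensor_def corolla_ori[OF cor] v Let_def arg_def)
qed

lemma rho_graph_corolla:
  fixes F :: "('o, 'k::field_char_0, 'v::ab_group_add) functional"
  assumes cor: "corolla \<Gamma>" and F: "F \<in> functional_space V"
  shows "rho_graph d V F \<Gamma> g b ws =
    (if cwords V ws \<and> g = gdf \<Gamma> (hes \<Gamma>) \<and> b = bdf \<Gamma> (hes \<Gamma>) \<and> placements \<Gamma> ws \<noteq> {}
     then F g b ws else 0)"
proof (cases "cwords V ws \<and> g = gdf \<Gamma> (hes \<Gamma>) \<and> b = bdf \<Gamma> (hes \<Gamma>)")
  case True
  then have ws: "cwords V ws" by simp
  have "rho_graph d V F \<Gamma> g b ws =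
      (\<Sum>hs \<in> placements \<Gamma> ws. graph_tensor F \<Gamma> [] hs ws) / of_nat (card (automorphisms \<Gamma>))"
    using True by (simp add: rho_graph_def corolla_arith_genus[OF cor] corolla_vts[OF cor]
        corolla_empty_face_colors[OF cor] corolla_ori[OF cor])
  also have "\<dots> = of_nat (card (placements \<Gamma> ws)) * F g b ws / of_nat (card (automorphisms \<Gamma>))"
    using graph_tensor_corolla[OF cor F ws] True by simp
  also have "\<dots> = (if placements \<Gamma> ws \<noteq> {} then F g b ws else 0)"
    using card_placements_corolla[OF cor ws] by auto
  finally show ?thesis
    using True by simp
next
  case False
  then show ?thesis
    by (auto simp: rho_graph_def corolla_arith_genus[OF cor] corolla_vts[OF cor]
        corolla_empty_face_colors[OF cor])
qed

text \<open>At most one class contributes: two corollas with the same defects on which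
  \<open>ws\<close> can be placed are isomorphic by \<open>placements_iso\<close>. That there is one
  is left as the hypothesis \<open>exists\<close>, because it depends on \<open>P\<close>.\<close>

lemma rho_corolla_sum:
  fixes F :: "('o, 'k::field_char_0, 'v::ab_group_add) functional"
  assumes P: "\<And>\<Gamma>. P \<Gamma> \<Longrightarrow> corolla \<Gamma>"
    and iso: "\<And>\<Gamma> \<Gamma>'. P \<Gamma> \<Longrightarrow> (\<Gamma>, \<Gamma>') \<in> iso_rel \<Longrightarrow> P \<Gamma>'"
    and F: "F \<in> functional_space V"
    and exists: "F g b ws \<noteq> 0 \<Longrightarrow>
      \<exists>\<Gamma>. P \<Gamma> \<and> gdf \<Gamma> (hes \<Gamma>) = g \<and> bdf \<Gamma> (hes \<Gamma>) = b \<and> placements \<Gamma> ws \<noteq> {}"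
  shows "rho d V F (corolla_sum P) g b ws = F g b ws"
proof -
  define good where "good \<Gamma> \<longleftrightarrow> P \<Gamma> \<and> gdf \<Gamma> (hes \<Gamma>) = g \<and> bdf \<Gamma> (hes \<Gamma>) = b \<and> placements \<Gamma> ws \<noteq> {}"
    for \<Gamma>
  let ?Q = "{\<Gamma>. admissible \<Gamma>} // iso_rel"
  define trm where
    "trm c = (\<Sum>k\<le>g. corolla_sum P k (representative c) *
       rho_graph d V F (representative c) (g - k) b ws)" for c
  have trm: "trm c = (if good (representative c) then F g b ws else 0)" for c
  proof -
    have "trm c = (\<Sum>k\<in>{0}. corolla_sum P k (representative c) *
        rho_graph d V F (representative c) (g - k) b ws)"
      unfolding trm_def by (rule sum.mono_neutral_right) (auto simp: tree_incl_def)
    also have "\<dots> = of_bool (P (representative c)) * rho_graph d V F (representative c) g b ws"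
      by (simp add: tree_incl_def)
    also have "\<dots> = (if good (representative c) then F g b ws else 0)"
      using rho_graph_corolla[OF P F, of "representative c"] functional_space_support[OF F]
      by (auto simp: good_def)
    finally show ?thesis .
  qed
  have rho: "rho d V F (corolla_sum P) g b ws = sum trm {c \<in> ?Q. trm c \<noteq> 0}"
    unfolding rho_def Let_def trm_def ..
  show ?thesis
  proof (cases "F g b ws = 0")
    case True
    then show ?thesis
      unfolding rho trm by simp
  next
    case False
    then have ws: "cwords V ws"
      using functional_space_support[OF F] by blast
    obtain \<Gamma> where \<Gamma>: "good \<Gamma>"
      using exists[OF False] by (auto simp: good_def)
    then have cor: "corolla \<Gamma>" by (simp add: good_def P)
    have stable: "{\<Gamma>. admissible \<Gamma>} \<subseteq> {\<Gamma>. stable_ribbon_graph \<Gamma>}"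
      by (auto simp: admissible_def)
    define c\<^sub>0 where "c\<^sub>0 = iso_rel `` {\<Gamma>}"
    have c\<^sub>0: "c\<^sub>0 \<in> ?Q"
      using corolla_admissible[OF cor] unfolding c\<^sub>0_def by (intro quotientI) simp
    have rel: "(\<Gamma>, representative c\<^sub>0) \<in> iso_rel"
      using representative_in[OF c\<^sub>0 stable] by (simp add: c\<^sub>0_def)
    have rep: "P (representative c\<^sub>0)"
      using \<Gamma> iso[OF _ rel] by (simp add: good_def)
    obtain f where f: "graph_iso f \<Gamma> (representative c\<^sub>0)"
      using rel unfolding iso_rel_def by blast
    have "f ` hes \<Gamma> = hes (representative c\<^sub>0)"
      using f by (simp add: graph_iso_def bij_betw_def)
    then have good: "good (representative c\<^sub>0)"
      using \<Gamma> f rep placement_image[OF cor P[OF rep] ws f]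
      by (auto simp: good_def graph_iso_def corolla_vts[OF cor])
    have unique: "c = c\<^sub>0" if c: "c \<in> ?Q" "good (representative c)" for c
    proof -
      have cor': "corolla (representative c)"
        using c(2) by (simp add: good_def P)
      obtain hs hs' where "hs \<in> placements \<Gamma> ws" "hs' \<in> placements (representative c) ws"
        using c(2) \<Gamma> by (auto simp: good_def)
      then obtain f where "graph_iso f \<Gamma> (representative c)"
        using placements_iso[OF cor cor' ws] c(2) \<Gamma> unfolding good_def by metis
      then have "(\<Gamma>, representative c) \<in> iso_rel"
        using cor cor' unfolding iso_rel_def by (auto simp: corolla_stable)
      moreover have "representative c \<in> c"
        by (rule representative_in[OF c(1) stable])
      moreover obtain \<Gamma>\<^sub>0 where "c = iso_rel `` {\<Gamma>\<^sub>0}"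
        using c(1) by (auto simp: quotient_def)
      ultimately show ?thesis
        using equiv_class_eq[OF equiv_iso_rel] unfolding c\<^sub>0_def by (metis Image_singleton_iff)
    qed
    have "trm c \<noteq> 0 \<longleftrightarrow> good (representative c)" for c
      unfolding trm using False by simp
    then have "{c \<in> ?Q. trm c \<noteq> 0} = {c \<in> ?Q. good (representative c)}"
      by simp
    also have "\<dots> = {c\<^sub>0}"
      using c\<^sub>0 good unique by blast
    finally have "{c \<in> ?Q. trm c \<noteq> 0} = {c\<^sub>0}" .
    then show ?thesis
      unfolding rho using trm good by simp
  qed
qed

section \<open>Realizing a product of words on a corolla\<close>

lemma concat_labels: "concat (labels k ws) = [k..<k + length (concat ws)]"
proof (induction ws arbitrary: k)
  case (Cons w ws)
  then show ?case
    using upt_add_eq_append[of k "k + length w" "length (concat ws)"] by (simp add: add.assoc)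
qed simp

lemma map_length_labels: "map length (labels k ws) = map length ws"
  by (induction ws arbitrary: k) auto

text \<open>The letters of \<open>ws\<close>, numbered consecutively, serve as half-edges; the words
  become the cycles and the sources of the arrows the colors, so that the numbering is itself a
  placement. The hypothesis \<open>cond\<close> is the stability bound, and the last conclusion
  allows one to recognize a tree.\<close>

lemma corolla_exists:
  assumes ws: "cwords V ws" "ws \<noteq> []"
    and cond: "g = 0 \<Longrightarrow> b = {#} \<Longrightarrow> length ws = 1 \<Longrightarrow> length (hd ws) \<ge> 3"
  obtains \<Gamma> where "corolla \<Gamma>" "gdf \<Gamma> (hes \<Gamma>) = g" "bdf \<Gamma> (hes \<Gamma>) = b" "placements \<Gamma> ws \<noteq> {}"
    "card (cyc \<Gamma> ` hes \<Gamma>) = 1 \<longleftrightarrow> length ws = 1"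
proof -
  define n where "n = length (concat ws)"
  define hs where "hs = labels 0 ws"
  have hs: "concat hs = [0..<n]" "map length hs = map length ws"
    by (simp_all add: hs_def n_def concat_labels map_length_labels)
  then have set_hs: "set (concat hs) = {..<n}"
    by (metis lessThan_atLeast0 set_upt)
  have nonempty: "[] \<notin> set ws"
    using ws(1) by (auto simp: cwords_def cword_def)
  have "0 \<notin> set (map length hs)"
    unfolding hs(2) using nonempty by auto
  then have ne: "[] \<notin> set hs"
    by auto
  obtain s where s: "s permutes {..<n}" "cycle_words s hs"
    using cycle_words_exists[of hs] hs(1) ne by (auto simp: lessThan_atLeast0)
  have pos: "n > 0"
    using ws(2) nonempty unfolding n_def by (cases ws) auto
  have cyc: "orbit s h = set w" if "w \<in> set hs" "h \<in> set w" for w h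
  proof -
    have w: "rotate1 w = map s w"
      using s(2) that by (simp add: cycle_words_def)
    have "s ` set w = set w"
      using arg_cong[OF w, of set] by simp
    then have "orbit s h \<subseteq> set w"
      using that by (intro orbit_subset_invariant) auto
    moreover have "k \<in> orbit s h" if "k \<in> set w" for k
    proof -
      have "w \<noteq> []" using that by auto
      obtain i j where ij: "i < length w" "w ! i = h" "j < length w" "w ! j = k"
        using \<open>h \<in> set w\<close> \<open>k \<in> set w\<close> by (auto simp: in_set_conv_nth)
      \<comment> \<open>Rotation by this amount brings the letter at position \<open>j\<close> to
        position \<open>i\<close>. The full turn \<open>length w\<close> keeps the exponent
        positive, as orbits demand.\<close>
      define m where "m = length w - i + j"
      have "rotate m w ! i = k"
        using ij by (simp add: m_def nth_rotate)
      then have "(s ^^ m) h = k"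
        using rotate_eq_map_funpow[OF w, of m] ij by simp
      moreover have "m > 0"
        using ij by (simp add: m_def)
      ultimately show ?thesis
        by (auto simp: orbit_altdef)
    qed
    ultimately show ?thesis by blast
  qed
  define \<Gamma> where "\<Gamma> = \<lparr>hes = {..<n}, vts = {{..<n}}, sig0 = s, sig1 = id, gdf = (\<lambda>_. g),
    bdf = (\<lambda>_. b), col = (\<lambda>h. fst (concat ws ! h)), ori = []\<rparr>"
  have one: "card (cyc \<Gamma> ` hes \<Gamma>) = 1 \<longleftrightarrow> length ws = 1"
  proof
    assume "length ws = 1"
    then obtain w where w: "hs = [w]"
      using hs(2) by (cases hs; cases "tl hs"; cases ws) auto
    then have "w = [0..<n]"
      using hs(1) by simp
    then have "set w = {..<n}"
      by (simp add: lessThan_atLeast0)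
    then have "cyc \<Gamma> h = set w" if "h \<in> hes \<Gamma>" for h
      using cyc[of w h] w that by (simp add: \<Gamma>_def cyc_def)
    moreover have "hes \<Gamma> \<noteq> {}"
      using pos by (auto simp: \<Gamma>_def)
    ultimately have "cyc \<Gamma> ` hes \<Gamma> = {set w}"
      by blast
    then show "card (cyc \<Gamma> ` hes \<Gamma>) = 1"
      by simp
  next
    assume card: "card (cyc \<Gamma> ` hes \<Gamma>) = 1"
    show "length ws = 1"
    proof (rule ccontr)
      assume "length ws \<noteq> 1"
      moreover have "length hs = length ws"
        using hs(2) by (metis length_map)
      ultimately obtain u w hs' where hs': "hs = u # w # hs'"
        using ws(2) by (cases hs; cases "tl hs") auto
      have "u \<noteq> []" "w \<noteq> []" "set u \<inter> set w = {}"
        using ne s(2) hs' by (auto simp: cycle_words_def)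
      moreover have "set u \<subseteq> {..<n}" "set w \<subseteq> {..<n}"
        using set_hs hs' by auto
      ultimately have "hd u \<in> hes \<Gamma>" "hd w \<in> hes \<Gamma>"
        by (auto simp: \<Gamma>_def subset_iff)
      then have "cyc \<Gamma> (hd u) = cyc \<Gamma> (hd w)"
        using card_image_1_eq[OF card] by blast
      then have "set u = set w"
        using cyc[of u "hd u"] cyc[of w "hd w"] hs' \<open>u \<noteq> []\<close> \<open>w \<noteq> []\<close> by (simp add: \<Gamma>_def cyc_def)
      then show False
        using \<open>u \<noteq> []\<close> \<open>set u \<inter> set w = {}\<close> by auto
    qed
  qed
  have edges: "edges \<Gamma> = {}" "leaves \<Gamma> = {..<n}"
    by (auto simp: edges_def leaves_def \<Gamma>_def)
  have three: "3 \<le> n" if "g = 0" "b = {#}" "length ws = 1"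
    using cond[OF that] that(3) unfolding n_def by (cases ws) auto
  have "{..<n} \<noteq> {}"
    using pos by auto
  then have "partition_on {..<n} {{..<n}}"
    unfolding partition_on_def by simp
  then have "stable_ribbon_graph \<Gamma>"
    using s(1) one edges three permutes_image[OF s(1)]
    by (simp add: stable_ribbon_graph_def permutes_id) (simp add: \<Gamma>_def permutes_id)
  then have cor: "corolla \<Gamma>"
    using edges by (simp add: corolla_def) (simp add: \<Gamma>_def)
  have "map (\<lambda>h. fst (concat ws ! h)) [0..<n] = map fst (concat ws)"
    by (rule nth_equalityI) (simp_all add: n_def)
  then have "map (col \<Gamma>) (concat hs) = concat (map (map fst) ws)"
    by (simp add: hs(1) \<Gamma>_def map_concat)
  then have "map (map (col \<Gamma>)) hs = map (map fst) ws"
    by (intro map_map_eq_if_concat_eq) (simp_all add: hs(2))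
  then have "hs \<in> placements \<Gamma> ws"
    unfolding placements_corolla[OF cor ws(1)] using s(2) set_hs
    by (simp add: \<Gamma>_def del: set_concat)
  then show thesis
    using that[OF cor _ _ _ one] by (auto simp: \<Gamma>_def)
qed

text \<open>On two letters the Hamiltonian pairs \<open>m_1\<close> of the first with the second,
  and \<open>m_1 = 0\<close>; on shorter words it is 0 by definition. This is the counterpart of the
  valence bound at trivial vertices.\<close>

lemma hamiltonian_short:
  fixes C :: "('o, 'k::field_char_0, 'v::ab_group_add) ainf"
  assumes "cyclic_ainf_category d C" "length w < 3"
  shows "hamiltonian d C [w] = 0"
proof (cases "cword C w \<and> length w \<ge> 2 \<and> sdegs w = d - 3")
  case True
  then have "length w = 2"
    using assms(2) by simp
  then obtain x y where w: "w = [x, y]"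
    by (cases w; cases "tl w") auto
  obtain a i u b j v where x: "x = (a, i, u)" and y: "y = (b, j, v)"
    using prod_cases3 by metis
  \<comment> \<open>The degree condition puts \<open>v\<close> in the degree dual to that of the
    product, where the pairing is linear.\<close>
  have deg: "j = d - (i + 1)"
    using True by (simp add: w x y sdeg_def)
  have path: "u \<in> Hom C a b i" "v \<in> Hom C b a j"
    using True by (auto simp: w x y cword_def is_path_Cons tgt_def)
  have "mult C [x] b = 0"
    using assms(1) path unfolding cyclic_ainf_category_def ainf_category_def
    by (auto simp: x is_path_Cons tgt_def)
  moreover have "pair C a b (i + 1) 0 v = 0"
  proof -
    have V: "vector_space (smul C)" "module.subspace (smul C) (Hom C a b (i + 1))"
      and lin: "lin_on (smul C) (*) (Hom C a b (i + 1)) (\<lambda>u. pair C a b (i + 1) u v)"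
      using assms(1) path(2) by (simp_all add: deg cyclic_ainf_category_def cyclic_complexes_def)
    then interpret vector_space "smul C" by simp
    have "0 \<in> Hom C a b (i + 1)"
      using V(2) subspace_0 by blast
    then have "pair C a b (i + 1) (smul C 0 0) v = 0 * pair C a b (i + 1) 0 v"
      using lin unfolding lin_on_def by blast
    then show ?thesis
      by simp
  qed
  then have "pair C a b (1 + i) 0 v = 0"
    by (simp only: add.commute)
  ultimately show ?thesis
    using True by (simp add: hamiltonian_def w x y mult_arrow_def sdeg_def)
next
  case False
  then show ?thesis
    by (auto simp: hamiltonian_def)
qed

theorem theoremF:
  fixes d :: int
    and C :: "('o, 'k::field_char_0, 'v::ab_group_add) ainf"
    and I :: "('o, 'v) arrow list list \<Rightarrow> 'k"
    and Iq :: "('o, 'k, 'v) functional"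
  assumes "odd d"
    and "cyclic_ainf_category d C"
    and "V\<^sub>B = complexes.truncate C"
    and "I = hamiltonian d C" and "I \<in> MCE_fr d V\<^sub>B"
    and "is_quantization d C Iq"
  shows "\<exists>(D :: 'o rgraph \<Rightarrow> 'k) (S :: ('o, 'k) cochain).
           D \<in> MCE_RT d \<and> S \<in> MCE_sRG d \<and>
           tree_proj S = D \<and>
           rho_tree d V\<^sub>B I D = I \<and> rho d V\<^sub>B Iq S = Iq \<and>
           D = sum_of_classes {\<Gamma>. ribbon_tree \<Gamma> \<and> card (vts \<Gamma>) = 1 \<and> edges \<Gamma> = {} \<and>
                 card (leaves \<Gamma>) > 2} \<and>
           S = (\<lambda>k. if k = 0
                 then sum_of_classes {\<Gamma>. stable_ribbon_graph \<Gamma> \<and> card (vts \<Gamma>) = 1 \<and> edges \<Gamma> = {} \<and>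
                   card (leaves \<Gamma>) > 0}
                 else (\<lambda>_. 0))"
proof -
  let ?D = "\<lambda>\<Gamma>. of_bool (tree_corolla \<Gamma>) :: 'k"
  let ?S = "corolla_sum corolla :: ('o, 'k) cochain"
  have proj: "tree_proj ?S = ?D"
    by (auto simp: fun_eq_iff tree_proj_def tree_incl_def tree_corolla_iff)
  have rho_tree: "rho_tree d V\<^sub>B I ?D = I"
  proof
    fix ws
    have F: "fr_incl I \<in> functional_space V\<^sub>B"
      using assms(5) by (simp add: MCE_fr_def)
    have "rho d V\<^sub>B (fr_incl I) (corolla_sum tree_corolla) 0 {#} ws = fr_incl I 0 {#} ws"
    proof (rule rho_corolla_sum[OF _ tree_corolla_iso F])
      show "corolla \<Gamma>" if "tree_corolla \<Gamma>" for \<Gamma> :: "'o rgraph"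
        using that by (simp add: tree_corolla_def)
      assume nz: "fr_incl I 0 {#} ws \<noteq> 0"
      then have I: "hamiltonian d C ws \<noteq> 0"
        by (simp add: fr_incl_def assms(4))
      then obtain w where w: "ws = [w]"
        by (auto simp: hamiltonian_def split: list.splits)
      have "length w \<ge> 3"
        using I hamiltonian_short[OF assms(2), of w] w by (metis not_less)
      have "cwords V\<^sub>B ws"
        using nz functional_space_support[OF F] by blast
      then obtain \<Gamma> where "corolla \<Gamma>" "gdf \<Gamma> (hes \<Gamma>) = 0" "bdf \<Gamma> (hes \<Gamma>) = {#}"
          "placements \<Gamma> ws \<noteq> {}" "card (cyc \<Gamma> ` hes \<Gamma>) = 1"
        by (rule corolla_exists[where g = 0 and b = "{#}"]) (use w \<open>length w \<ge> 3\<close> in auto)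
      then show "\<exists>\<Gamma>. tree_corolla \<Gamma> \<and> gdf \<Gamma> (hes \<Gamma>) = 0 \<and> bdf \<Gamma> (hes \<Gamma>) = {#} \<and> placements \<Gamma> ws \<noteq> {}"
        by (auto simp: tree_corolla_def corolla_vts)
    qed
    then show "rho_tree d V\<^sub>B I ?D ws = I ws"
      by (simp add: rho_tree_def fr_incl_def)
  qed
  have rho: "rho d V\<^sub>B Iq ?S g b ws = Iq g b ws" for g b ws
  proof (rule rho_corolla_sum[OF _ corolla_iso])
    show F: "Iq \<in> functional_space V\<^sub>B"
      using assms(3,6) by (simp add: is_quantization_def MCE_pq_def)
    assume nz: "Iq g b ws \<noteq> 0"
    \<comment> \<open>A corolla carries at least one word, so the components without words must
      vanish: there are no constant terms.\<close>
    then have nonempty: "ws \<noteq> []"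
      using assms(6) by (auto simp: is_quantization_def)
    have cwords: "cwords V\<^sub>B ws"
      using nz functional_space_support[OF F] by blast
    \<comment> \<open>The corolla would have trivial defects and one cycle. Such a component is part
      of the Hamiltonian, which vanishes on short words.\<close>
    have long: "length (hd ws) \<ge> 3" if "g = 0" "b = {#}" "length ws = 1"
    proof -
      have "(\<lambda>ws. if length ws = 1 then Iq 0 {#} ws else 0) = hamiltonian d C"
        using assms(6) by (simp add: is_quantization_def)
      from fun_cong[OF this, of ws] have "hamiltonian d C ws \<noteq> 0"
        using nz that by simp
      moreover have "ws = [hd ws]"
        using that(3) by (cases ws) auto
      ultimately show ?thesis
        using hamiltonian_short[OF assms(2), of "hd ws"] by (metis not_less)
    qed
    show "\<exists>\<Gamma>. corolla \<Gamma> \<and> gdf \<Gamma> (hes \<Gamma>) = g \<and> bdf \<Gamma> (hes \<Gamma>) = b \<and> placements \<Gamma> ws \<noteq> {}"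
      by (rule corolla_exists[OF cwords nonempty long]) blast+
  qed
  have "rho d V\<^sub>B Iq ?S = Iq"
    by (intro ext rho)
  moreover have "?S = (\<lambda>k. if k = 0 then \<lambda>\<Gamma>. of_bool (corolla \<Gamma>) else (\<lambda>_. 0))"
    by (simp add: fun_eq_iff tree_incl_def)
  ultimately show ?thesis
    unfolding sum_of_classes_corolla sum_of_classes_tree_corolla
    by (intro exI[of _ ?D] exI[of _ ?S] conjI tree_corolla_sum_MCE corolla_sum_MCE proj rho_tree
        refl)
qed

end
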